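(* Suppose that the Regularity assumption, the Oracle assumption and the Parameter assumption of the context hold, and fix an integer $K\ge2$. Run stochastic NR-LALM with the projected SPIDER estimator and the parameters $$B=K,\qquad Q=\lceil\sqrt K\rceil,\qquad b=\max\{1,\lceil2D_1L_s^2Q\rceil\},$$ and suppose that, almost surely, its iterates remain in the regularity region up to iteration $K$ (i.e. almost surely $[x_k,x_{k+1}]\subset\mathcal U$ for all $0\le k\le K-1$). Let $\widehat k$ be independent of the oracle samples and uniform on $\{1,\ldots,K-1\}$. Then $$\mathbb E[\mathcal R_{\widehat k+1}^2]\le\frac{C_{\mathrm{st}}}{K-1},$$ where the expectation is over both the oracle samples and $\widehat k$, and $C_{\mathrm{st}}$ is independent of $K$ and $\varepsilon$. Consequently, for $\varepsilon>0$, if $K-1\ge C_{\mathrm{st}}\varepsilon^{-2}$, then $(x_{\widehat k+1},\lambda_{\widehat k+1})$ is a stochastic $\varepsilon$-KKT pair. Hence the iteration, deterministic constraint/Jacobian evaluation, and exact linear-system solve complexities are $\mathcal O(\varepsilon^{-2})$, whereas the stochastic-gradient complexity is $\mathcal O(\varepsilon^{-3})$.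
   Context: Problem: minimize $f(x)$ over $x\in\mathbb R^n$ subject to $c(x)=0$, with $f:\mathbb R^n\to\mathbb R$, $c:\mathbb R^n\to\mathbb R^m$. Norms are Euclidean for vectors and spectral for matrices; $\nabla c(x):=(\nabla c_1(x),\ldots,\nabla c_m(x))\in\mathbb R^{n\times m}$. All random variables are assumed measurable. The KKT residual is $\mathcal R(x,\lambda):=(\|\nabla f(x)+\nabla c(x)\lambda\|^2+\|c(x)\|^2)^{1/2}$, and $\mathcal R_k:=\mathcal R(x_k,\lambda_k)$. A random pair $(x,\lambda)$ is a stochastic $\varepsilon$-KKT pair if $\mathbb E\|\nabla f(x)+\nabla c(x)\lambda\|^2\le\varepsilon^2$ and $\mathbb E\|c(x)\|^2\le\varepsilon^2$. Regularity assumption: $f$ and $c$ are continuously differentiable on a nonempty open set $\mathcal U\subseteq\mathbb R^n$, and there are $\underline f\in\mathbb R$ and positive constants $G,L_f,M,L_c,\sigma$ such that for all $x,y\in\mathcal U$ and $u\in\mathbb R^m$: (i) $f(x)\ge\underline f$, $\|\nabla f(x)\|\le G$, $\|\nabla f(x)-\nabla f(y)\|\le L_f\|x-y\|$; (ii) $\|\nabla c(x)\|\le M$, $\|\nabla c(x)-\nabla c(y)\|\le L_c\|x-y\|$; (iii) $\|\nabla c(x)u\|\ge\sigma\|u\|$. Oracle assumption: $f(x)=\mathbb E[F(x;\xi)]$ for $x\in\mathcal U$; for almost every $\xi$, $F(\cdot;\xi)$ is differentiable on $\mathcal U$; and there are $\sigma_f,L_s\ge0$ such that for all $x,y\in\mathcal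 U$: (i) $\mathbb E[\nabla F(x;\xi)]=\nabla f(x)$ and $\mathbb E\|\nabla F(x;\xi)-\nabla f(x)\|^2\le\sigma_f^2$; (ii) $\mathbb E\|\nabla F(x;\xi)-\nabla F(y;\xi)\|^2\le L_s^2\|x-y\|^2$. Constants: $\kappa_{\mathrm{lin}}:=L_c/2$ and, for $\beta,\rho,\Delta,\Lambda>0$, $$C_{\mathrm{mod}}:=\frac{L_f}{2}+\kappa_{\mathrm{lin}}(3\Lambda+\rho M\Delta)+\frac{\rho}{2}\kappa_{\mathrm{lin}}^2\Delta^2,\quad A_p:=\beta+\rho M\kappa_{\mathrm{lin}}\Delta,\quad B_p:=A_p+L_f+L_c\Lambda,\quad C_{\lambda,p}:=\frac{4}{\sigma^2}\max\{A_p^2,B_p^2\},$$ $$C_{\lambda,e}:=\frac4{\sigma^2},\quad C_e^\star:=\frac2\beta+\frac{C_{\lambda,e}}\rho,\quad C_s:=\beta+\rho M\kappa_{\mathrm{lin}}\Delta+L_f+L_c\Lambda,$$ $$\overline\Phi_1:=f(x_0)+G\Delta+\frac{4\Lambda^2}{\rho}+\frac{C_{\lambda,p}}{\rho}\Delta^2,\quad \underline\Phi:=\underline f-\frac{\Lambda^2}{2\rho},\quad D_0:=\Delta^2+\frac{4(\overline\Phi_1-\underline\Phi)}{\beta},\quad D_1:=\frac{8C_e^\star}{\beta},$$ $$C_R^{\mathrm{st}}:=\max\left\{2C_s^2+\frac{C_{\lambda,p}}{\rho^2},2+\frac{C_{\lambda,e}}{\rho^2}\right\},\quad \Gamma_e:=2\sigma_f^2+\frac{D_0}{D_1},\quad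 \Gamma_p:=2D_1\sigma_f^2+2D_0,\quad C_{\mathrm{st}}:=2C_R^{\mathrm{st}}(\Gamma_p+\Gamma_e).$$ Parameter assumption: the fixed constants $\beta,\rho,\Delta,\Lambda>0$, independent of the target accuracy $\varepsilon$, satisfy $$\Lambda\ge\frac{G+\beta\Delta+\rho M\kappa_{\mathrm{lin}}\Delta^2}{\sigma},\quad \frac{G}{\beta}+\frac{3M\Lambda}{\beta+\rho\sigma^2}\le\Delta,\quad C_{\mathrm{mod}}\le\frac{3\beta}{8},\quad \rho\ge\frac{8C_{\lambda,p}}{\beta},$$ and the initial pair satisfies $\|\lambda_0\|\le\Lambda$ and $\rho\|c(x_0)\|\le\Lambda$. Stochastic NR-LALM with projected SPIDER (positive integers $Q,B,b$): start from $(x_0,\lambda_0)$. Let $\mathcal G_k$ be the $\sigma$-algebra generated by the algorithmic history before the $k$th batch is sampled. At iteration $k$, draw a batch $\{\xi_{k,i}\}$ of independent copies of $\xi$, independent of $\mathcal G_k$, of size $B$ if $k\equiv0\pmod Q$ and of size $b$ otherwise, and set $$h_k=\begin{cases}\frac1B\sum_{i=1}^B\nabla F(x_k;\xi_{k,i}),&k\equiv0\pmod Q,\\ h_{k-1}+\frac1b\sum_{i=1}^b[\nabla F(x_k;\xi_{k,i})-\nabla F(x_{k-1};\xi_{k,i})],&\text{otherwise},\end{cases}$$ $v_k:=\operatorname{Proj}_{\{w:\|w\|\le G\}}(h_k)$. Then $p_k$ solves $(\beta I_n+\rho\nabla c(x_k)\nabla c(x_k)^\top)p_k=-v_k-\nabla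 c(x_k)(\lambda_k+\rho c(x_k))$, and $x_{k+1}=x_k+p_k$, $\lambda_{k+1}=\lambda_k+\rho c(x_{k+1})$. Cost accounting: an iteration with $k\equiv0\pmod Q$ costs $B$ stochastic-gradient evaluations, any other iteration costs $2b$; besides the initial evaluation of $c(x_0)$, each iteration uses one evaluation of $\nabla c(x_k)$, one of $c(x_{k+1})$, and one linear-system solve. *)

theory Defs
  imports "HOL-Probability.Probability" "HOL-Library.Landau_Symbols"
begin

section \<open>Gradients, Jacobians and the KKT residual\<close>

definition grad :: "('a::real_inner \<Rightarrow> real) \<Rightarrow> 'a \<Rightarrow> 'a" where
  "grad f x = (THE d. GDERIV f x :> d)"

text \<open>The columns are the gradients of the components of \<open>c\<close>, so for \<open>c\<close> from n-space to
  m-space this is an n-by-m matrix, the transpose of the usual Jacobian.\<close>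
definition gradc :: "(real^'n \<Rightarrow> real^'m) \<Rightarrow> real^'n \<Rightarrow> real^'m^'n" where
  "gradc c x = (\<chi> i j. grad (\<lambda>y. c y $ j) x $ i)"

text \<open>\<open>norm\<close> on matrices is the Frobenius norm; the spectral norm is the operator norm.\<close>
definition specnorm :: "real^'m^'n \<Rightarrow> real" where
  "specnorm A = onorm (\<lambda>u. A *v u)"

definition kkt_grad :: "(real^'n \<Rightarrow> real) \<Rightarrow> (real^'n \<Rightarrow> real^'m) \<Rightarrow> real^'n \<Rightarrow> real^'m \<Rightarrow> real^'n" where
  "kkt_grad f c x l = grad f x + gradc c x *v l"

definition kkt_residual :: "(real^'n \<Rightarrow> real) \<Rightarrow> (real^'n \<Rightarrow> real^'m) \<Rightarrow> real^'n \<Rightarrow> real^'m \<Rightarrow> real" where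
  "kkt_residual f c x l = sqrt ((norm (kkt_grad f c x l))\<^sup>2 + (norm (c x))\<^sup>2)"

text \<open>Expectations of nonnegative quantities are taken in the extended nonnegative reals, so an
  upper bound also asserts finiteness (a Bochner integral would be 0 in the non-integrable case).\<close>
definition stochastic_KKT ::
  "'w measure \<Rightarrow> (real^'n \<Rightarrow> real) \<Rightarrow> (real^'n \<Rightarrow> real^'m) \<Rightarrow> real \<Rightarrow>
   ('w \<Rightarrow> real^'n) \<Rightarrow> ('w \<Rightarrow> real^'m) \<Rightarrow> bool" where
  "stochastic_KKT M f c e X L \<longleftrightarrow>
     X \<in> borel_measurable M \<and> L \<in> borel_measurable M \<and>
     (\<integral>\<^sup>+ \<omega>. ennreal ((norm (kkt_grad f c (X \<omega>) (L \<omega>)))\<^sup>2) \<partial>M) \<le> ennreal (e\<^sup>2) \<and>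
     (\<integral>\<^sup>+ \<omega>. ennreal ((norm (c (X \<omega>)))\<^sup>2) \<partial>M) \<le> ennreal (e\<^sup>2)"


section \<open>Constants\<close>

text \<open>Lower bound of \<open>f\<close>, the constants G, L_f, M, L_c, sigma of the regularity assumption,
  sigma_f and L_s of the stochastic-gradient assumption, and the algorithm parameters
  beta, rho, Delta, Lambda.\<close>
record lalm_consts =
  f_low :: real
  G_f :: real
  L_f :: real
  M_c :: real
  L_c :: real
  sigma_c :: real
  sigma_f :: real
  L_s :: real
  beta :: real
  rho :: real
  Delta :: real
  Lambda :: real

definition kappa_lin :: "lalm_consts \<Rightarrow> real" where
  "kappa_lin P = L_c P / 2"

definition C_mod :: "lalm_consts \<Rightarrow> real" where
  "C_mod P = L_f P / 2 + kappa_lin P * (3 * Lambda P + rho P * M_c P * Delta P)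
     + rho P / 2 * (kappa_lin P)\<^sup>2 * (Delta P)\<^sup>2"

definition A_p :: "lalm_consts \<Rightarrow> real" where
  "A_p P = beta P + rho P * M_c P * kappa_lin P * Delta P"

definition B_p :: "lalm_consts \<Rightarrow> real" where
  "B_p P = A_p P + L_f P + L_c P * Lambda P"

definition C_lambda_p :: "lalm_consts \<Rightarrow> real" where
  "C_lambda_p P = 4 / (sigma_c P)\<^sup>2 * max ((A_p P)\<^sup>2) ((B_p P)\<^sup>2)"

definition C_lambda_e :: "lalm_consts \<Rightarrow> real" where
  "C_lambda_e P = 4 / (sigma_c P)\<^sup>2"

definition C_e_star :: "lalm_consts \<Rightarrow> real" where
  "C_e_star P = 2 / beta P + C_lambda_e P / rho P"

definition C_s :: "lalm_consts \<Rightarrow> real" where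
  "C_s P = beta P + rho P * M_c P * kappa_lin P * Delta P + L_f P + L_c P * Lambda P"

text \<open>In the following constants, \<open>f0\<close> stands for the initial objective value \<open>f x0\<close>.\<close>

definition Phi_upper :: "lalm_consts \<Rightarrow> real \<Rightarrow> real" where
  "Phi_upper P f0 = f0 + G_f P * Delta P + 4 * (Lambda P)\<^sup>2 / rho P
     + C_lambda_p P / rho P * (Delta P)\<^sup>2"

definition Phi_lower :: "lalm_consts \<Rightarrow> real" where
  "Phi_lower P = f_low P - (Lambda P)\<^sup>2 / (2 * rho P)"

definition D_0 :: "lalm_consts \<Rightarrow> real \<Rightarrow> real" where
  "D_0 P f0 = (Delta P)\<^sup>2 + 4 * (Phi_upper P f0 - Phi_lower P) / beta P"

definition D_1 :: "lalm_consts \<Rightarrow> real" where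
  "D_1 P = 8 * C_e_star P / beta P"

definition C_R_st :: "lalm_consts \<Rightarrow> real" where
  "C_R_st P = max (2 * (C_s P)\<^sup>2 + C_lambda_p P / (rho P)\<^sup>2) (2 + C_lambda_e P / (rho P)\<^sup>2)"

definition Gamma_e :: "lalm_consts \<Rightarrow> real \<Rightarrow> real" where
  "Gamma_e P f0 = 2 * (sigma_f P)\<^sup>2 + D_0 P f0 / D_1 P"

definition Gamma_p :: "lalm_consts \<Rightarrow> real \<Rightarrow> real" where
  "Gamma_p P f0 = 2 * D_1 P * (sigma_f P)\<^sup>2 + 2 * D_0 P f0"

definition C_st :: "lalm_consts \<Rightarrow> real \<Rightarrow> real" where
  "C_st P f0 = 2 * C_R_st P * (Gamma_p P f0 + Gamma_e P f0)"


section \<open>Assumptions\<close>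

definition regularity_assumption ::
  "lalm_consts \<Rightarrow> (real^'n) set \<Rightarrow> (real^'n \<Rightarrow> real) \<Rightarrow> (real^'n \<Rightarrow> real^'m) \<Rightarrow> bool" where
  "regularity_assumption P U f c \<longleftrightarrow>
     open U \<and> U \<noteq> {} \<and>
     (\<forall>x\<in>U. f differentiable (at x)) \<and> continuous_on U (grad f) \<and>
     (\<forall>x\<in>U. c differentiable (at x)) \<and> continuous_on U (gradc c) \<and>
     0 < G_f P \<and> 0 < L_f P \<and> 0 < M_c P \<and> 0 < L_c P \<and> 0 < sigma_c P \<and>
     (\<forall>x\<in>U. f_low P \<le> f x \<and> norm (grad f x) \<le> G_f P \<and> specnorm (gradc c x) \<le> M_c P) \<and>
     (\<forall>x\<in>U. \<forall>y\<in>U. norm (grad f x - grad f y) \<le> L_f P * norm (x - y) \<and>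
        specnorm (gradc c x - gradc c y) \<le> L_c P * norm (x - y)) \<and>
     (\<forall>x\<in>U. \<forall>u. sigma_c P * norm u \<le> norm (gradc c x *v u))"

text \<open>\<open>D\<close> is the law of the sample \<open>\<xi>\<close>.\<close>
definition oracle_assumption ::
  "lalm_consts \<Rightarrow> (real^'n) set \<Rightarrow> (real^'n \<Rightarrow> real) \<Rightarrow>
   's measure \<Rightarrow> (real^'n \<Rightarrow> 's \<Rightarrow> real) \<Rightarrow> bool" where
  "oracle_assumption P U f D F \<longleftrightarrow>
     prob_space D \<and>
     (\<forall>x\<in>U. integrable D (F x) \<and> f x = (\<integral>s. F x s \<partial>D)) \<and>
     (AE s in D. \<forall>x\<in>U. (\<lambda>y. F y s) differentiable (at x)) \<and>
     0 \<le> sigma_f P \<and> 0 \<le> L_s P \<and>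
     (\<forall>x\<in>U. integrable D (\<lambda>s. grad (\<lambda>y. F y s) x) \<and>
        (\<integral>s. grad (\<lambda>y. F y s) x \<partial>D) = grad f x \<and>
        (\<integral>\<^sup>+ s. ennreal ((norm (grad (\<lambda>y. F y s) x - grad f x))\<^sup>2) \<partial>D) \<le> ennreal ((sigma_f P)\<^sup>2)) \<and>
     (\<forall>x\<in>U. \<forall>y\<in>U.
        (\<integral>\<^sup>+ s. ennreal ((norm (grad (\<lambda>z. F z s) x - grad (\<lambda>z. F z s) y))\<^sup>2) \<partial>D)
          \<le> ennreal ((L_s P)\<^sup>2 * (norm (x - y))\<^sup>2))"

definition parameter_assumption ::
  "lalm_consts \<Rightarrow> (real^'n \<Rightarrow> real^'m) \<Rightarrow> real^'n \<Rightarrow> real^'m \<Rightarrow> bool" where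
  "parameter_assumption P c x0 l0 \<longleftrightarrow>
     0 < beta P \<and> 0 < rho P \<and> 0 < Delta P \<and> 0 < Lambda P \<and>
     Lambda P \<ge> (G_f P + beta P * Delta P + rho P * M_c P * kappa_lin P * (Delta P)\<^sup>2) / sigma_c P \<and>
     G_f P / beta P + 3 * M_c P * Lambda P / (beta P + rho P * (sigma_c P)\<^sup>2) \<le> Delta P \<and>
     C_mod P \<le> 3 * beta P / 8 \<and>
     rho P \<ge> 8 * C_lambda_p P / beta P \<and>
     norm l0 \<le> Lambda P \<and> rho P * norm (c x0) \<le> Lambda P"


section \<open>Stochastic NR-LALM with projected SPIDER\<close>

definition batch_size :: "nat \<Rightarrow> nat \<Rightarrow> nat \<Rightarrow> nat \<Rightarrow> nat" where
  "batch_size Q B b k = (if k mod Q = 0 then B else b)"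

text \<open>One realization of the first \<open>K\<close> iterations: \<open>s k i\<close> is the value of the \<open>i\<close>-th sample of
  batch \<open>k\<close> (numbered from 0), \<open>x\<close>, \<open>l\<close> the primal and dual iterates, \<open>h\<close> the unprojected
  gradient estimators. The matrix of the linear system is positive definite, so \<open>p\<close> is unique.\<close>
definition nr_lalm_path ::
  "lalm_consts \<Rightarrow> (real^'n \<Rightarrow> real^'m) \<Rightarrow> (real^'n \<Rightarrow> 's \<Rightarrow> real) \<Rightarrow> real^'n \<Rightarrow> real^'m \<Rightarrow>
   nat \<Rightarrow> nat \<Rightarrow> nat \<Rightarrow> nat \<Rightarrow> (nat \<Rightarrow> nat \<Rightarrow> 's) \<Rightarrow>
   (nat \<Rightarrow> real^'n) \<Rightarrow> (nat \<Rightarrow> real^'m) \<Rightarrow> (nat \<Rightarrow> real^'n) \<Rightarrow> bool" where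
  "nr_lalm_path P c F x0 l0 Q B b K s x l h \<longleftrightarrow>
     x 0 = x0 \<and> l 0 = l0 \<and>
     (\<forall>k<K.
        h k = (if k mod Q = 0
               then (1 / real B) *\<^sub>R (\<Sum>i<B. grad (\<lambda>y. F y (s k i)) (x k))
               else h (k - 1) + (1 / real b) *\<^sub>R
                 (\<Sum>i<b. grad (\<lambda>y. F y (s k i)) (x k) - grad (\<lambda>y. F y (s k i)) (x (k - 1)))) \<and>
        (let v = closest_point (cball 0 (G_f P)) (h k); A = gradc c (x k) in
         \<exists>p. (beta P *\<^sub>R mat 1 + rho P *\<^sub>R (A ** transpose A)) *v p
                = - v - A *v (l k + rho P *\<^sub>R c (x k)) \<and>
             x (k + 1) = x k + p \<and>
             l (k + 1) = l k + rho P *\<^sub>R c (x (k + 1))))"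

text \<open>The sigma-algebra generated by the samples of the batches with index in \<open>J\<close>, where batch
  \<open>k\<close> has \<open>N k\<close> samples.\<close>
definition sample_algebra ::
  "'w measure \<Rightarrow> 's measure \<Rightarrow> (nat \<Rightarrow> nat) \<Rightarrow> (nat \<Rightarrow> nat \<Rightarrow> 'w \<Rightarrow> 's) \<Rightarrow> nat set \<Rightarrow> 'w set set" where
  "sample_algebra M D N xi J =
     sigma_sets (space M) (\<Union>k\<in>J. \<Union>i<N k. sets (vimage_algebra (space M) (xi k i) D))"

text \<open>The sigma-algebra of the algorithmic history before batch \<open>k\<close> is sampled. It is generated
  by the samples of earlier batches together with all quantities computed so far.\<close>
definition history_algebra ::
  "'w measure \<Rightarrow> 's measure \<Rightarrow> (nat \<Rightarrow> nat) \<Rightarrow> (nat \<Rightarrow> nat \<Rightarrow> 'w \<Rightarrow> 's) \<Rightarrow>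
   (nat \<Rightarrow> 'w \<Rightarrow> real^'n) \<Rightarrow> (nat \<Rightarrow> 'w \<Rightarrow> real^'m) \<Rightarrow> (nat \<Rightarrow> 'w \<Rightarrow> real^'n) \<Rightarrow> nat \<Rightarrow> 'w set set" where
  "history_algebra M D N xi x l h k =
     sigma_sets (space M)
       (sample_algebra M D N xi {..<k}
        \<union> (\<Union>j\<le>k. sets (vimage_algebra (space M) (x j) borel))
        \<union> (\<Union>j\<le>k. sets (vimage_algebra (space M) (l j) borel))
        \<union> (\<Union>j<k. sets (vimage_algebra (space M) (h j) borel)))"

definition stochastic_nr_lalm ::
  "lalm_consts \<Rightarrow> (real^'n \<Rightarrow> real^'m) \<Rightarrow> 's measure \<Rightarrow> (real^'n \<Rightarrow> 's \<Rightarrow> real) \<Rightarrow>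
   real^'n \<Rightarrow> real^'m \<Rightarrow> nat \<Rightarrow> nat \<Rightarrow> nat \<Rightarrow> nat \<Rightarrow>
   'w measure \<Rightarrow> (nat \<Rightarrow> nat \<Rightarrow> 'w \<Rightarrow> 's) \<Rightarrow>
   (nat \<Rightarrow> 'w \<Rightarrow> real^'n) \<Rightarrow> (nat \<Rightarrow> 'w \<Rightarrow> real^'m) \<Rightarrow> (nat \<Rightarrow> 'w \<Rightarrow> real^'n) \<Rightarrow> bool" where
  "stochastic_nr_lalm P c D F x0 l0 Q B b K M xi x l h \<longleftrightarrow>
     prob_space M \<and>
     (\<forall>k\<le>K. x k \<in> borel_measurable M \<and> l k \<in> borel_measurable M) \<and>
     (\<forall>k<K. h k \<in> borel_measurable M) \<and>
     (\<forall>k<K. \<forall>i<batch_size Q B b k. xi k i \<in> measurable M D \<and> distr M D (xi k i) = D) \<and>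
     (\<forall>k<K. prob_space.indep_vars M (\<lambda>_. D) (xi k) {..<batch_size Q B b k}) \<and>
     (\<forall>k<K. prob_space.indep_set M
        (sample_algebra M D (batch_size Q B b) xi {k})
        (history_algebra M D (batch_size Q B b) xi x l h k)) \<and>
     (AE \<omega> in M. nr_lalm_path P c F x0 l0 Q B b K
        (\<lambda>k i. xi k i \<omega>) (\<lambda>k. x k \<omega>) (\<lambda>k. l k \<omega>) (\<lambda>k. h k \<omega>))"

definition uniform_output_index ::
  "'w measure \<Rightarrow> 's measure \<Rightarrow> (nat \<Rightarrow> nat) \<Rightarrow> (nat \<Rightarrow> nat \<Rightarrow> 'w \<Rightarrow> 's) \<Rightarrow> nat \<Rightarrow> ('w \<Rightarrow> nat) \<Rightarrow> bool" where
  "uniform_output_index M D N xi K kh \<longleftrightarrow>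
     kh \<in> measurable M (count_space {1..K - 1}) \<and>
     distr M (count_space {1..K - 1}) kh = uniform_count_measure {1..K - 1} \<and>
     prob_space.indep_set M
       (sets (vimage_algebra (space M) kh (count_space {1..K - 1})))
       (sample_algebra M D N xi {..<K})"

definition epoch_length :: "nat \<Rightarrow> nat" where
  "epoch_length K = nat \<lceil>sqrt (real K)\<rceil>"

definition minibatch :: "lalm_consts \<Rightarrow> nat \<Rightarrow> nat" where
  "minibatch P K = max 1 (nat \<lceil>2 * D_1 P * (L_s P)\<^sup>2 * real (epoch_length K)\<rceil>)"

text \<open>A run over \<open>K\<close> iterations with \<open>B = K\<close> and the above \<open>Q\<close>, \<open>b\<close>, whose iterates almost
  surely remain in the regularity region, together with the random output index.\<close>
definition admissible_run ::
  "lalm_consts \<Rightarrow> (real^'n) set \<Rightarrow> (real^'n \<Rightarrow> real^'m) \<Rightarrow> 's measure \<Rightarrow> (real^'n \<Rightarrow> 's \<Rightarrow> real) \<Rightarrow>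
   real^'n \<Rightarrow> real^'m \<Rightarrow> nat \<Rightarrow> 'w measure \<Rightarrow> (nat \<Rightarrow> nat \<Rightarrow> 'w \<Rightarrow> 's) \<Rightarrow>
   (nat \<Rightarrow> 'w \<Rightarrow> real^'n) \<Rightarrow> (nat \<Rightarrow> 'w \<Rightarrow> real^'m) \<Rightarrow> (nat \<Rightarrow> 'w \<Rightarrow> real^'n) \<Rightarrow> ('w \<Rightarrow> nat) \<Rightarrow> bool" where
  "admissible_run P U c D F x0 l0 K M xi x l h kh \<longleftrightarrow>
     stochastic_nr_lalm P c D F x0 l0 (epoch_length K) K (minibatch P K) K M xi x l h \<and>
     (AE \<omega> in M. \<forall>k<K. closed_segment (x k \<omega>) (x (k + 1) \<omega>) \<subseteq> U) \<and>
     uniform_output_index M D (batch_size (epoch_length K) K (minibatch P K)) xi K kh"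


section \<open>Complexity\<close>

definition sgrad_evals :: "nat \<Rightarrow> nat \<Rightarrow> nat \<Rightarrow> nat \<Rightarrow> nat" where
  "sgrad_evals Q B b K = (\<Sum>k<K. if k mod Q = 0 then B else 2 * b)"

text \<open>One evaluation at the initial point, then one at the new point of every iteration.\<close>
definition constraint_evals :: "nat \<Rightarrow> nat" where
  "constraint_evals K = 1 + (\<Sum>k<K. 1)"

definition jacobian_evals :: "nat \<Rightarrow> nat" where
  "jacobian_evals K = (\<Sum>k<K. 1)"

definition linear_solves :: "nat \<Rightarrow> nat" where
  "linear_solves K = (\<Sum>k<K. 1)"

text \<open>The smallest number of iterations that is sufficient for accuracy \<open>e\<close> when the expected
  squared residual is at most \<open>C / (K - 1)\<close>.\<close>
definition horizon :: "real \<Rightarrow> real \<Rightarrow> nat" where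
  "horizon C e = (LEAST K. 2 \<le> K \<and> C / e\<^sup>2 \<le> real K - 1)"

end

theory Submission
  imports Defs
begin

text \<open>On each path the augmented Lagrangian decreases: the primal step lowers it by a multiple of the
  squared step up to the squared gradient error, and the dual step raises it by the squared multiplier
  increment divided by \<open>\<rho>\<close>, which the full-rank Jacobian bounds by two consecutive squared steps and
  errors. Telescoping gives \<open>S\<^sub>p \<le> D\<^sub>0 + D\<^sub>1 S\<^sub>e\<close> for the sums \<open>S\<^sub>p\<close>, \<open>S\<^sub>e\<close> of the squared steps and
  errors. In the other direction, a batch is independent of the history, so the variance of the
  recursive estimator grows by at most \<open>L\<^sub>s\<^sup>2 / b\<close> times the expected squared step between restarts;
  with the chosen batch sizes \<open>E S\<^sub>e \<le> \<sigma>\<^sub>f\<^sup>2 + E S\<^sub>p / (2 D\<^sub>1)\<close>. The two inequalities bound both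
  expectations independently of \<open>K\<close>, and the squared residual at \<open>k + 1\<close> is at most \<open>C_R_st\<close> times
  the steps and errors at \<open>k\<close> and \<open>k - 1\<close>.\<close>

section \<open>Gradients and matrices\<close>

text \<open>The Lagrangian estimate requires bounds on steps, multipliers and constraint values that
  hold on every path, although the sampling errors are unbounded. The projection supplies them: the
  direction \<open>v\<close> stays in the ball of radius G, and the linear system with its full-rank
  Jacobian then propagates the bounds \<Delta>, \<Lambda> and 2 \<Lambda> / \<rho> by induction. As
  it is nonexpansive and fixes the true gradient, it never increases the error, so the variance
  recursion can be run for the unprojected estimator. The batch size \<open>b\<close> is tuned so
  that the product of the two coupling factors between steps and errors is at most 1/2, which closes
  the loop. Two obstacles are measure-theoretic. The gradient oracle is given at each fixed point
  but evaluated at random iterates, so a jointly measurable version is constructed. The output index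
  is independent of the samples, so the averaged quantity has to be rewritten, up to a null set, as
  a function of the samples.\<close>

lemma GDERIV_unique:
  assumes "GDERIV f x :> d" and "GDERIV f x :> e"
  shows "d = e"
proof -
  have "(\<lambda>h. h \<bullet> d) = (\<lambda>h. h \<bullet> e)"
    using assms unfolding gderiv_def by (rule has_derivative_unique)
  then show ?thesis
    by (metis vector_eq_ldot)
qed

lemma grad_eqI: "GDERIV f x :> d \<Longrightarrow> grad f x = d"
  unfolding grad_def by (rule the_equality) (auto intro: GDERIV_unique)

text \<open>By Riesz representation a real-valued derivative is the inner product with its adjoint
  applied to 1, so the definite description in \<open>grad\<close> is well defined wherever the
  function is differentiable.\<close>

lemma GDERIV_grad:
  fixes f :: "'a::euclidean_space \<Rightarrow> real"
  assumes "f differentiable (at x)"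
  shows "GDERIV f x :> grad f x"
proof -
  obtain f' where f': "(f has_derivative f') (at x)"
    using assms unfolding differentiable_def by blast
  then have lin: "linear f'"
    by (rule has_derivative_linear)
  have "f' h = h \<bullet> adjoint f' 1" for h
    using adjoint_works[OF lin, of h 1] by simp
  then have "GDERIV f x :> adjoint f' 1"
    using f' unfolding gderiv_def by (metis (no_types, lifting) ext)
  then show ?thesis
    using grad_eqI by metis
qed

lemma norm_matrix_vector_le_specnorm: "norm (A *v u) \<le> specnorm A * norm u"
  for A :: "real^'m^'n"
  unfolding specnorm_def by (rule onorm) simp

lemma specnorm_nonneg: "0 \<le> specnorm A" for A :: "real^'m^'n"
  unfolding specnorm_def by (rule onorm_pos_le) simp

lemma inner_matrix_vector_transpose: "(A *v u) \<bullet> p = u \<bullet> (transpose A *v p)"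
  for A :: "real^'m^'n"
  by (metis dot_lmul_matrix inner_commute transpose_matrix_vector)

text \<open>Scalarizing by a fixed \<open>w\<close> reduces the vector-valued constraint to a real
  function, to which \<open>descent_lemma\<close> applies; the norm is recovered by
  \<open>norm_le_of_inner_le\<close>.\<close>

lemma GDERIV_inner_gradc:
  fixes c :: "real^'n \<Rightarrow> real^'m"
  assumes "c differentiable (at x)"
  shows "GDERIV (\<lambda>y. w \<bullet> c y) x :> gradc c x *v w"
proof -
  obtain c' where c': "(c has_derivative c') (at x)"
    using assms unfolding differentiable_def by blast
  have comp: "GDERIV (\<lambda>y. c y $ j) x :> grad (\<lambda>y. c y $ j) x" for j
    using bounded_linear.has_derivative[OF bounded_linear_vec_nth[of j] c']
    by (intro GDERIV_grad) (auto simp: differentiable_def)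
  have "((\<lambda>y. \<Sum>j\<in>UNIV. w $ j * (c y $ j)) has_derivative
      (\<lambda>h. \<Sum>j\<in>UNIV. w $ j * (h \<bullet> grad (\<lambda>y. c y $ j) x))) (at x)"
    by (intro has_derivative_sum has_derivative_mult_right comp[unfolded gderiv_def])
  moreover have "(\<Sum>j\<in>UNIV. w $ j * (h \<bullet> grad (\<lambda>y. c y $ j) x)) = h \<bullet> (gradc c x *v w)" for h
    by (simp add: inner_vec_def gradc_def matrix_vector_mult_def sum_distrib_left mult_ac)
      (rule sum.swap)
  ultimately show ?thesis
    by (simp add: gderiv_def inner_vec_def[of w])
qed

text \<open>Subtracting the quadratic makes the function nonincreasing along the segment, which gives
  the constant \<open>L / 2\<close> without integration.\<close>
lemma descent_lemma:
  fixes u :: "'a::euclidean_space \<Rightarrow> real"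
  assumes der: "\<And>y. y \<in> closed_segment x (x + p) \<Longrightarrow> GDERIV u y :> D y"
    and lip: "\<And>y. y \<in> closed_segment x (x + p) \<Longrightarrow> norm (D y - D x) \<le> L * norm (y - x)"
  shows "u (x + p) - u x - D x \<bullet> p \<le> L / 2 * (norm p)\<^sup>2"
proof -
  define \<phi> where "\<phi> t = u (x + t *\<^sub>R p) - t * (D x \<bullet> p) - L / 2 * (norm p)\<^sup>2 * t\<^sup>2" for t
  have "\<phi> 1 \<le> \<phi> 0"
  proof (rule DERIV_nonpos_imp_nonincreasing[where f=\<phi>])
    fix t :: real assume t: "0 \<le> t" "t \<le> 1"
    have seg: "x + t *\<^sub>R p \<in> closed_segment x (x + p)"
      unfolding in_segment using t by (intro exI[of _ t]) (simp add: algebra_simps)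
    have "((\<lambda>t. x + t *\<^sub>R p) has_derivative (\<lambda>h. h *\<^sub>R p)) (at t)"
      by (auto intro!: derivative_eq_intros)
    from has_derivative_compose[OF this der[OF seg, unfolded gderiv_def]]
    have "((\<lambda>t. u (x + t *\<^sub>R p)) has_real_derivative (p \<bullet> D (x + t *\<^sub>R p))) (at t)"
      by (simp add: has_field_derivative_def mult_commute_abs)
    then have "(\<phi> has_real_derivative
        (p \<bullet> D (x + t *\<^sub>R p) - D x \<bullet> p - L * (norm p)\<^sup>2 * t)) (at t)"
      unfolding \<phi>_def by (auto intro!: derivative_eq_intros)
    moreover have "p \<bullet> D (x + t *\<^sub>R p) - D x \<bullet> p \<le> L * (norm p)\<^sup>2 * t"
    proof -
      have "p \<bullet> D (x + t *\<^sub>R p) - D x \<bullet> p = p \<bullet> (D (x + t *\<^sub>R p) - D x)"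
        by (simp add: inner_diff_right inner_commute)
      also have "\<dots> \<le> norm p * norm (D (x + t *\<^sub>R p) - D x)"
        by (rule norm_cauchy_schwarz)
      also have "\<dots> \<le> norm p * (L * norm (t *\<^sub>R p))"
        using lip[OF seg] by (intro mult_left_mono) auto
      finally show ?thesis
        using t by (simp add: power2_eq_square mult_ac)
    qed
    ultimately show "\<exists>d. (\<phi> has_real_derivative d) (at t) \<and> d \<le> 0"
      by (auto intro!: exI)
  qed simp
  then show ?thesis
    by (simp add: \<phi>_def)
qed

text \<open>The test vector \<open>w = r\<close> gives the bound. Scalar estimates that are uniform
  in the test vector thus become a norm estimate with no loss in the constant.\<close>

lemma norm_le_of_inner_le:
  assumes "\<And>w. w \<bullet> r \<le> b * norm w" and "0 \<le> b"
  shows "norm r \<le> b"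
proof (cases "r = 0")
  case True
  then show ?thesis
    using assms(2) by simp
next
  case False
  have "norm r * norm r \<le> b * norm r"
    using assms(1)[of r] by (simp add: power2_eq_square[symmetric] power2_norm_eq_inner)
  then show ?thesis
    using False by simp
qed

section \<open>The regularized linear system of the primal step\<close>

definition lalm_matrix :: "real \<Rightarrow> real \<Rightarrow> real^'m^'n \<Rightarrow> real^'n^'n" where
  "lalm_matrix b r A = b *\<^sub>R mat 1 + r *\<^sub>R (A ** transpose A)"

lemma lalm_matrix_vector:
  "lalm_matrix b r A *v p = b *\<^sub>R p + r *\<^sub>R (A *v (transpose A *v p))"
  unfolding lalm_matrix_def matrix_vector_mult_add_rdistrib matrix_vector_mul_assoc
  by (simp add: scaleR_matrix_vector_assoc[symmetric])

text \<open>The quadratic form of the matrix is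
  \<open>b * (norm p)\<^sup>2 + r * (norm (transpose A *v p))\<^sup>2\<close>, so it is coercive
  with constant \<open>b\<close>.\<close>

lemma norm_le_lalm_matrix:
  assumes "0 < b" "0 \<le> r"
  shows "b * norm p \<le> norm (lalm_matrix b r A *v p)"
proof (cases "p = 0")
  case False
  have "b * (norm p)\<^sup>2 \<le> b * (norm p)\<^sup>2 + r * (norm (transpose A *v p))\<^sup>2"
    using assms by simp
  also have "\<dots> = (lalm_matrix b r A *v p) \<bullet> p"
    by (simp add: lalm_matrix_vector inner_add_left inner_matrix_vector_transpose
        power2_norm_eq_inner)
  also have "\<dots> \<le> norm (lalm_matrix b r A *v p) * norm p"
    by (rule norm_cauchy_schwarz)
  finally show ?thesis
    using False by (simp add: power2_eq_square)
qed simp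

lemma invertible_lalm_matrix:
  assumes "0 < b" "0 \<le> r"
  shows "invertible (lalm_matrix b r A)"
proof -
  have "p = 0" if "lalm_matrix b r A *v p = 0" for p
    using norm_le_lalm_matrix[OF assms, of p A] that assms by (simp add: mult_le_0_iff)
  then show ?thesis
    by (simp add: invertible_left_inverse matrix_left_invertible_ker)
qed

text \<open>For a right-hand side in the range of \<open>A\<close> the solution is
  \<open>A *v z\<close>, where \<open>z\<close> solves the smaller system with matrix b I + r A^T A.
  Injectivity of \<open>A\<close> makes that matrix coercive with constant
  \<open>b + r * s\<^sup>2\<close>, which improves on the general factor 1 / b.\<close>

lemma lalm_matrix_range_bound:
  assumes "0 < b" "0 \<le> r" "0 < s"
    and A: "specnorm A \<le> m" "\<And>u. s * norm u \<le> norm (A *v u)"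
    and eq: "lalm_matrix b r A *v p = A *v y"
  shows "norm p \<le> m * norm y / (b + r * s\<^sup>2)"
proof -
  define z where "z = (1 / b) *\<^sub>R (y - r *\<^sub>R (transpose A *v p))"
  have bz: "b *\<^sub>R z = y - r *\<^sub>R (transpose A *v p)"
    using assms by (simp add: z_def)
  have "b *\<^sub>R p = A *v y - r *\<^sub>R (A *v (transpose A *v p))"
    using eq by (simp add: lalm_matrix_vector algebra_simps)
  also have "\<dots> = b *\<^sub>R (A *v z)"
    by (simp add: bz matrix_vector_mult_scaleR[symmetric] matrix_vector_mult_diff_distrib)
  finally have p: "p = A *v z"
    using assms by simp
  have "(b + r * s\<^sup>2) * (norm z)\<^sup>2 \<le> b * (norm z)\<^sup>2 + r * (norm (A *v z))\<^sup>2"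
  proof -
    have "(s * norm z)\<^sup>2 \<le> (norm (A *v z))\<^sup>2"
      using A(2)[of z] assms by (intro power_mono) auto
    from mult_left_mono[OF this \<open>0 \<le> r\<close>] show ?thesis
      by (simp add: algebra_simps power_mult_distrib)
  qed
  also have "\<dots> = (b *\<^sub>R z + r *\<^sub>R (transpose A *v p)) \<bullet> z"
    using inner_matrix_vector_transpose[of A z p]
    by (simp add: power2_norm_eq_inner inner_add_right inner_commute p del: transpose_matrix_vector)
  also have "\<dots> = y \<bullet> z"
    by (simp add: bz)
  also have "\<dots> \<le> norm y * norm z"
    by (rule norm_cauchy_schwarz)
  finally have "(b + r * s\<^sup>2) * norm z \<le> norm y"
    by (cases "z = 0") (simp_all add: power2_eq_square)
  then have z: "norm z \<le> norm y / (b + r * s\<^sup>2)"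
    using assms by (simp add: field_simps add_pos_nonneg)
  have m: "0 \<le> m"
    using specnorm_nonneg[of A] A by simp
  have "norm p \<le> specnorm A * norm z"
    unfolding p by (rule norm_matrix_vector_le_specnorm)
  also have "\<dots> \<le> m * (norm y / (b + r * s\<^sup>2))"
    using z A(1) m specnorm_nonneg[of A] by (intro mult_mono) auto
  finally show ?thesis
    by simp
qed

text \<open>By linearity the step splits into \<open>q\<close>, driven by \<open>v\<close>, and
  \<open>p - q\<close>, driven by a vector in the range of \<open>A\<close>. Only the latter profits
  from the rank condition; this is the origin of the two terms in the parameter condition on
  \<Delta>.\<close>

lemma lalm_step_bound:
  assumes pos: "0 < b" "0 \<le> r" "0 < s"
    and A: "specnorm A \<le> m" "\<And>u. s * norm u \<le> norm (A *v u)"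
    and eq: "lalm_matrix b r A *v p = - v - A *v y"
  shows "norm p \<le> norm v / b + m * norm y / (b + r * s\<^sup>2)"
proof -
  obtain B where B: "lalm_matrix b r A ** B = mat 1"
    using invertible_lalm_matrix[OF pos(1,2)] unfolding invertible_def by blast
  define q where "q = B *v (- v)"
  have q: "lalm_matrix b r A *v q = - v"
    by (simp add: q_def matrix_vector_mul_assoc B)
  have "lalm_matrix b r A *v (p - q) = A *v (- y)"
    by (simp add: matrix_vector_mult_diff_distrib q eq) (simp add: linear_neg[OF matrix_vector_mul_linear])
  from lalm_matrix_range_bound[OF pos A this]
  have 1: "norm (p - q) \<le> m * norm y / (b + r * s\<^sup>2)"
    by simp
  have 2: "norm q \<le> norm v / b"
    using norm_le_lalm_matrix[OF pos(1,2), of q A] pos by (simp add: q field_simps)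
  show ?thesis
    using 1 2 norm_triangle_ineq[of q "p - q"] by simp
qed

section \<open>Analysis of a single path\<close>

text \<open>The path analysis is deterministic: \<open>v\<close> is any sequence in the ball of
  radius G, and its deviation from the true gradient is not restricted further. The projected
  estimator is substituted later, one outcome at a time.\<close>

locale nr_lalm_regular =
  fixes P :: lalm_consts and U :: "(real^'n) set"
    and f :: "real^'n \<Rightarrow> real" and c :: "real^'n \<Rightarrow> real^'m"
    and x0 :: "real^'n" and l0 :: "real^'m" and K :: nat
    and x :: "nat \<Rightarrow> real^'n" and l :: "nat \<Rightarrow> real^'m" and v :: "nat \<Rightarrow> real^'n"
  assumes regularity: "regularity_assumption P U f c"
    and parameters: "parameter_assumption P c x0 l0"
    and init: "x 0 = x0" "l 0 = l0"
    and v_bound: "k < K \<Longrightarrow> norm (v k) \<le> G_f P"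
    and segment_U: "k < K \<Longrightarrow> closed_segment (x k) (x (Suc k)) \<subseteq> U"
    and primal_step: "k < K \<Longrightarrow> lalm_matrix (beta P) (rho P) (gradc c (x k)) *v (x (Suc k) - x k)
      = - v k - gradc c (x k) *v (l k + rho P *\<^sub>R c (x k))"
    and dual_step: "k < K \<Longrightarrow> l (Suc k) = l k + rho P *\<^sub>R c (x (Suc k))"
begin

abbreviation "\<beta> \<equiv> beta P"
abbreviation "\<rho> \<equiv> rho P"
abbreviation "\<Lambda> \<equiv> Lambda P"
abbreviation "\<Delta> \<equiv> Delta P"
abbreviation "\<kappa> \<equiv> kappa_lin P"

definition p :: "nat \<Rightarrow> real^'n" where "p k = x (Suc k) - x k"
definition e :: "nat \<Rightarrow> real^'n" where "e k = v k - grad f (x k)"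
text \<open>The remainder of the linearized constraint; \<open>transpose (gradc c (x k))\<close> is
  the Jacobian in the usual convention.\<close>

definition r :: "nat \<Rightarrow> real^'m" where
  "r k = c (x (Suc k)) - c (x k) - transpose (gradc c (x k)) *v p k"

lemma positive: "0 < \<beta>" "0 < \<rho>" "0 < \<Delta>" "0 < \<Lambda>" "0 < G_f P" "0 < L_f P" "0 < M_c P"
  "0 < L_c P" "0 < sigma_c P" "0 < \<kappa>"
  using regularity parameters
  unfolding regularity_assumption_def parameter_assumption_def kappa_lin_def by auto

lemma p_eq: "x (Suc k) = x k + p k"
  by (simp add: p_def)

lemma x_in_U: "k < K \<Longrightarrow> x k \<in> U" "k < K \<Longrightarrow> x (Suc k) \<in> U"
  using segment_U[of k] by auto

lemma
  assumes "y \<in> U"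
  shows diff_f: "GDERIV f y :> grad f y"
    and diff_c: "GDERIV (\<lambda>y. w \<bullet> c y) y :> gradc c y *v w"
    and f_low: "f_low P \<le> f y"
    and grad_bound: "norm (grad f y) \<le> G_f P"
    and specnorm_bound: "specnorm (gradc c y) \<le> M_c P"
    and lower_bound: "sigma_c P * norm u \<le> norm (gradc c y *v u)"
  using assms regularity GDERIV_grad[of f y] GDERIV_inner_gradc[of c y]
  unfolding regularity_assumption_def by blast+

lemma gradc_bound: "y \<in> U \<Longrightarrow> norm (gradc c y *v u) \<le> M_c P * norm u"
  using norm_matrix_vector_le_specnorm[of "gradc c y" u] specnorm_bound[of y]
  by (meson mult_right_mono norm_ge_zero order_trans)

lemma transpose_gradc_bound:
  assumes "y \<in> U"
  shows "norm (transpose (gradc c y) *v q) \<le> M_c P * norm q"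
proof (rule norm_le_of_inner_le)
  fix w :: "real^'m"
  have "w \<bullet> (transpose (gradc c y) *v q) = (gradc c y *v w) \<bullet> q"
    by (rule inner_matrix_vector_transpose[symmetric])
  also have "\<dots> \<le> norm (gradc c y *v w) * norm q"
    by (rule norm_cauchy_schwarz)
  also have "\<dots> \<le> (M_c P * norm w) * norm q"
    using gradc_bound[OF assms] by (intro mult_right_mono) auto
  finally show "w \<bullet> (transpose (gradc c y) *v q) \<le> M_c P * norm q * norm w"
    by (simp add: mult_ac)
qed (use positive in simp)

lemma
  assumes "y \<in> U" "z \<in> U"
  shows grad_lipschitz: "norm (grad f y - grad f z) \<le> L_f P * norm (y - z)"
    and gradc_lipschitz: "norm (gradc c y *v u - gradc c z *v u) \<le> L_c P * norm (y - z) * norm u"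
proof -
  show "norm (grad f y - grad f z) \<le> L_f P * norm (y - z)"
    using assms regularity unfolding regularity_assumption_def by blast
  have "specnorm (gradc c y - gradc c z) \<le> L_c P * norm (y - z)"
    using assms regularity unfolding regularity_assumption_def by blast
  then show "norm (gradc c y *v u - gradc c z *v u) \<le> L_c P * norm (y - z) * norm u"
    using norm_matrix_vector_le_specnorm[of "gradc c y - gradc c z" u]
    unfolding matrix_vector_mult_diff_rdistrib
    by (meson mult_right_mono norm_ge_zero order_trans)
qed

lemma segment_p: "k < K \<Longrightarrow> closed_segment (x k) (x k + p k) \<subseteq> U"
  using segment_U by (simp add: p_eq)

section \<open>First-order expansions and approximate stationarity\<close>

lemma f_step:
  assumes "k < K"
  shows "f (x (Suc k)) \<le> f (x k) + grad f (x k) \<bullet> p k + L_f P / 2 * (norm (p k))\<^sup>2"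
proof -
  have "f (x k + p k) - f (x k) - grad f (x k) \<bullet> p k \<le> L_f P / 2 * (norm (p k))\<^sup>2"
    using segment_p[OF assms] x_in_U[OF assms]
    by (intro descent_lemma diff_f grad_lipschitz) auto
  then show ?thesis
    by (simp add: p_eq)
qed

text \<open>The scalarized constraint has a gradient with Lipschitz constant
  \<open>L_c P * norm w\<close>, so the descent lemma followed by duality yields half of L_c,
  independently of the number of constraints.\<close>

lemma r_bound:
  assumes "k < K"
  shows "norm (r k) \<le> \<kappa> * (norm (p k))\<^sup>2"
proof (rule norm_le_of_inner_le)
  fix w :: "real^'m"
  have "w \<bullet> c (x k + p k) - w \<bullet> c (x k) - (gradc c (x k) *v w) \<bullet> p k
      \<le> (L_c P * norm w) / 2 * (norm (p k))\<^sup>2"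
  proof (rule descent_lemma)
    fix y assume "y \<in> closed_segment (x k) (x k + p k)"
    then have y: "y \<in> U"
      using segment_p[OF assms] by blast
    show "GDERIV (\<lambda>y. w \<bullet> c y) y :> gradc c y *v w"
      by (rule diff_c[OF y])
    show "norm (gradc c y *v w - gradc c (x k) *v w) \<le> L_c P * norm w * norm (y - x k)"
      using gradc_lipschitz[OF y x_in_U(1)[OF assms], of w] by (simp add: mult_ac)
  qed
  then show "w \<bullet> r k \<le> \<kappa> * (norm (p k))\<^sup>2 * norm w"
    by (simp add: r_def p_eq inner_diff_right inner_matrix_vector_transpose kappa_lin_def mult_ac
        del: transpose_matrix_vector)
qed (use positive in simp)

text \<open>With J the Jacobian, the vector l k + \<rho> c (x k) + \<rho> J p k equals l (Suc k) -
  \<rho> r k. Hence the linear system is a stationarity condition at the old point with the new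
  multiplier, up to the proximal term and the linearization remainder.\<close>

lemma stationarity:
  assumes "k < K"
  shows "gradc c (x k) *v l (Suc k) = - v k - \<beta> *\<^sub>R p k + \<rho> *\<^sub>R (gradc c (x k) *v r k)"
proof -
  define A where "A = gradc c (x k)"
  have "l (Suc k) = (l k + \<rho> *\<^sub>R c (x k)) + \<rho> *\<^sub>R (transpose A *v p k) + \<rho> *\<^sub>R r k"
    by (simp add: dual_step[OF assms] r_def A_def scaleR_diff_right)
  then have "A *v l (Suc k) = A *v (l k + \<rho> *\<^sub>R c (x k)) + \<rho> *\<^sub>R (A *v (transpose A *v p k))
      + \<rho> *\<^sub>R (A *v r k)"
    by (simp only: matrix_vector_right_distrib matrix_vector_mult_scaleR)
  moreover have "\<beta> *\<^sub>R p k + \<rho> *\<^sub>R (A *v (transpose A *v p k))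
      = - v k - A *v (l k + \<rho> *\<^sub>R c (x k))"
    using primal_step[OF assms] by (simp only: lalm_matrix_vector A_def p_def)
  ultimately show ?thesis
    unfolding A_def[symmetric] by (simp add: algebra_simps)
qed

lemma stationarity_bound:
  assumes "k < K"
  shows "norm (v k + gradc c (x k) *v l (Suc k))
    \<le> \<beta> * norm (p k) + \<rho> * M_c P * \<kappa> * (norm (p k))\<^sup>2"
proof -
  have "v k + gradc c (x k) *v l (Suc k) = - (\<beta> *\<^sub>R p k) + \<rho> *\<^sub>R (gradc c (x k) *v r k)"
    by (simp add: stationarity[OF assms])
  then have "norm (v k + gradc c (x k) *v l (Suc k))
      \<le> norm (- (\<beta> *\<^sub>R p k)) + norm (\<rho> *\<^sub>R (gradc c (x k) *v r k))"
    by (metis norm_triangle_ineq)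
  moreover have "norm (gradc c (x k) *v r k) \<le> M_c P * (\<kappa> * (norm (p k))\<^sup>2)"
    using gradc_bound[OF x_in_U(1)[OF assms], of "r k"] r_bound[OF assms] positive
    by (meson mult_left_mono less_imp_le order_trans)
  ultimately show ?thesis
    using positive by (simp add: mult_ac) (smt (verit) mult_left_mono mult.left_commute)
qed

section \<open>Uniform bounds on steps, multipliers and constraint values\<close>

lemma p_bound_step:
  assumes k: "k < K" and l: "norm (l k) \<le> \<Lambda>" and c: "\<rho> * norm (c (x k)) \<le> 2 * \<Lambda>"
  shows "norm (p k) \<le> \<Delta>"
proof -
  \<comment> \<open>One \<Lambda> comes from the multiplier and two from the constraint term; this
    is the 3 in the parameter condition on \<Delta>.\<close>
  have y: "norm (l k + \<rho> *\<^sub>R c (x k)) \<le> 3 * \<Lambda>"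
    using norm_triangle_ineq[of "l k" "\<rho> *\<^sub>R c (x k)"] l c positive by simp
  have "norm (p k) \<le> norm (v k) / \<beta>
      + M_c P * norm (l k + \<rho> *\<^sub>R c (x k)) / (\<beta> + \<rho> * (sigma_c P)\<^sup>2)"
    unfolding p_def
    by (rule lalm_step_bound[OF positive(1) less_imp_le[OF positive(2)] positive(9)
          specnorm_bound[OF x_in_U(1)[OF k]] lower_bound[OF x_in_U(1)[OF k]] primal_step[OF k]])
  also have "\<dots> \<le> G_f P / \<beta> + M_c P * (3 * \<Lambda>) / (\<beta> + \<rho> * (sigma_c P)\<^sup>2)"
    using y v_bound[OF k] positive
    by (intro add_mono divide_right_mono mult_left_mono) (auto intro: add_nonneg_nonneg)
  also have "\<dots> \<le> \<Delta>"
    using parameters unfolding parameter_assumption_def by (simp add: mult_ac)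
  finally show ?thesis .
qed

text \<open>Stationarity expresses the image of the new multiplier under \<open>gradc\<close>
  through \<open>v\<close> and the step alone, so the bound does not involve the old multiplier and
  cannot deteriorate with \<open>k\<close>. The lower bound on \<Lambda> in the parameter assumption
  is what this computation asks for.\<close>

lemma l_bound_step:
  assumes k: "k < K" and p: "norm (p k) \<le> \<Delta>"
  shows "norm (l (Suc k)) \<le> \<Lambda>"
proof -
  have p2: "(norm (p k))\<^sup>2 \<le> \<Delta>\<^sup>2"
    using p by (intro power_mono) auto
  have "sigma_c P * norm (l (Suc k)) \<le> norm (gradc c (x k) *v l (Suc k))"
    using lower_bound x_in_U k by blast
  also have "\<dots> \<le> norm (v k + gradc c (x k) *v l (Suc k)) + norm (v k)"
    by norm
  also have "\<dots> \<le> \<beta> * norm (p k) + \<rho> * M_c P * \<kappa> * (norm (p k))\<^sup>2 + G_f P"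
    using stationarity_bound[OF k] v_bound[OF k] by simp
  also have "\<dots> \<le> \<beta> * \<Delta> + \<rho> * M_c P * \<kappa> * \<Delta>\<^sup>2 + G_f P"
    using p p2 positive by (intro add_mono mult_left_mono) auto
  also have "\<dots> \<le> sigma_c P * \<Lambda>"
    using parameters positive unfolding parameter_assumption_def by (simp add: field_simps)
  finally show ?thesis
    using positive by simp
qed

text \<open>By the dual update, \<rho> times the new constraint value is a difference of two
  multipliers.\<close>

lemma c_bound_step:
  assumes "k < K" "norm (l k) \<le> \<Lambda>" "norm (l (Suc k)) \<le> \<Lambda>"
  shows "\<rho> * norm (c (x (Suc k))) \<le> 2 * \<Lambda>"
proof -
  have "\<rho> * norm (c (x (Suc k))) = norm (l (Suc k) - l k)"
    using positive by (simp add: dual_step[OF assms(1)])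
  then show ?thesis
    using norm_triangle_ineq4[of "l (Suc k)" "l k"] assms by simp
qed

text \<open>The invariant advances in the order step, new multiplier, new constraint value. Both
  bounds are carried together because the step bound uses both; initially the constraint satisfies
  the stronger bound \<Lambda>.\<close>

lemma l_c_bound: "k \<le> K \<Longrightarrow> norm (l k) \<le> \<Lambda> \<and> \<rho> * norm (c (x k)) \<le> 2 * \<Lambda>"
proof (induction k)
  case 0
  then show ?case
    using parameters init unfolding parameter_assumption_def by auto
next
  case (Suc k)
  then show ?case
    using p_bound_step l_bound_step c_bound_step by (meson Suc_le_lessD less_imp_le)
qed

lemma l_bound: "k \<le> K \<Longrightarrow> norm (l k) \<le> \<Lambda>"
  using l_c_bound by blast

lemma p_bound: "k < K \<Longrightarrow> norm (p k) \<le> \<Delta>"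
  using l_c_bound p_bound_step less_imp_le by blast

text \<open>One of the two factors of the quadratic remainder is replaced by the uniform bound
  \<Delta>; \<open>A_p\<close> is the resulting coefficient.\<close>

lemma stationarity_bound_linear:
  assumes "k < K"
  shows "norm (v k + gradc c (x k) *v l (Suc k)) \<le> A_p P * norm (p k)"
proof -
  have "(\<rho> * M_c P * \<kappa> * norm (p k)) * norm (p k) \<le> (\<rho> * M_c P * \<kappa> * norm (p k)) * \<Delta>"
    using p_bound[OF assms] positive by (intro mult_left_mono) auto
  then show ?thesis
    using stationarity_bound[OF assms] by (simp add: A_p_def power2_eq_square algebra_simps)
qed

section \<open>Multiplier increments\<close>

lemma square_sum4: "(a + b + d + g)\<^sup>2 \<le> 4 * (a\<^sup>2 + b\<^sup>2 + d\<^sup>2 + g\<^sup>2)" for a b d g :: real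
proof -
  have "4 * (a\<^sup>2 + b\<^sup>2 + d\<^sup>2 + g\<^sup>2) - (a + b + d + g)\<^sup>2
      = (a - b)\<^sup>2 + (a - d)\<^sup>2 + (a - g)\<^sup>2 + (b - d)\<^sup>2 + (b - g)\<^sup>2 + (d - g)\<^sup>2"
    by (simp add: power2_eq_square algebra_simps)
  then show ?thesis
    by (smt (verit) zero_le_power2)
qed

text \<open>Two consecutive stationarity relations are subtracted, and the lower bound on
  \<open>gradc\<close> at the newer point is applied. Passing between the points adds L_f from the
  objective gradient and L_c \<Lambda> from the Jacobian acting on the common multiplier
  \<open>l (Suc k)\<close>, which is why the older step carries \<open>B_p\<close> and the newer one
  \<open>A_p\<close>. Squaring a sum of four terms costs the factor 4.\<close>

lemma multiplier_difference:
  assumes k: "Suc k < K"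
  shows "(norm (l (Suc (Suc k)) - l (Suc k)))\<^sup>2
    \<le> C_lambda_p P * ((norm (p (Suc k)))\<^sup>2 + (norm (p k))\<^sup>2)
      + C_lambda_e P * ((norm (e (Suc k)))\<^sup>2 + (norm (e k))\<^sup>2)"
proof -
  let ?A = "\<lambda>k. gradc c (x k)"
  let ?d = "norm (l (Suc (Suc k)) - l (Suc k))"
  have k': "k < K" using k by simp
  note U = x_in_U[OF k] x_in_U[OF k']
  have eq: "?A (Suc k) *v (l (Suc (Suc k)) - l (Suc k))
      = (v (Suc k) + ?A (Suc k) *v l (Suc (Suc k))) - (v k + ?A k *v l (Suc k))
        - e (Suc k) + e k - (grad f (x (Suc k)) - grad f (x k))
        - (?A (Suc k) *v l (Suc k) - ?A k *v l (Suc k))"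
    by (simp add: e_def matrix_vector_mult_diff_distrib)
  have 1: "norm (grad f (x (Suc k)) - grad f (x k)) \<le> L_f P * norm (p k)"
    unfolding p_def by (rule grad_lipschitz) (use U in auto)
  have 2: "norm (?A (Suc k) *v l (Suc k) - ?A k *v l (Suc k)) \<le> L_c P * norm (p k) * \<Lambda>"
  proof -
    have "norm (?A (Suc k) *v l (Suc k) - ?A k *v l (Suc k)) \<le> L_c P * norm (p k) * norm (l (Suc k))"
      unfolding p_def by (rule gradc_lipschitz) (use U in auto)
    also have "\<dots> \<le> L_c P * norm (p k) * \<Lambda>"
      using l_bound[of "Suc k"] k positive by (intro mult_left_mono) auto
    finally show ?thesis .
  qed
  have "sigma_c P * ?d \<le> norm (?A (Suc k) *v (l (Suc (Suc k)) - l (Suc k)))"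
    using lower_bound U by blast
  also have "\<dots> \<le> norm (v (Suc k) + ?A (Suc k) *v l (Suc (Suc k))) + norm (v k + ?A k *v l (Suc k))
      + norm (e (Suc k)) + norm (e k) + norm (grad f (x (Suc k)) - grad f (x k))
      + norm (?A (Suc k) *v l (Suc k) - ?A k *v l (Suc k))"
    unfolding eq by norm
  also have "\<dots> \<le> A_p P * norm (p (Suc k)) + B_p P * norm (p k) + norm (e (Suc k)) + norm (e k)"
    using 1 2 stationarity_bound_linear[OF k] stationarity_bound_linear[OF k']
    by (simp add: B_p_def algebra_simps)
  finally have "(sigma_c P * ?d)\<^sup>2
      \<le> (A_p P * norm (p (Suc k)) + B_p P * norm (p k) + norm (e (Suc k)) + norm (e k))\<^sup>2"
    using positive by (intro power_mono) auto
  also have "\<dots> \<le> 4 * ((A_p P)\<^sup>2 * (norm (p (Suc k)))\<^sup>2 + (B_p P)\<^sup>2 * (norm (p k))\<^sup>2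
      + (norm (e (Suc k)))\<^sup>2 + (norm (e k))\<^sup>2)"
    using square_sum4 by (simp only: power_mult_distrib[symmetric])
  also have "\<dots> \<le> 4 * (max ((A_p P)\<^sup>2) ((B_p P)\<^sup>2) * (norm (p (Suc k)))\<^sup>2
      + max ((A_p P)\<^sup>2) ((B_p P)\<^sup>2) * (norm (p k))\<^sup>2 + (norm (e (Suc k)))\<^sup>2 + (norm (e k))\<^sup>2)"
    by (intro mult_left_mono add_mono mult_right_mono) auto
  finally have "?d\<^sup>2 \<le> (4 * (max ((A_p P)\<^sup>2) ((B_p P)\<^sup>2) * (norm (p (Suc k)))\<^sup>2
      + max ((A_p P)\<^sup>2) ((B_p P)\<^sup>2) * (norm (p k))\<^sup>2 + (norm (e (Suc k)))\<^sup>2 + (norm (e k))\<^sup>2))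
      / (sigma_c P)\<^sup>2"
    using positive by (simp add: pos_le_divide_eq power_mult_distrib mult.commute)
  then show ?thesis
    by (simp add: C_lambda_p_def C_lambda_e_def algebra_simps add_divide_distrib)
qed

section \<open>Descent of the augmented Lagrangian\<close>

definition aug_lagrangian :: "nat \<Rightarrow> real" where
  "aug_lagrangian k = f (x k) + l k \<bullet> c (x k) + \<rho> / 2 * (norm (c (x k)))\<^sup>2"

text \<open>Pairing the linear system with \<open>p k\<close> replaces all first-order terms by
  minus \<beta> times the squared step and minus \<rho> times the squared norm of \<open>t\<close>,
  half of which pays for the quadratic penalty. The second-order term of the objective and
  everything containing the remainder \<open>r k\<close> are collected in
  \<open>C_mod\<close>.\<close>

lemma primal_descent:
  assumes k: "k < K"
  shows "f (x (Suc k)) + l k \<bullet> c (x (Suc k)) + \<rho> / 2 * (norm (c (x (Suc k))))\<^sup>2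
    \<le> aug_lagrangian k - \<beta> / 2 * (norm (p k))\<^sup>2 + 2 / \<beta> * (norm (e k))\<^sup>2"
proof -
  define A where "A = gradc c (x k)"
  define t where "t = transpose A *v p k"
  have c1: "c (x (Suc k)) = c (x k) + t + r k"
    by (simp add: r_def t_def A_def)
  have inn: "(A *v w) \<bullet> p k = w \<bullet> t" for w
    unfolding t_def by (rule inner_matrix_vector_transpose)
  have "\<beta> *\<^sub>R p k + \<rho> *\<^sub>R (A *v t) = - v k - A *v (l k + \<rho> *\<^sub>R c (x k))"
    using primal_step[OF k] by (simp only: lalm_matrix_vector A_def p_def t_def)
  then have "(\<beta> *\<^sub>R p k + \<rho> *\<^sub>R (A *v t)) \<bullet> p k = (- v k - A *v (l k + \<rho> *\<^sub>R c (x k))) \<bullet> p k"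
    by simp
  then have step: "\<beta> * (norm (p k))\<^sup>2 + \<rho> * (norm t)\<^sup>2
      = - (v k \<bullet> p k) - l k \<bullet> t - \<rho> * (c (x k) \<bullet> t)"
    by (simp add: inner_add_left inner_diff_left inn power2_norm_eq_inner)
  have sq: "(norm (c (x (Suc k))))\<^sup>2 = (norm (c (x k)))\<^sup>2 + 2 * (c (x k) \<bullet> t) + (norm t)\<^sup>2
      + 2 * (c (x k) \<bullet> r k) + 2 * (t \<bullet> r k) + (norm (r k))\<^sup>2"
    unfolding c1 power2_norm_eq_inner by (simp add: inner_add_left inner_add_right inner_commute)
  have fs: "f (x (Suc k)) \<le> f (x k) + (v k \<bullet> p k - e k \<bullet> p k) + L_f P / 2 * (norm (p k))\<^sup>2"
    using f_step[OF k] by (simp add: e_def inner_diff_left)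
  have R: "norm (r k) \<le> \<kappa> * (norm (p k))\<^sup>2"
    by (rule r_bound[OF k])
  have lr: "l k \<bullet> r k \<le> \<Lambda> * (\<kappa> * (norm (p k))\<^sup>2)"
    using norm_cauchy_schwarz[of "l k" "r k"] R l_bound[of k] k positive
    by (smt (verit) mult_mono norm_ge_zero less_imp_le)
  have cr: "\<rho> * (c (x k) \<bullet> r k) \<le> (2 * \<Lambda>) * (\<kappa> * (norm (p k))\<^sup>2)"
  proof -
    have "\<rho> * (c (x k) \<bullet> r k) \<le> \<rho> * (norm (c (x k)) * norm (r k))"
      using norm_cauchy_schwarz positive by (intro mult_left_mono) auto
    also have "\<dots> = (\<rho> * norm (c (x k))) * norm (r k)"
      by simp
    also have "\<dots> \<le> (2 * \<Lambda>) * (\<kappa> * (norm (p k))\<^sup>2)"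
      by (rule mult_mono) (use l_c_bound[of k] k R positive in auto)
    finally show ?thesis .
  qed
  have t: "norm t \<le> M_c P * \<Delta>"
    using transpose_gradc_bound[OF x_in_U(1)[OF k], of "p k"] p_bound[OF k] positive
    unfolding t_def A_def by (meson mult_left_mono less_imp_le order_trans)
  have tr: "\<rho> * (t \<bullet> r k) \<le> \<rho> * ((M_c P * \<Delta>) * (\<kappa> * (norm (p k))\<^sup>2))"
  proof (rule mult_left_mono)
    have "t \<bullet> r k \<le> norm t * norm (r k)"
      by (rule norm_cauchy_schwarz)
    also have "\<dots> \<le> (M_c P * \<Delta>) * (\<kappa> * (norm (p k))\<^sup>2)"
      using t R positive by (intro mult_mono) auto
    finally show "t \<bullet> r k \<le> (M_c P * \<Delta>) * (\<kappa> * (norm (p k))\<^sup>2)" .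
  qed (use positive in simp)
  have rr: "\<rho> / 2 * (norm (r k))\<^sup>2 \<le> \<rho> / 2 * (\<kappa>\<^sup>2 * \<Delta>\<^sup>2 * (norm (p k))\<^sup>2)"
  proof (rule mult_left_mono)
    have "(norm (r k))\<^sup>2 \<le> (\<kappa> * (norm (p k))\<^sup>2)\<^sup>2"
      using R by (intro power_mono) auto
    also have "\<dots> = \<kappa>\<^sup>2 * (norm (p k))\<^sup>2 * (norm (p k))\<^sup>2"
      by (simp add: power2_eq_square)
    also have "\<dots> \<le> \<kappa>\<^sup>2 * \<Delta>\<^sup>2 * (norm (p k))\<^sup>2"
      using p_bound[OF k] by (intro mult_right_mono mult_left_mono power_mono) auto
    finally show "(norm (r k))\<^sup>2 \<le> \<kappa>\<^sup>2 * \<Delta>\<^sup>2 * (norm (p k))\<^sup>2" .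
  qed (use positive in simp)
  \<comment> \<open>Young's inequality with weight \<beta> / 8: together with the 3 \<beta> / 8
    allowed to \<open>C_mod\<close>, half of the decrease \<beta> is spent.\<close>
  have ep: "- (e k \<bullet> p k) \<le> \<beta> / 8 * (norm (p k))\<^sup>2 + 2 / \<beta> * (norm (e k))\<^sup>2"
  proof -
    have "- (e k \<bullet> p k) \<le> norm (e k) * norm (p k)"
      using norm_cauchy_schwarz[of "- e k" "p k"] by simp
    moreover have "0 \<le> (\<beta> * norm (p k) - 4 * norm (e k))\<^sup>2 / (8 * \<beta>)"
      using positive by simp
    moreover have "(\<beta> * norm (p k) - 4 * norm (e k))\<^sup>2 / (8 * \<beta>)
        = \<beta> / 8 * (norm (p k))\<^sup>2 + 2 / \<beta> * (norm (e k))\<^sup>2 - norm (e k) * norm (p k)"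
      using positive by (simp add: field_simps power2_eq_square)
    ultimately show ?thesis by linarith
  qed
  have "C_mod P * (norm (p k))\<^sup>2 \<le> 3 * \<beta> / 8 * (norm (p k))\<^sup>2"
    using parameters unfolding parameter_assumption_def by (intro mult_right_mono) auto
  moreover have "C_mod P * (norm (p k))\<^sup>2 = L_f P / 2 * (norm (p k))\<^sup>2
      + \<Lambda> * (\<kappa> * (norm (p k))\<^sup>2) + (2 * \<Lambda>) * (\<kappa> * (norm (p k))\<^sup>2)
      + \<rho> * ((M_c P * \<Delta>) * (\<kappa> * (norm (p k))\<^sup>2)) + \<rho> / 2 * (\<kappa>\<^sup>2 * \<Delta>\<^sup>2 * (norm (p k))\<^sup>2)"
    by (simp add: C_mod_def algebra_simps)
  moreover have "0 \<le> \<rho> * (norm t)\<^sup>2"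
    using positive by simp
  moreover have "\<rho> / 2 * (norm (c (x (Suc k))))\<^sup>2 = \<rho> / 2 * (norm (c (x k)))\<^sup>2 + \<rho> * (c (x k) \<bullet> t)
      + \<rho> / 2 * (norm t)\<^sup>2 + \<rho> * (c (x k) \<bullet> r k) + \<rho> * (t \<bullet> r k) + \<rho> / 2 * (norm (r k))\<^sup>2"
    unfolding sq by (simp add: algebra_simps)
  moreover have "l k \<bullet> c (x (Suc k)) = l k \<bullet> c (x k) + l k \<bullet> t + l k \<bullet> r k"
    unfolding c1 by (simp add: inner_add_right)
  ultimately show ?thesis
    using step fs lr cr tr rr ep unfolding aug_lagrangian_def by (simp add: field_simps)
qed

lemma multiplier_step:
  assumes "k < K"
  shows "(norm (l (Suc k) - l k))\<^sup>2 = \<rho>\<^sup>2 * (norm (c (x (Suc k))))\<^sup>2"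
  using positive by (simp add: dual_step[OF assms] power_mult_distrib)

text \<open>At a fixed point the dual update changes only the term linear in the multiplier, by
  \<rho> times the squared constraint norm.\<close>

lemma aug_lagrangian_step:
  assumes "k < K"
  shows "aug_lagrangian (Suc k) \<le> aug_lagrangian k - \<beta> / 2 * (norm (p k))\<^sup>2
    + 2 / \<beta> * (norm (e k))\<^sup>2 + (norm (l (Suc k) - l k))\<^sup>2 / \<rho>"
proof -
  have "l (Suc k) \<bullet> c (x (Suc k)) = l k \<bullet> c (x (Suc k)) + \<rho> * (norm (c (x (Suc k))))\<^sup>2"
    by (simp add: dual_step[OF assms] inner_add_left power2_norm_eq_inner)
  moreover have "\<rho> * (norm (c (x (Suc k))))\<^sup>2 = (norm (l (Suc k) - l k))\<^sup>2 / \<rho>"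
    using positive unfolding multiplier_step[OF assms] by (simp add: power2_eq_square)
  ultimately show ?thesis
    using primal_descent[OF assms] by (simp add: aug_lagrangian_def)
qed

lemma C_lambda_nonneg: "0 \<le> C_lambda_p P" "0 \<le> C_lambda_e P"
  unfolding C_lambda_p_def C_lambda_e_def by (auto intro!: mult_nonneg_nonneg simp: le_max_iff_disj)

text \<open>\<open>C_e_star\<close> combines the Young coefficient 2 / \<beta> of the current error
  with its share in the multiplier increment; the previous step and error enter through the
  increment only.\<close>

lemma aug_lagrangian_descent:
  assumes k: "Suc k < K"
  shows "aug_lagrangian (Suc (Suc k)) \<le> aug_lagrangian (Suc k)
    - \<beta> / 2 * (norm (p (Suc k)))\<^sup>2 + C_lambda_p P / \<rho> * ((norm (p (Suc k)))\<^sup>2 + (norm (p k))\<^sup>2)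
    + C_e_star P * (norm (e (Suc k)))\<^sup>2 + C_lambda_e P / \<rho> * (norm (e k))\<^sup>2"
proof -
  have "(norm (l (Suc (Suc k)) - l (Suc k)))\<^sup>2 / \<rho>
      \<le> (C_lambda_p P * ((norm (p (Suc k)))\<^sup>2 + (norm (p k))\<^sup>2)
      + C_lambda_e P * ((norm (e (Suc k)))\<^sup>2 + (norm (e k))\<^sup>2)) / \<rho>"
    using multiplier_difference[OF k] positive by (intro divide_right_mono) auto
  also have "\<dots> = C_lambda_p P / \<rho> * ((norm (p (Suc k)))\<^sup>2 + (norm (p k))\<^sup>2)
      + C_lambda_e P / \<rho> * ((norm (e (Suc k)))\<^sup>2 + (norm (e k))\<^sup>2)"
    by (simp add: add_divide_distrib)
  finally show ?thesis
    using aug_lagrangian_step[OF k] by (simp add: C_e_star_def algebra_simps)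
qed

text \<open>Telescoping starts at index 1, because a multiplier increment is estimated from two
  consecutive iterations. The term in \<open>p 0\<close> is the delayed contribution that the first
  descent inequality charges to the initial step.\<close>

lemma aug_lagrangian_upper:
  assumes "0 < K"
  shows "aug_lagrangian 1 + C_lambda_p P / \<rho> * (norm (p 0))\<^sup>2 \<le> Phi_upper P (f x0)"
proof -
  have "f (x 1) \<le> f x0 + G_f P * \<Delta>"
  proof -
    have "norm (f (x 1) - f (x 0)) \<le> G_f P * norm (x 1 - x 0)"
    proof (rule differentiable_bound)
      fix y assume "y \<in> closed_segment (x 0) (x 1)"
      then have y: "y \<in> U"
        using segment_U[of 0] assms by auto
      show "(f has_derivative (\<lambda>h. h \<bullet> grad f y)) (at y within closed_segment (x 0) (x 1))"
        using diff_f[OF y] unfolding gderiv_def by (rule has_derivative_at_withinI)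
      show "onorm (\<lambda>h. h \<bullet> grad f y) \<le> G_f P"
      proof (rule onorm_le)
        fix h
        have "norm (h \<bullet> grad f y) \<le> norm h * norm (grad f y)"
          unfolding real_norm_def by (rule Cauchy_Schwarz_ineq2)
        also have "\<dots> \<le> G_f P * norm h"
          using grad_bound[OF y] by (metis mult.commute mult_left_mono norm_ge_zero)
        finally show "norm (h \<bullet> grad f y) \<le> G_f P * norm h" .
      qed
    qed auto
    also have "\<dots> \<le> G_f P * \<Delta>"
      using p_bound[of 0] assms positive by (intro mult_left_mono) (auto simp: p_def)
    finally show ?thesis
      using init by simp
  qed
  moreover have "l 1 \<bullet> c (x 1) + \<rho> / 2 * (norm (c (x 1)))\<^sup>2 \<le> 4 * \<Lambda>\<^sup>2 / \<rho>"
  proof -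
    have b: "norm (l 1) \<le> \<Lambda>" "norm (c (x 1)) \<le> 2 * \<Lambda> / \<rho>"
      using l_c_bound[of 1] assms positive by (auto simp: field_simps)
    have "l 1 \<bullet> c (x 1) \<le> norm (l 1) * norm (c (x 1))"
      by (rule norm_cauchy_schwarz)
    also have "\<dots> \<le> \<Lambda> * (2 * \<Lambda> / \<rho>)"
      using b positive by (intro mult_mono) auto
    finally have "l 1 \<bullet> c (x 1) \<le> 2 * \<Lambda>\<^sup>2 / \<rho>"
      by (simp add: power2_eq_square mult_ac)
    moreover have "\<rho> / 2 * (norm (c (x 1)))\<^sup>2 \<le> \<rho> / 2 * (2 * \<Lambda> / \<rho>)\<^sup>2"
      using b positive by (intro mult_left_mono power_mono) auto
    then have "\<rho> / 2 * (norm (c (x 1)))\<^sup>2 \<le> 2 * \<Lambda>\<^sup>2 / \<rho>"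
      using positive by (simp add: power2_eq_square field_simps)
    ultimately show ?thesis by simp
  qed
  moreover have "C_lambda_p P / \<rho> * (norm (p 0))\<^sup>2 \<le> C_lambda_p P / \<rho> * \<Delta>\<^sup>2"
    using p_bound[of 0] assms C_lambda_nonneg positive
    by (intro mult_left_mono power_mono) auto
  ultimately show ?thesis
    by (simp add: aug_lagrangian_def Phi_upper_def)
qed

text \<open>Completing the square: the linear and quadratic constraint terms equal the squared norm
  of l + \<rho> c minus that of l, divided by 2 \<rho>.\<close>

lemma aug_lagrangian_lower:
  assumes "k < K"
  shows "Phi_lower P \<le> aug_lagrangian (Suc k)"
proof -
  let ?l = "l (Suc k)" and ?c = "c (x (Suc k))"
  have "0 \<le> (norm (?l + \<rho> *\<^sub>R ?c))\<^sup>2 / (2 * \<rho>)"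
    using positive by simp
  also have "\<dots> = (norm ?l)\<^sup>2 / (2 * \<rho>) + ?l \<bullet> ?c + \<rho> / 2 * (norm ?c)\<^sup>2"
    using positive unfolding power2_norm_eq_inner
    by (simp add: inner_add_left inner_add_right inner_commute field_simps)
  finally have "- ((norm ?l)\<^sup>2 / (2 * \<rho>)) \<le> ?l \<bullet> ?c + \<rho> / 2 * (norm ?c)\<^sup>2"
    by simp
  moreover have "(norm ?l)\<^sup>2 / (2 * \<rho>) \<le> \<Lambda>\<^sup>2 / (2 * \<rho>)"
    using l_bound[of "Suc k"] assms positive by (intro divide_right_mono power_mono) auto
  ultimately show ?thesis
    using f_low[OF x_in_U(2)[OF assms]] by (simp add: aug_lagrangian_def Phi_lower_def)
qed

text \<open>A step or an error occurs in up to two consecutive descent inequalities, as the current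
  and then as the previous one. The terms in \<open>p k\<close> and \<open>e k\<close> on the left
  are a potential that pays for the delayed occurrence in the next inequality.\<close>

lemma aug_lagrangian_sum:
  "Suc k \<le> K \<Longrightarrow> aug_lagrangian (Suc k) + \<beta> / 4 * (\<Sum>j<Suc k. (norm (p j))\<^sup>2)
      + C_lambda_p P / \<rho> * (norm (p k))\<^sup>2 + C_lambda_e P / \<rho> * (norm (e k))\<^sup>2
    \<le> aug_lagrangian 1 + (\<beta> / 4 + C_lambda_p P / \<rho>) * (norm (p 0))\<^sup>2
      + 2 * C_e_star P * (\<Sum>j<Suc k. (norm (e j))\<^sup>2)"
proof (induction k)
  case 0
  have "0 \<le> C_lambda_e P / \<rho>" "0 \<le> 2 / \<beta>"
    using positive C_lambda_nonneg by auto
  then have "C_lambda_e P / \<rho> \<le> C_e_star P" "0 \<le> C_e_star P"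
    unfolding C_e_star_def by simp_all
  then have "C_lambda_e P / \<rho> \<le> 2 * C_e_star P"
    by linarith
  from mult_right_mono[OF this, of "(norm (e 0))\<^sup>2"] show ?case
    by (simp add: algebra_simps)
next
  case (Suc k)
  have "0 \<le> 2 / \<beta>"
    using positive by auto
  then have "C_lambda_e P / \<rho> \<le> C_e_star P"
    unfolding C_e_star_def by simp
  then have "C_lambda_e P / \<rho> + C_e_star P \<le> 2 * C_e_star P"
    by linarith
  note 1 = mult_right_mono[OF this, of "(norm (e (Suc k)))\<^sup>2"]
  \<comment> \<open>This is the condition on \<rho>: charging the multiplier term twice consumes at
    most \<beta> / 4 of the available \<beta> / 2, so \<beta> / 4 remains.\<close>
  have "2 * (C_lambda_p P / \<rho>) - \<beta> / 4 \<le> 0"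
    using parameters positive unfolding parameter_assumption_def by (simp add: field_simps)
  note 2 = mult_right_mono[OF this, of "(norm (p (Suc k)))\<^sup>2"]
  define a b where "a = C_lambda_p P / \<rho>" and "b = C_lambda_e P / \<rho>"
  show ?case
    using Suc.IH Suc.prems aug_lagrangian_descent[of k] 1 2
    unfolding a_def[symmetric] b_def[symmetric] by (simp add: algebra_simps)
qed

text \<open>Dividing the telescoped inequality by \<beta> / 4 produces \<open>D_0\<close> and
  \<open>D_1\<close>; the squared \<Delta> in \<open>D_0\<close> is the initial step, which precedes
  the telescoping.\<close>

lemma sum_p_bound:
  assumes "0 < K"
  shows "(\<Sum>k<K. (norm (p k))\<^sup>2) \<le> D_0 P (f x0) + D_1 P * (\<Sum>k<K. (norm (e k))\<^sup>2)"
proof -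
  obtain k where K: "K = Suc k"
    using assms gr0_implies_Suc by blast
  define Sp where "Sp = (\<Sum>k<K. (norm (p k))\<^sup>2)"
  define Se where "Se = (\<Sum>k<K. (norm (e k))\<^sup>2)"
  have "0 \<le> C_lambda_p P / \<rho> * (norm (p k))\<^sup>2" "0 \<le> C_lambda_e P / \<rho> * (norm (e k))\<^sup>2"
    using positive C_lambda_nonneg by auto
  moreover have "\<beta> / 4 * (norm (p 0))\<^sup>2 \<le> \<beta> / 4 * \<Delta>\<^sup>2"
    using p_bound[of 0] assms positive by (intro mult_left_mono power_mono) auto
  ultimately have "\<beta> / 4 * Sp \<le> \<beta> / 4 * \<Delta>\<^sup>2 + (Phi_upper P (f x0) - Phi_lower P) + 2 * C_e_star P * Se"
    using aug_lagrangian_sum[of k] aug_lagrangian_upper aug_lagrangian_lower[of k] K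
    unfolding Sp_def Se_def by (simp only: distrib_right) linarith
  then have "Sp \<le> (\<beta> / 4 * \<Delta>\<^sup>2 + (Phi_upper P (f x0) - Phi_lower P) + 2 * C_e_star P * Se) / (\<beta> / 4)"
    using positive by (simp add: pos_le_divide_eq mult.commute)
  also have "\<dots> = D_0 P (f x0) + D_1 P * Se"
    using positive by (simp add: D_0_def D_1_def field_simps)
  finally show ?thesis
    by (simp add: Sp_def Se_def)
qed

text \<open>The residual is taken at the new point while stationarity holds at the old one; the
  transfer adds L_f + L_c \<Lambda> to \<open>A_p\<close>, giving \<open>C_s\<close>. The constraint
  part is the multiplier increment divided by \<rho>, which brings in the previous iteration and
  explains why the output index starts at 1.\<close>

lemma kkt_residual_bound:
  assumes k: "Suc k < K"
  shows "(kkt_residual f c (x (Suc (Suc k))) (l (Suc (Suc k))))\<^sup>2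
    \<le> C_R_st P * ((norm (p (Suc k)))\<^sup>2 + (norm (p k))\<^sup>2 + (norm (e (Suc k)))\<^sup>2 + (norm (e k))\<^sup>2)"
proof -
  let ?x = "x (Suc (Suc k))" and ?l = "l (Suc (Suc k))" and ?p = "p (Suc k)" and ?e = "e (Suc k)"
  note U = x_in_U[OF k]
  have eq: "kkt_grad f c ?x ?l = (grad f ?x - grad f (x (Suc k)))
      + (gradc c ?x *v ?l - gradc c (x (Suc k)) *v ?l)
      + (v (Suc k) + gradc c (x (Suc k)) *v ?l) - ?e"
    by (simp add: kkt_grad_def e_def)
  have 1: "norm (grad f ?x - grad f (x (Suc k))) \<le> L_f P * norm ?p"
    unfolding p_def by (rule grad_lipschitz) (use U in auto)
  have 2: "norm (gradc c ?x *v ?l - gradc c (x (Suc k)) *v ?l) \<le> L_c P * norm ?p * \<Lambda>"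
  proof -
    have "norm (gradc c ?x *v ?l - gradc c (x (Suc k)) *v ?l) \<le> L_c P * norm ?p * norm ?l"
      unfolding p_def by (rule gradc_lipschitz) (use U in auto)
    also have "\<dots> \<le> L_c P * norm ?p * \<Lambda>"
      using l_bound[of "Suc (Suc k)"] k positive by (intro mult_left_mono) auto
    finally show ?thesis .
  qed
  have "norm (kkt_grad f c ?x ?l) \<le> norm (grad f ?x - grad f (x (Suc k)))
      + norm (gradc c ?x *v ?l - gradc c (x (Suc k)) *v ?l)
      + norm (v (Suc k) + gradc c (x (Suc k)) *v ?l) + norm ?e"
    unfolding eq by norm
  also have "\<dots> \<le> C_s P * norm ?p + norm ?e"
    using 1 2 stationarity_bound_linear[OF k] by (simp add: C_s_def A_p_def algebra_simps)
  finally have "(norm (kkt_grad f c ?x ?l))\<^sup>2 \<le> (C_s P * norm ?p + norm ?e)\<^sup>2"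
    by (intro power_mono) auto
  also have "\<dots> \<le> 2 * (C_s P)\<^sup>2 * (norm ?p)\<^sup>2 + 2 * (norm ?e)\<^sup>2"
    using zero_le_power2[of "C_s P * norm ?p - norm ?e"]
    by (simp add: power2_eq_square algebra_simps)
  finally have g: "(norm (kkt_grad f c ?x ?l))\<^sup>2
      \<le> 2 * (C_s P)\<^sup>2 * (norm ?p)\<^sup>2 + 2 * (norm ?e)\<^sup>2" .
  have "(norm (c ?x))\<^sup>2 = (norm (?l - l (Suc k)))\<^sup>2 / \<rho>\<^sup>2"
    using positive by (simp add: multiplier_step[OF k])
  also have "\<dots> \<le> (C_lambda_p P * ((norm ?p)\<^sup>2 + (norm (p k))\<^sup>2)
      + C_lambda_e P * ((norm ?e)\<^sup>2 + (norm (e k))\<^sup>2)) / \<rho>\<^sup>2"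
    using multiplier_difference[OF k] by (intro divide_right_mono) auto
  also have "\<dots> = C_lambda_p P / \<rho>\<^sup>2 * (norm ?p)\<^sup>2 + C_lambda_p P / \<rho>\<^sup>2 * (norm (p k))\<^sup>2
      + C_lambda_e P / \<rho>\<^sup>2 * (norm ?e)\<^sup>2 + C_lambda_e P / \<rho>\<^sup>2 * (norm (e k))\<^sup>2"
    by (simp add: add_divide_distrib algebra_simps)
  finally have "(kkt_residual f c ?x ?l)\<^sup>2
      \<le> (2 * (C_s P)\<^sup>2 + C_lambda_p P / \<rho>\<^sup>2) * (norm ?p)\<^sup>2 + C_lambda_p P / \<rho>\<^sup>2 * (norm (p k))\<^sup>2
      + (2 + C_lambda_e P / \<rho>\<^sup>2) * (norm ?e)\<^sup>2 + C_lambda_e P / \<rho>\<^sup>2 * (norm (e k))\<^sup>2"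
    using g by (simp add: kkt_residual_def algebra_simps)
  also have "\<dots> \<le> C_R_st P * (norm ?p)\<^sup>2 + C_R_st P * (norm (p k))\<^sup>2
      + C_R_st P * (norm ?e)\<^sup>2 + C_R_st P * (norm (e k))\<^sup>2"
    by (intro add_mono mult_right_mono) (auto simp: C_R_st_def le_max_iff_disj)
  finally show ?thesis
    by (simp add: algebra_simps)
qed

end

section \<open>Joint measurability of stochastic gradients\<close>

text \<open>The identity is a pointwise limit of simple functions. Replacing the first argument by
  such a function leaves finitely many sections, each measurable in the second argument; continuity
  gives the limit, and openness of \<open>U\<close> keeps the approximations eventually inside
  \<open>U\<close>.\<close>

lemma borel_measurable_Caratheodory:
  fixes F :: "'a::{metric_space, second_countable_topology} \<Rightarrow> 's \<Rightarrow> real"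
  assumes U: "open U"
    and meas: "\<And>x. x \<in> U \<Longrightarrow> F x \<in> borel_measurable D"
    and cont: "\<And>s. s \<in> space D \<Longrightarrow> continuous_on U (\<lambda>x. F x s)"
  shows "(\<lambda>z. if fst z \<in> U then F (fst z) (snd z) else 0) \<in> borel_measurable (borel \<Otimes>\<^sub>M D)"
proof -
  have "(\<lambda>x. x) \<in> borel_measurable (borel :: 'a measure)"
    by simp
  from borel_measurable_implies_sequence_metric[OF this, of undefined]
  obtain S where S: "\<And>i. simple_function (borel :: 'a measure) (S i)"
    and lim: "\<And>x. (\<lambda>i. S i x) \<longlonglongrightarrow> x"
    by auto
  have [measurable]: "U \<in> sets borel"
    using U by simp
  show ?thesis
  proof (rule borel_measurable_LIMSEQ_metric)
    fix i
    have fin: "finite (range (S i))"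
      using simple_functionD(1)[OF S[of i]] by simp
    have "S i \<in> borel \<rightarrow>\<^sub>M count_space (range (S i))"
      using simple_functionD[OF S[of i]] by (subst measurable_count_space_eq2[OF fin]) auto
    then have g: "(\<lambda>z. S i (fst z)) \<in> (borel \<Otimes>\<^sub>M D) \<rightarrow>\<^sub>M count_space (range (S i))"
      by (rule measurable_compose[OF measurable_fst])
    show "(\<lambda>z. if fst z \<in> U then if S i (fst z) \<in> U then F (S i (fst z)) (snd z) else 0 else 0)
        \<in> borel_measurable (borel \<Otimes>\<^sub>M D)"
    proof (rule measurable_compose_countable'[OF _ g countable_finite[OF fin]])
      fix y
      have "(\<lambda>z. if y \<in> U then F y (snd z) else 0) \<in> borel_measurable (borel \<Otimes>\<^sub>M D)"
        using measurable_compose[OF measurable_snd meas[of y]] by (cases "y \<in> U") auto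
      then show "(\<lambda>z. if fst z \<in> U then if y \<in> U then F y (snd z) else 0 else 0)
          \<in> borel_measurable (borel \<Otimes>\<^sub>M D)"
        by measurable
    qed
  next
    fix z assume z: "z \<in> space (borel \<Otimes>\<^sub>M D :: ('a \<times> 's) measure)"
    show "(\<lambda>i. if fst z \<in> U then if S i (fst z) \<in> U then F (S i (fst z)) (snd z) else 0 else 0)
        \<longlonglongrightarrow> (if fst z \<in> U then F (fst z) (snd z) else 0)"
    proof (cases "fst z \<in> U")
      case True
      have "isCont (\<lambda>x. F x (snd z)) (fst z)"
        using cont[of "snd z"] z True U by (auto simp: space_pair_measure continuous_on_eq_continuous_at)
      then have "(\<lambda>i. F (S i (fst z)) (snd z)) \<longlonglongrightarrow> F (fst z) (snd z)"
        using lim by (rule isCont_tendsto_compose)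
      moreover have "\<forall>\<^sub>F i in sequentially. S i (fst z) \<in> U"
        using lim U True by (rule topological_tendstoD)
      then have "\<forall>\<^sub>F i in sequentially. F (S i (fst z)) (snd z)
          = (if fst z \<in> U then if S i (fst z) \<in> U then F (S i (fst z)) (snd z) else 0 else 0)"
        by eventually_elim (use True in simp)
      ultimately show ?thesis
        using True by (simp add: tendsto_cong)
    qed simp
  qed
qed

lemma GDERIV_difference_quotient:
  assumes "GDERIV f x :> d"
  shows "(\<lambda>n. (f (x + (1 / real (Suc n)) *\<^sub>R i) - f x) * real (Suc n)) \<longlonglongrightarrow> i \<bullet> d"
proof -
  have "((\<lambda>t. x + t *\<^sub>R i) has_derivative (\<lambda>h. h *\<^sub>R i)) (at 0)"
    by (auto intro!: derivative_eq_intros)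
  moreover have "(f has_derivative (\<lambda>h. h \<bullet> d)) (at (x + 0 *\<^sub>R i))"
    using assms by (simp add: gderiv_def)
  ultimately have "((\<lambda>t. f (x + t *\<^sub>R i)) has_derivative (\<lambda>h. (h *\<^sub>R i) \<bullet> d)) (at 0)"
    by (rule has_derivative_compose)
  then have "((\<lambda>t. f (x + t *\<^sub>R i)) has_real_derivative i \<bullet> d) (at 0)"
    by (simp add: has_field_derivative_def mult_commute_abs)
  then have "((\<lambda>t. (f (x + t *\<^sub>R i) - f x) / t) \<longlongrightarrow> i \<bullet> d) (at 0)"
    by (simp add: DERIV_def)
  moreover have "filterlim (\<lambda>n. 1 / real (Suc n)) (at 0) sequentially"
    using LIMSEQ_inverse_real_of_nat by (intro filterlim_atI) (auto simp: inverse_eq_divide)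
  ultimately have "(\<lambda>n. (f (x + (1 / real (Suc n)) *\<^sub>R i) - f x) / (1 / real (Suc n))) \<longlonglongrightarrow> i \<bullet> d"
    by (rule filterlim_compose)
  then show ?thesis
    by simp
qed

text \<open>The gradient need not be continuous, but it is a limit of difference quotients of a function
  that is continuous in the first argument and measurable in the second one.\<close>
lemma measurable_stochastic_gradient:
  fixes F :: "'a::euclidean_space \<Rightarrow> 's \<Rightarrow> real"
  assumes U: "open U"
    and meas: "\<And>x. x \<in> U \<Longrightarrow> F x \<in> borel_measurable D"
    and diff: "AE s in D. \<forall>x\<in>U. (\<lambda>y. F y s) differentiable (at x)"
  shows "\<exists>g. (\<lambda>z. g (fst z) (snd z)) \<in> borel_measurable (borel \<Otimes>\<^sub>M D) \<and>
    (AE s in D. \<forall>x\<in>U. g x s = grad (\<lambda>y. F y s) x)"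
proof -
  \<comment> \<open>The set of bad samples need not be measurable. It is enlarged to a measurable
    null set on which \<open>H\<close> and \<open>g\<close> vanish, so that continuity in the first
    argument holds for every sample.\<close>
  obtain N where N: "{s \<in> space D. \<not> (\<forall>x\<in>U. (\<lambda>y. F y s) differentiable (at x))} \<subseteq> N"
    and N_null: "N \<in> null_sets D"
    using diff unfolding eventually_ae_filter by blast
  have [measurable]: "N \<in> sets D"
    using N_null by auto
  define H where "H = (\<lambda>z. if fst z \<in> U then if snd z \<in> N then 0 else F (fst z) (snd z) else 0)"
  have H [measurable]: "H \<in> borel_measurable (borel \<Otimes>\<^sub>M D)"
    unfolding H_def
  proof (rule borel_measurable_Caratheodory[OF U, of "\<lambda>x s. if s \<in> N then 0 else F x s"])
    fix x assume "x \<in> U"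
    note [measurable] = meas[OF this]
    show "(\<lambda>s. if s \<in> N then 0 else F x s) \<in> borel_measurable D"
      by measurable
  next
    fix s assume s: "s \<in> space D"
    show "continuous_on U (\<lambda>x. if s \<in> N then 0 else F x s)"
    proof (cases "s \<in> N")
      case False
      then have "\<forall>x\<in>U. (\<lambda>y. F y s) differentiable (at x)"
        using N s by blast
      then have "continuous_on U (\<lambda>x. F x s)"
        by (auto intro!: continuous_at_imp_continuous_on differentiable_imp_continuous_within)
      then show ?thesis
        using False by simp
    qed simp
  qed
  define g where "g = (\<lambda>x s. if x \<in> U then if s \<in> N then 0 else grad (\<lambda>y. F y s) x else 0)"
  have [measurable]: "U \<in> sets borel"
    using U by simp
  have "(\<lambda>z. g (fst z) (snd z)) \<in> borel_measurable (borel \<Otimes>\<^sub>M D)"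
  proof (subst borel_measurable_euclidean_space, rule ballI)
    fix i :: 'a assume "i \<in> Basis"
    let ?q = "\<lambda>n z. if fst z \<in> U then
      (H (fst z + (1 / real (Suc n)) *\<^sub>R i, snd z) - H z) * real (Suc n) else 0"
    show "(\<lambda>z. g (fst z) (snd z) \<bullet> i) \<in> borel_measurable (borel \<Otimes>\<^sub>M D)"
    proof (rule borel_measurable_LIMSEQ_metric[where f = ?q])
      show "?q n \<in> borel_measurable (borel \<Otimes>\<^sub>M D)" for n
        by measurable
    next
      fix z assume z: "z \<in> space (borel \<Otimes>\<^sub>M D :: ('a \<times> 's) measure)"
      obtain y s where ys: "z = (y, s)" by (cases z)
      show "(\<lambda>n. ?q n z) \<longlonglongrightarrow> g (fst z) (snd z) \<bullet> i"
      proof (cases "y \<in> U \<and> s \<notin> N")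
        case True
        then have "GDERIV (\<lambda>y. F y s) y :> grad (\<lambda>y. F y s) y"
          using N z ys by (intro GDERIV_grad) (auto simp: space_pair_measure)
        then have "(\<lambda>n. (F (y + (1 / real (Suc n)) *\<^sub>R i) s - F y s) * real (Suc n))
            \<longlonglongrightarrow> i \<bullet> grad (\<lambda>y. F y s) y"
          by (rule GDERIV_difference_quotient)
        moreover have "(\<lambda>n. y + (1 / real (Suc n)) *\<^sub>R i) \<longlonglongrightarrow> y + 0 *\<^sub>R i"
          using LIMSEQ_inverse_real_of_nat
          by (intro tendsto_add tendsto_scaleR tendsto_const) (auto simp: inverse_eq_divide)
        then have "\<forall>\<^sub>F n in sequentially. y + (1 / real (Suc n)) *\<^sub>R i \<in> U"
          using U True by (intro topological_tendstoD) auto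
        then have "\<forall>\<^sub>F n in sequentially.
            (F (y + (1 / real (Suc n)) *\<^sub>R i) s - F y s) * real (Suc n) = ?q n z"
          by eventually_elim (use True ys in \<open>simp add: H_def\<close>)
        ultimately have "(\<lambda>n. ?q n z) \<longlonglongrightarrow> i \<bullet> grad (\<lambda>y. F y s) y"
          by (rule Lim_transform_eventually)
        moreover have "g (fst z) (snd z) \<bullet> i = i \<bullet> grad (\<lambda>y. F y s) y"
          using True ys by (simp add: g_def inner_commute)
        ultimately show ?thesis
          by (simp only:)
      next
        case False
        then have "?q n z = 0" for n
          by (auto simp: ys H_def)
        then show ?thesis
          using False by (auto simp: g_def ys)
      qed
    qed
  qed
  moreover have "AE s in D. \<forall>x\<in>U. g x s = grad (\<lambda>y. F y s) x"
    using AE_not_in[OF N_null] by eventually_elim (simp add: g_def)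
  ultimately show ?thesis
    by blast
qed


section \<open>Second moments of batch averages\<close>

text \<open>The cross term vanishes because \<open>Y\<close> is centered. If the second moment is
  infinite, so is the right-hand side; otherwise everything is integrable and the square may be
  expanded.\<close>

lemma (in prob_space) nn_integral_norm_add_sq:
  fixes Y :: "'a \<Rightarrow> 'b::euclidean_space"
  assumes Y: "integrable M Y" "expectation Y = 0"
  shows "(\<integral>\<^sup>+ s. ennreal ((norm (a + Y s))\<^sup>2) \<partial>M)
    \<le> ennreal ((norm a)\<^sup>2) + (\<integral>\<^sup>+ s. ennreal ((norm (Y s))\<^sup>2) \<partial>M)"
proof (cases "(\<integral>\<^sup>+ s. ennreal ((norm (Y s))\<^sup>2) \<partial>M) = \<infinity>")
  case False
  have [measurable]: "Y \<in> borel_measurable M"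
    using Y by simp
  have sq: "integrable M (\<lambda>s. (norm (Y s))\<^sup>2)"
    using False by (intro integrableI_nonneg) (auto simp: top.not_eq_extremum)
  have eq: "(norm (a + Y s))\<^sup>2 = (norm a)\<^sup>2 + 2 * (a \<bullet> Y s) + (norm (Y s))\<^sup>2" for s
    by (simp add: power2_norm_eq_inner inner_add_left inner_add_right inner_commute)
  have nonneg: "0 \<le> (norm a)\<^sup>2 + 2 * (a \<bullet> Y s) + (norm (Y s))\<^sup>2" for s
    using zero_le_power2[of "norm (a + Y s)"] unfolding eq .
  have int: "integrable M (\<lambda>s. (norm a)\<^sup>2 + 2 * (a \<bullet> Y s) + (norm (Y s))\<^sup>2)"
    using Y sq by simp
  have "(\<integral>\<^sup>+ s. ennreal ((norm (a + Y s))\<^sup>2) \<partial>M)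
      = ennreal (expectation (\<lambda>s. (norm a)\<^sup>2 + 2 * (a \<bullet> Y s) + (norm (Y s))\<^sup>2))"
    unfolding eq using int nonneg by (intro nn_integral_eq_integral) auto
  also have "expectation (\<lambda>s. (norm a)\<^sup>2 + 2 * (a \<bullet> Y s) + (norm (Y s))\<^sup>2)
      = (norm a)\<^sup>2 + expectation (\<lambda>s. (norm (Y s))\<^sup>2)"
    using Y sq by (simp add: prob_space)
  also have "ennreal \<dots> = ennreal ((norm a)\<^sup>2) + (\<integral>\<^sup>+ s. ennreal ((norm (Y s))\<^sup>2) \<partial>M)"
    using sq by (simp add: nn_integral_eq_integral)
  finally show ?thesis by simp
qed simp

lemma (in prob_space) nn_integral_norm_centered_sq_le:
  fixes Y :: "'a \<Rightarrow> 'b::euclidean_space"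
  assumes Y: "integrable M Y"
  shows "(\<integral>\<^sup>+ s. ennreal ((norm (Y s - expectation Y))\<^sup>2) \<partial>M)
    \<le> (\<integral>\<^sup>+ s. ennreal ((norm (Y s))\<^sup>2) \<partial>M)"
proof (cases "(\<integral>\<^sup>+ s. ennreal ((norm (Y s))\<^sup>2) \<partial>M) = \<infinity>")
  case False
  let ?m = "expectation Y"
  have [measurable]: "Y \<in> borel_measurable M"
    using Y by simp
  have sq: "integrable M (\<lambda>s. (norm (Y s))\<^sup>2)"
    using False by (intro integrableI_nonneg) (auto simp: top.not_eq_extremum)
  have eq: "(norm (Y s - ?m))\<^sup>2 = (norm ?m)\<^sup>2 - 2 * (?m \<bullet> Y s) + (norm (Y s))\<^sup>2" for s
    by (simp add: power2_norm_eq_inner inner_diff_left inner_diff_right inner_commute)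
  have nonneg: "0 \<le> (norm ?m)\<^sup>2 - 2 * (?m \<bullet> Y s) + (norm (Y s))\<^sup>2" for s
    using zero_le_power2[of "norm (Y s - ?m)"] unfolding eq .
  have int: "integrable M (\<lambda>s. (norm ?m)\<^sup>2 - 2 * (?m \<bullet> Y s) + (norm (Y s))\<^sup>2)"
    using Y sq by simp
  have "(\<integral>\<^sup>+ s. ennreal ((norm (Y s - ?m))\<^sup>2) \<partial>M)
      = ennreal (expectation (\<lambda>s. (norm ?m)\<^sup>2 - 2 * (?m \<bullet> Y s) + (norm (Y s))\<^sup>2))"
    unfolding eq using int nonneg by (intro nn_integral_eq_integral) auto
  also have "expectation (\<lambda>s. (norm ?m)\<^sup>2 - 2 * (?m \<bullet> Y s) + (norm (Y s))\<^sup>2)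
      = expectation (\<lambda>s. (norm (Y s))\<^sup>2) - (norm ?m)\<^sup>2"
    using Y sq by (simp add: prob_space power2_norm_eq_inner)
  also have "ennreal \<dots> \<le> ennreal (expectation (\<lambda>s. (norm (Y s))\<^sup>2))"
    by (intro ennreal_leI) simp
  also have "\<dots> = (\<integral>\<^sup>+ s. ennreal ((norm (Y s))\<^sup>2) \<partial>M)"
    using sq by (simp add: nn_integral_eq_integral)
  finally show ?thesis .
qed simp

text \<open>Coordinates are integrated out one at a time: with the others fixed, \<open>a\<close>
  plus the partial sum is a constant shift of one centered variable. In the application
  \<open>a\<close> is the error inherited from the previous iteration.\<close>

lemma (in prob_space) nn_integral_norm_add_sum_sq:
  fixes Y :: "'a \<Rightarrow> 'b::euclidean_space"
  assumes Y: "integrable M Y" "expectation Y = 0" and I: "finite I"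
  shows "(\<integral>\<^sup>+ s. ennreal ((norm (a + (\<Sum>i\<in>I. Y (s i))))\<^sup>2) \<partial>PiM I (\<lambda>_. M))
    \<le> ennreal ((norm a)\<^sup>2) + of_nat (card I) * (\<integral>\<^sup>+ s. ennreal ((norm (Y s))\<^sup>2) \<partial>M)"
  using I
proof (induction I)
  case empty
  then show ?case
    by (simp add: product_sigma_finite.nn_integral_empty product_sigma_finite_def
        sigma_finite_measure_axioms PiM_empty)
next
  case (insert j I)
  let ?v = "\<integral>\<^sup>+ s. ennreal ((norm (Y s))\<^sup>2) \<partial>M"
  interpret I: product_sigma_finite "\<lambda>_. M"
    by (simp add: product_sigma_finite_def sigma_finite_measure_axioms)
  interpret PI: prob_space "PiM I (\<lambda>_. M)"
    by (rule prob_space_PiM) (rule prob_space_axioms)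
  have [measurable]: "Y \<in> borel_measurable M"
    using Y by simp
  have "(\<integral>\<^sup>+ s. ennreal ((norm (a + (\<Sum>i\<in>insert j I. Y (s i))))\<^sup>2) \<partial>PiM (insert j I) (\<lambda>_. M))
      = (\<integral>\<^sup>+ s. \<integral>\<^sup>+ t. ennreal ((norm (a + (\<Sum>i\<in>insert j I. Y ((s(j := t)) i))))\<^sup>2) \<partial>M
          \<partial>PiM I (\<lambda>_. M))"
    using insert by (subst I.product_nn_integral_insert) auto
  also have "\<dots> = (\<integral>\<^sup>+ s. \<integral>\<^sup>+ t. ennreal ((norm ((a + (\<Sum>i\<in>I. Y (s i))) + Y t))\<^sup>2) \<partial>M \<partial>PiM I (\<lambda>_. M))"
  proof -
    have "(\<Sum>i\<in>insert j I. Y ((s(j := t)) i)) = Y t + (\<Sum>i\<in>I. Y (s i))" for s t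
      using insert by (simp add: sum.insert) (intro sum.cong, auto)
    then show ?thesis
      by (simp add: add_ac)
  qed
  also have "\<dots> \<le> (\<integral>\<^sup>+ s. ennreal ((norm (a + (\<Sum>i\<in>I. Y (s i))))\<^sup>2) + ?v \<partial>PiM I (\<lambda>_. M))"
    by (intro nn_integral_mono nn_integral_norm_add_sq Y)
  also have "\<dots> = (\<integral>\<^sup>+ s. ennreal ((norm (a + (\<Sum>i\<in>I. Y (s i))))\<^sup>2) \<partial>PiM I (\<lambda>_. M)) + ?v"
    by (subst nn_integral_add) (auto simp: PI.emeasure_space_1)
  also have "\<dots> \<le> ennreal ((norm a)\<^sup>2) + of_nat (card I) * ?v + ?v"
    by (intro add_mono insert.IH order_refl)
  also have "\<dots> = ennreal ((norm a)\<^sup>2) + of_nat (card (insert j I)) * ?v"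
    using insert by (simp add: algebra_simps)
  finally show ?case .
qed

text \<open>Each centered summand scaled by 1 / N has second moment at most
  \<open>t / (real N)\<^sup>2\<close>, and there are N of them.\<close>

lemma (in prob_space) nn_integral_norm_add_average_sq:
  fixes Y :: "'a \<Rightarrow> 'b::euclidean_space"
  assumes Y: "integrable M Y" and N: "0 < N" and t: "0 \<le> t"
    and var: "(\<integral>\<^sup>+ s. ennreal ((norm (Y s - expectation Y))\<^sup>2) \<partial>M) \<le> ennreal t"
  shows "(\<integral>\<^sup>+ s. ennreal ((norm (a + ((1 / real N) *\<^sub>R (\<Sum>i<N. Y (s i)) - expectation Y)))\<^sup>2)
      \<partial>PiM {..<N} (\<lambda>_. M))
    \<le> ennreal ((norm a)\<^sup>2 + t / real N)"
proof -
  let ?Z = "\<lambda>s. (1 / real N) *\<^sub>R (Y s - expectation Y)"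
  have Z: "integrable M ?Z" "expectation ?Z = 0"
    using Y by (simp_all add: prob_space)
  have [measurable]: "Y \<in> borel_measurable M"
    using Y by simp
  have eq: "(1 / real N) *\<^sub>R (\<Sum>i<N. Y (s i)) - expectation Y = (\<Sum>i<N. ?Z (s i))" for s
    using N by (simp add: scaleR_sum_right[symmetric] sum_subtractf scaleR_diff_right
        sum_constant_scaleR)
  have "(\<integral>\<^sup>+ s. ennreal ((norm (?Z s))\<^sup>2) \<partial>M)
      = ennreal (1 / (real N)\<^sup>2) * (\<integral>\<^sup>+ s. ennreal ((norm (Y s - expectation Y))\<^sup>2) \<partial>M)"
    by (subst nn_integral_cmult[symmetric])
       (auto simp: power_divide ennreal_mult[symmetric] power_mult_distrib intro!: nn_integral_cong)
  also have "\<dots> \<le> ennreal (1 / (real N)\<^sup>2) * ennreal t"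
    using var by (intro mult_left_mono) auto
  finally have v: "(\<integral>\<^sup>+ s. ennreal ((norm (?Z s))\<^sup>2) \<partial>M) \<le> ennreal (t / (real N)\<^sup>2)"
    by (simp add: ennreal_mult[symmetric] t)
  have "(\<integral>\<^sup>+ s. ennreal ((norm (a + ((1 / real N) *\<^sub>R (\<Sum>i<N. Y (s i)) - expectation Y)))\<^sup>2)
      \<partial>PiM {..<N} (\<lambda>_. M))
    \<le> ennreal ((norm a)\<^sup>2) + of_nat (card {..<N}) * (\<integral>\<^sup>+ s. ennreal ((norm (?Z s))\<^sup>2) \<partial>M)"
    unfolding eq by (rule nn_integral_norm_add_sum_sq[OF Z]) simp
  also have "\<dots> \<le> ennreal ((norm a)\<^sup>2) + ennreal (real N) * ennreal (t / (real N)\<^sup>2)"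
    using v by (intro add_mono mult_mono) (auto simp: ennreal_of_nat_eq_real_of_nat)
  also have "\<dots> = ennreal ((norm a)\<^sup>2 + real N * (t / (real N)\<^sup>2))"
    using t by (simp add: ennreal_mult[symmetric])
  also have "real N * (t / (real N)\<^sup>2) = t / real N"
    by (simp add: power2_eq_square)
  finally show ?thesis .
qed


section \<open>Independence\<close>

lemma (in prob_space) indep_set_commute:
  assumes "indep_set A B"
  shows "indep_set B A"
proof (rule indep_setI)
  show "B \<subseteq> events" "A \<subseteq> events"
    using assms unfolding indep_set_def indep_sets_def by (auto split: bool.splits)
  show "prob (b \<inter> a) = prob b * prob a" if "b \<in> B" "a \<in> A" for a b
    using indep_setD[OF assms that(2,1)] by (simp add: Int_commute mult.commute)
qed

text \<open>Independence of the \<sigma>-algebras makes the joint law a product, and Tonelli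
  evaluates the inner integral with \<open>X\<close> frozen. This takes the place of conditional
  expectation given the history.\<close>

lemma (in prob_space) nn_integral_indep_set:
  assumes indep: "indep_set (sets A) (sets B)"
    and space: "space A = space M" "space B = space M"
    and X: "X \<in> A \<rightarrow>\<^sub>M S" and Y: "Y \<in> B \<rightarrow>\<^sub>M T"
    and g [measurable]: "g \<in> borel_measurable (S \<Otimes>\<^sub>M T)"
  shows "(\<integral>\<^sup>+ \<omega>. g (X \<omega>, Y \<omega>) \<partial>M) = (\<integral>\<^sup>+ \<omega>. \<integral>\<^sup>+ t. g (X \<omega>, t) \<partial>distr M T Y \<partial>M)"
proof -
  have sub: "sets A \<subseteq> events" "sets B \<subseteq> events"
    using indep unfolding indep_set_def indep_sets_def by (auto split: bool.splits)
  have [measurable]: "X \<in> M \<rightarrow>\<^sub>M S" "Y \<in> M \<rightarrow>\<^sub>M T"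
    using X Y sub space by (auto simp: measurable_def)
  have eq: "distr M S X \<Otimes>\<^sub>M distr M T Y = distr M (S \<Otimes>\<^sub>M T) (\<lambda>\<omega>. (X \<omega>, Y \<omega>))"
  proof (rule pair_measure_eqI)
    show "sigma_finite_measure (distr M S X)" "sigma_finite_measure (distr M T Y)"
      by (auto intro!: prob_space_imp_sigma_finite prob_space_distr)
  next
    fix C E assume "C \<in> sets (distr M S X)" "E \<in> sets (distr M T Y)"
    then have [measurable]: "C \<in> sets S" "E \<in> sets T" by auto
    have "X -` C \<inter> space M \<in> sets A" "Y -` E \<inter> space M \<in> sets B"
      using measurable_sets[OF X, of C] measurable_sets[OF Y, of E] space by auto
    moreover have "(X -` C \<inter> space M) \<inter> (Y -` E \<inter> space M)
        = (\<lambda>\<omega>. (X \<omega>, Y \<omega>)) -` (C \<times> E) \<inter> space M"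
      by auto
    ultimately have "prob (X -` C \<inter> space M) * prob (Y -` E \<inter> space M)
        = prob ((\<lambda>\<omega>. (X \<omega>, Y \<omega>)) -` (C \<times> E) \<inter> space M)"
      using indep_setD[OF indep] by metis
    then show "emeasure (distr M S X) C * emeasure (distr M T Y) E
        = emeasure (distr M (S \<Otimes>\<^sub>M T) (\<lambda>\<omega>. (X \<omega>, Y \<omega>))) (C \<times> E)"
      by (simp add: emeasure_distr emeasure_eq_measure ennreal_mult[symmetric])
  qed (simp cong: sets_pair_measure_cong)
  interpret T: prob_space "distr M T Y"
    by (rule prob_space_distr) simp
  have "(\<integral>\<^sup>+ \<omega>. g (X \<omega>, Y \<omega>) \<partial>M) = (\<integral>\<^sup>+ z. g z \<partial>distr M (S \<Otimes>\<^sub>M T) (\<lambda>\<omega>. (X \<omega>, Y \<omega>)))"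
    by (simp add: nn_integral_distr)
  also have "\<dots> = (\<integral>\<^sup>+ y. \<integral>\<^sup>+ t. g (y, t) \<partial>distr M T Y \<partial>distr M S X)"
    unfolding eq[symmetric] by (rule T.nn_integral_fst[symmetric]) simp
  also have "\<dots> = (\<integral>\<^sup>+ \<omega>. \<integral>\<^sup>+ t. g (X \<omega>, t) \<partial>distr M T Y \<partial>M)"
    by (intro nn_integral_distr) (auto intro!: T.borel_measurable_nn_integral)
  finally show ?thesis .
qed

section \<open>Measurability of linear solves\<close>

lemma borel_measurable_vec_iff:
  fixes f :: "'a \<Rightarrow> real^'n"
  shows "f \<in> borel_measurable M \<longleftrightarrow> (\<forall>i. (\<lambda>z. f z $ i) \<in> borel_measurable M)"
  by (subst borel_measurable_euclidean_space) (auto simp: Basis_vec_def cart_eq_inner_axis)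

lemma borel_measurable_vec_nth [measurable (raw)]:
  fixes f :: "'a \<Rightarrow> real^'n"
  shows "f \<in> borel_measurable M \<Longrightarrow> (\<lambda>z. f z $ i) \<in> borel_measurable M"
  by (simp add: borel_measurable_vec_iff)

lemma borel_measurable_mat_nth [measurable (raw)]:
  fixes A :: "'a \<Rightarrow> real^'m^'n"
  assumes "A \<in> borel_measurable M"
  shows "(\<lambda>z. A z $ i $ j) \<in> borel_measurable M"
proof -
  have "continuous_on UNIV (\<lambda>B :: real^'m^'n. B $ i $ j)"
    by (intro continuous_intros)
  from borel_measurable_continuous_on[OF this assms] show ?thesis .
qed

lemma borel_measurable_det:
  fixes A :: "'a \<Rightarrow> real^'n^'n"
  assumes "\<And>i j. (\<lambda>z. A z $ i $ j) \<in> borel_measurable M"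
  shows "(\<lambda>z. det (A z)) \<in> borel_measurable M"
  unfolding det_def using assms
  by (intro borel_measurable_sum borel_measurable_times borel_measurable_prod borel_measurable_const)

lemma borel_measurable_matrix_vector [measurable (raw)]:
  fixes A :: "'a \<Rightarrow> real^'m^'n"
  assumes [measurable]: "A \<in> borel_measurable M" "w \<in> borel_measurable M"
  shows "(\<lambda>z. A z *v w z) \<in> borel_measurable M"
  unfolding borel_measurable_vec_iff by (simp add: matrix_vector_mult_def)

text \<open>Cramer's rule makes the measurable dependence of the solution on the data explicit.\<close>
definition cramer_solution :: "real^'n^'n \<Rightarrow> real^'n \<Rightarrow> real^'n" where
  "cramer_solution A w = (\<chi> k. det (\<chi> i j. if j = k then w $ i else A $ i $ j) / det A)"

lemma cramer_solution_eq: "invertible A \<Longrightarrow> A *v p = w \<Longrightarrow> p = cramer_solution A w"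
  unfolding cramer_solution_def by (simp add: cramer invertible_det_nz)

lemma borel_measurable_cramer_lalm [measurable (raw)]:
  fixes A :: "'a \<Rightarrow> real^'m^'n"
  assumes [measurable]: "A \<in> borel_measurable M" "w \<in> borel_measurable M"
  shows "(\<lambda>z. cramer_solution (lalm_matrix b r (A z)) (w z)) \<in> borel_measurable M"
proof -
  have [measurable]: "(\<lambda>z. lalm_matrix b r (A z) $ i $ j) \<in> borel_measurable M" for i j
    unfolding lalm_matrix_def by (simp add: matrix_matrix_mult_def transpose_def)
  show ?thesis
    unfolding borel_measurable_vec_iff cramer_solution_def vec_lambda_beta
    by (intro allI borel_measurable_divide borel_measurable_det) (simp_all add: if_distrib)
qed

section \<open>The stochastic run\<close>

lemma measurable_sigma_vimage:
  assumes "\<G> \<subseteq> Pow \<Omega>" and "sets (vimage_algebra \<Omega> Z N) \<subseteq> \<G>" and "Z \<in> \<Omega> \<rightarrow> space N"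
  shows "Z \<in> sigma \<Omega> \<G> \<rightarrow>\<^sub>M N"
proof (rule measurableI)
  fix A assume "A \<in> sets N"
  then have "Z -` A \<inter> \<Omega> \<in> sets (vimage_algebra \<Omega> Z N)"
    by (rule in_vimage_algebra)
  then show "Z -` A \<inter> space (sigma \<Omega> \<G>) \<in> sets (sigma \<Omega> \<G>)"
    using assms by (auto simp: space_measure_of_conv sets_measure_of)
qed (use assms in \<open>auto simp: space_measure_of_conv\<close>)

text \<open>\<open>Q\<close>, \<open>B\<close> and \<open>b\<close> stay general positive integers
  throughout the moment recursion; their relation to \<open>K\<close> enters in
  \<open>expected_sums\<close>.\<close>

locale stochastic_lalm_run = prob_space M for M :: "'w measure" +
  fixes P :: lalm_consts and U :: "(real^'n) set"
    and f :: "real^'n \<Rightarrow> real" and c :: "real^'n \<Rightarrow> real^'m"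
    and D :: "'s measure" and F :: "real^'n \<Rightarrow> 's \<Rightarrow> real"
    and x0 :: "real^'n" and l0 :: "real^'m" and Q B b K :: nat
    and xi :: "nat \<Rightarrow> nat \<Rightarrow> 'w \<Rightarrow> 's"
    and x :: "nat \<Rightarrow> 'w \<Rightarrow> real^'n" and l :: "nat \<Rightarrow> 'w \<Rightarrow> real^'m" and h :: "nat \<Rightarrow> 'w \<Rightarrow> real^'n"
  assumes regularity: "regularity_assumption P U f c"
    and gradients: "oracle_assumption P U f D F"
    and parameters: "parameter_assumption P c x0 l0"
    and run: "stochastic_nr_lalm P c D F x0 l0 Q B b K M xi x l h"
    and region: "AE \<omega> in M. \<forall>k<K. closed_segment (x k \<omega>) (x (k + 1) \<omega>) \<subseteq> U"
    and sizes: "0 < Q" "0 < B" "0 < b" "0 < K"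
begin

abbreviation "N \<equiv> batch_size Q B b"

lemma N_pos: "0 < N k"
  using sizes by (simp add: batch_size_def)

lemma open_U: "open U" and U_borel [measurable]: "U \<in> sets borel"
  using regularity by (auto simp: regularity_assumption_def)

sublocale D: prob_space D
  using gradients by (simp add: oracle_assumption_def)

lemma xlh_measurable [measurable]:
  "k \<le> K \<Longrightarrow> x k \<in> borel_measurable M" "k \<le> K \<Longrightarrow> l k \<in> borel_measurable M"
  "k < K \<Longrightarrow> h k \<in> borel_measurable M"
  using run by (auto simp: stochastic_nr_lalm_def)

lemma xi_measurable [measurable]: "k < K \<Longrightarrow> i < N k \<Longrightarrow> xi k i \<in> M \<rightarrow>\<^sub>M D"
  and xi_distr: "k < K \<Longrightarrow> i < N k \<Longrightarrow> distr M D (xi k i) = D"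
  using run by (auto simp: stochastic_nr_lalm_def)

text \<open>Measurability in the sample at each fixed point does not allow a random iterate to be
  inserted. A jointly measurable version does, and it agrees with the gradient on all of
  \<open>U\<close> outside one null set of samples.\<close>

definition sgrad :: "real^'n \<Rightarrow> 's \<Rightarrow> real^'n" where
  "sgrad = (SOME g. (\<lambda>z. g (fst z) (snd z)) \<in> borel_measurable (borel \<Otimes>\<^sub>M D) \<and>
    (AE s in D. \<forall>y\<in>U. g y s = grad (\<lambda>y. F y s) y))"

lemma sgrad_joint_measurable: "(\<lambda>z. sgrad (fst z) (snd z)) \<in> borel_measurable (borel \<Otimes>\<^sub>M D)"
  and sgrad_AE: "AE s in D. \<forall>y\<in>U. sgrad y s = grad (\<lambda>y. F y s) y"
proof -
  have meas: "F y \<in> borel_measurable D" if "y \<in> U" for y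
    using gradients that by (auto simp: oracle_assumption_def)
  have diff: "AE s in D. \<forall>y\<in>U. (\<lambda>y. F y s) differentiable (at y)"
    using gradients by (simp add: oracle_assumption_def)
  from measurable_stochastic_gradient[of U F D, OF open_U meas diff]
  have "(\<lambda>z. sgrad (fst z) (snd z)) \<in> borel_measurable (borel \<Otimes>\<^sub>M D) \<and>
      (AE s in D. \<forall>y\<in>U. sgrad y s = grad (\<lambda>y. F y s) y)"
    unfolding sgrad_def by (rule someI_ex)
  then show "(\<lambda>z. sgrad (fst z) (snd z)) \<in> borel_measurable (borel \<Otimes>\<^sub>M D)"
    and "AE s in D. \<forall>y\<in>U. sgrad y s = grad (\<lambda>y. F y s) y" by auto
qed

lemma sgrad_measurable [measurable (raw)]:
  assumes "Y \<in> borel_measurable M'" "Z \<in> M' \<rightarrow>\<^sub>M D"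
  shows "(\<lambda>\<omega>. sgrad (Y \<omega>) (Z \<omega>)) \<in> borel_measurable M'"
  using measurable_compose[OF measurable_Pair[OF assms] sgrad_joint_measurable] by simp

text \<open>Cut off outside \<open>U\<close>, where the derivatives need not be measurable.\<close>
definition gf :: "real^'n \<Rightarrow> real^'n" where "gf y = (if y \<in> U then grad f y else 0)"
definition gA :: "real^'n \<Rightarrow> real^'m^'n" where "gA y = (if y \<in> U then gradc c y else 0)"
definition cU :: "real^'n \<Rightarrow> real^'m" where "cU y = (if y \<in> U then c y else 0)"
definition proj :: "real^'n \<Rightarrow> real^'n" where "proj = closest_point (cball 0 (G_f P))"

lemma G_pos: "0 < G_f P"
  using regularity by (simp add: regularity_assumption_def)

lemma gf_measurable [measurable]: "gf \<in> borel_measurable borel"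
  and gA_measurable [measurable]: "gA \<in> borel_measurable borel"
  and cU_measurable [measurable]: "cU \<in> borel_measurable borel"
  and proj_measurable [measurable]: "proj \<in> borel_measurable borel"
proof -
  have "continuous_on U (grad f)" "continuous_on U (gradc c)" "\<forall>x\<in>U. c differentiable (at x)"
    using regularity by (auto simp: regularity_assumption_def)
  moreover from this(3) have "continuous_on U c"
    by (auto intro!: continuous_at_imp_continuous_on differentiable_imp_continuous_within)
  ultimately show "gf \<in> borel_measurable borel" "gA \<in> borel_measurable borel"
    "cU \<in> borel_measurable borel"
    unfolding gf_def[abs_def] gA_def[abs_def] cU_def[abs_def]
    by (auto intro!: borel_measurable_continuous_on_if)
  show "proj \<in> borel_measurable borel"
    unfolding proj_def using G_pos
    by (intro borel_measurable_continuous_onI continuous_on_closest_point) auto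
qed

lemma proj_bound: "norm (proj y) \<le> G_f P"
proof -
  have "proj y \<in> cball 0 (G_f P)"
    unfolding proj_def using G_pos by (intro closest_point_in_set) auto
  then show ?thesis by simp
qed

text \<open>The true gradient lies in the ball, hence is fixed by the projection, and projection
  onto a convex set is nonexpansive.\<close>

lemma proj_error: "y \<in> U \<Longrightarrow> norm (proj w - gf y) \<le> norm (w - gf y)"
proof -
  assume "y \<in> U"
  then have "gf y \<in> cball 0 (G_f P)"
    using regularity by (auto simp: regularity_assumption_def gf_def)
  then show ?thesis
    using closest_point_lipschitz[of "cball 0 (G_f P)" w "gf y"] G_pos
    by (simp add: proj_def closest_point_self dist_norm)
qed

text \<open>An event of probability one on which the path analysis applies and the gradients of the
  samples can be replaced by their jointly measurable versions.\<close>
definition regular_path :: "'w \<Rightarrow> bool" where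
  "regular_path \<omega> \<longleftrightarrow>
     nr_lalm_path P c F x0 l0 Q B b K (\<lambda>k i. xi k i \<omega>) (\<lambda>k. x k \<omega>) (\<lambda>k. l k \<omega>) (\<lambda>k. h k \<omega>) \<and>
     (\<forall>k<K. closed_segment (x k \<omega>) (x (k + 1) \<omega>) \<subseteq> U) \<and>
     (\<forall>k<K. \<forall>i<N k. \<forall>y\<in>U. sgrad y (xi k i \<omega>) = grad (\<lambda>y. F y (xi k i \<omega>)) y)"

text \<open>The exceptional set in \<open>sgrad_AE\<close> is null for the law \<open>D\<close>; it
  is pulled back along each sample, and countably many null sets are united.\<close>

lemma AE_regular_path: "AE \<omega> in M. regular_path \<omega>"
proof -
  have "AE \<omega> in M. \<forall>y\<in>U. sgrad y (xi k i \<omega>) = grad (\<lambda>y. F y (xi k i \<omega>)) y"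
    if "k < K" "i < N k" for k i
    by (rule AE_distrD[OF xi_measurable[OF that]]) (simp only: xi_distr[OF that] sgrad_AE)
  then have "AE \<omega> in M. \<forall>k<K. \<forall>i<N k. \<forall>y\<in>U. sgrad y (xi k i \<omega>) = grad (\<lambda>y. F y (xi k i \<omega>)) y"
    by (auto simp: AE_all_countable intro!: AE_impI)
  moreover have "AE \<omega> in M. nr_lalm_path P c F x0 l0 Q B b K
        (\<lambda>k i. xi k i \<omega>) (\<lambda>k. x k \<omega>) (\<lambda>k. l k \<omega>) (\<lambda>k. h k \<omega>)"
    using run by (simp add: stochastic_nr_lalm_def)
  ultimately show ?thesis
    using region by eventually_elim (auto simp: regular_path_def)
qed

lemma regular_path_U:
  assumes "regular_path \<omega>" "k \<le> K"
  shows "x k \<omega> \<in> U"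
proof (cases "k = K")
  case True
  then obtain j where j: "k = Suc j" "j < K"
    using sizes by (metis Suc_pred lessI)
  then have "closed_segment (x j \<omega>) (x (j + 1) \<omega>) \<subseteq> U"
    using assms(1) unfolding regular_path_def by blast
  then show ?thesis
    using j by auto
next
  case False
  then have "closed_segment (x k \<omega>) (x (k + 1) \<omega>) \<subseteq> U"
    using assms by (auto simp: regular_path_def)
  then show ?thesis by auto
qed

lemma AE_U: "k \<le> K \<Longrightarrow> AE \<omega> in M. x k \<omega> \<in> U"
  using AE_regular_path by eventually_elim (rule regular_path_U)

lemma regular_path_restart:
  assumes "regular_path \<omega>" "k < K" "k mod Q = 0"
  shows "h k \<omega> = (1 / real (N k)) *\<^sub>R (\<Sum>i<N k. sgrad (x k \<omega>) (xi k i \<omega>))"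
proof -
  have "h k \<omega> = (1 / real B) *\<^sub>R (\<Sum>i<B. grad (\<lambda>y. F y (xi k i \<omega>)) (x k \<omega>))"
    using assms by (simp add: regular_path_def nr_lalm_path_def)
  moreover have "sgrad (x k \<omega>) (xi k i \<omega>) = grad (\<lambda>y. F y (xi k i \<omega>)) (x k \<omega>)" if "i < N k" for i
    using assms(1,2) that regular_path_U[OF assms(1), of k] unfolding regular_path_def by simp
  ultimately show ?thesis
    using assms by (simp add: batch_size_def)
qed

lemma regular_path_recursive:
  assumes "regular_path \<omega>" "k < K" "k mod Q \<noteq> 0"
  shows "h k \<omega> = h (k - 1) \<omega> + (1 / real (N k)) *\<^sub>R
    (\<Sum>i<N k. sgrad (x k \<omega>) (xi k i \<omega>) - sgrad (x (k - 1) \<omega>) (xi k i \<omega>))"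
proof -
  have "h k \<omega> = h (k - 1) \<omega> + (1 / real b) *\<^sub>R (\<Sum>i<b. grad (\<lambda>y. F y (xi k i \<omega>)) (x k \<omega>)
      - grad (\<lambda>y. F y (xi k i \<omega>)) (x (k - 1) \<omega>))"
    using assms by (simp add: regular_path_def nr_lalm_path_def)
  moreover have "sgrad (x j \<omega>) (xi k i \<omega>) = grad (\<lambda>y. F y (xi k i \<omega>)) (x j \<omega>)"
    if "i < N k" "j \<le> k" for i j
    using assms(1,2) that regular_path_U[OF assms(1), of j] unfolding regular_path_def by simp
  ultimately show ?thesis
    using assms by (simp add: batch_size_def)
qed

lemma regular_path_lalm:
  assumes "regular_path \<omega>"
  shows "nr_lalm_regular P U f c x0 l0 K (\<lambda>k. x k \<omega>) (\<lambda>k. l k \<omega>) (\<lambda>k. proj (h k \<omega>))"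
proof
  have path: "nr_lalm_path P c F x0 l0 Q B b K (\<lambda>k i. xi k i \<omega>) (\<lambda>k. x k \<omega>) (\<lambda>k. l k \<omega>) (\<lambda>k. h k \<omega>)"
    using assms by (simp add: regular_path_def)
  show "x 0 \<omega> = x0" "l 0 \<omega> = l0"
    using path by (auto simp: nr_lalm_path_def)
  fix k assume k: "k < K"
  have "\<exists>p. lalm_matrix (beta P) (rho P) (gradc c (x k \<omega>)) *v p
        = - proj (h k \<omega>) - gradc c (x k \<omega>) *v (l k \<omega> + rho P *\<^sub>R c (x k \<omega>)) \<and>
      x (k + 1) \<omega> = x k \<omega> + p \<and> l (k + 1) \<omega> = l k \<omega> + rho P *\<^sub>R c (x (k + 1) \<omega>)"
    using path k unfolding nr_lalm_path_def Let_def lalm_matrix_def proj_def by blast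
  then obtain p where p: "lalm_matrix (beta P) (rho P) (gradc c (x k \<omega>)) *v p
        = - proj (h k \<omega>) - gradc c (x k \<omega>) *v (l k \<omega> + rho P *\<^sub>R c (x k \<omega>))"
      "x (k + 1) \<omega> = x k \<omega> + p" "l (k + 1) \<omega> = l k \<omega> + rho P *\<^sub>R c (x (k + 1) \<omega>)"
    by blast
  show "norm (proj (h k \<omega>)) \<le> G_f P"
    by (rule proj_bound)
  show "closed_segment (x k \<omega>) (x (Suc k) \<omega>) \<subseteq> U"
    using assms k by (simp add: regular_path_def)
  show "l (Suc k) \<omega> = l k \<omega> + rho P *\<^sub>R c (x (Suc k) \<omega>)"
    using p(3) by simp
  show "lalm_matrix (beta P) (rho P) (gradc c (x k \<omega>)) *v (x (Suc k) \<omega> - x k \<omega>)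
      = - proj (h k \<omega>) - gradc c (x k \<omega>) *v (l k \<omega> + rho P *\<^sub>R c (x k \<omega>))"
    using p(1,2) by simp
qed (rule regularity parameters)+

section \<open>Sigma-algebras of the samples and of the history\<close>

definition samples :: "nat set \<Rightarrow> 'w measure" where
  "samples J = sigma (space M) (\<Union>k\<in>J. \<Union>i<N k. sets (vimage_algebra (space M) (xi k i) D))"

lemma vimage_sets_Pow: "sets (vimage_algebra (space M) Z S) \<subseteq> Pow (space M)"
  using sets.space_closed[of "vimage_algebra (space M) Z S"] by simp

lemma samples_Pow: "(\<Union>k\<in>J. \<Union>i<N k. sets (vimage_algebra (space M) (xi k i) D)) \<subseteq> Pow (space M)"
  by (intro UN_least vimage_sets_Pow)

lemma space_samples [simp]: "space (samples J) = space M"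
  by (simp add: samples_def space_measure_of_conv)

lemma sets_samples: "sets (samples J) = sample_algebra M D N xi J"
  unfolding samples_def sample_algebra_def by (rule sets_measure_of[OF samples_Pow])

lemma xi_samples: "k < K \<Longrightarrow> k \<in> J \<Longrightarrow> i < N k \<Longrightarrow> xi k i \<in> samples J \<rightarrow>\<^sub>M D"
  unfolding samples_def using measurable_space[OF xi_measurable[of k i]]
  by (intro measurable_sigma_vimage samples_Pow) auto

definition history :: "nat \<Rightarrow> 'w measure" where
  "history k = sigma (space M) (sample_algebra M D N xi {..<k}
        \<union> (\<Union>j\<le>k. sets (vimage_algebra (space M) (x j) borel))
        \<union> (\<Union>j\<le>k. sets (vimage_algebra (space M) (l j) borel))
        \<union> (\<Union>j<k. sets (vimage_algebra (space M) (h j) borel)))"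

lemma history_Pow: "sample_algebra M D N xi {..<k}
        \<union> (\<Union>j\<le>k. sets (vimage_algebra (space M) (x j) borel))
        \<union> (\<Union>j\<le>k. sets (vimage_algebra (space M) (l j) borel))
        \<union> (\<Union>j<k. sets (vimage_algebra (space M) (h j) borel)) \<subseteq> Pow (space M)"
proof -
  have "sample_algebra M D N xi {..<k} \<subseteq> Pow (space M)"
    using sets.space_closed[of "samples {..<k}"] by (simp add: sets_samples)
  then show ?thesis
    by (intro Un_least UN_least vimage_sets_Pow)
qed

lemma space_history [simp]: "space (history k) = space M"
  by (simp add: history_def space_measure_of_conv)

lemma sets_history: "sets (history k) = history_algebra M D N xi x l h k"
  unfolding history_def history_algebra_def by (rule sets_measure_of[OF history_Pow])

lemma x_history: "j \<le> k \<Longrightarrow> x j \<in> borel_measurable (history k)"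
  and h_history: "j < k \<Longrightarrow> h j \<in> borel_measurable (history k)"
  unfolding history_def by (intro measurable_sigma_vimage history_Pow; auto)+

lemma samples_indep_history: "k < K \<Longrightarrow> indep_set (sets (samples {k})) (sets (history k))"
  using run unfolding sets_samples sets_history by (simp add: stochastic_nr_lalm_def)

text \<open>Restriction to the index set makes the batch a point of the product space, whose
  elements are extensional functions.\<close>

definition batch :: "nat \<Rightarrow> 'w \<Rightarrow> nat \<Rightarrow> 's" where
  "batch k \<omega> = (\<lambda>i\<in>{..<N k}. xi k i \<omega>)"

lemma batch_samples: "k < K \<Longrightarrow> batch k \<in> samples {k} \<rightarrow>\<^sub>M PiM {..<N k} (\<lambda>_. D)"
  unfolding batch_def by (intro measurable_restrict xi_samples) auto

lemma batch_distr: "k < K \<Longrightarrow> distr M (PiM {..<N k} (\<lambda>_. D)) (batch k) = PiM {..<N k} (\<lambda>_. D)"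
proof -
  assume k: "k < K"
  have "indep_vars (\<lambda>_. D) (xi k) {..<N k}"
    using run k by (simp add: stochastic_nr_lalm_def)
  then have "distr M (PiM {..<N k} (\<lambda>_. D)) (batch k) = PiM {..<N k} (\<lambda>i. distr M D (xi k i))"
    unfolding batch_def using N_pos[of k] k xi_measurable
    by (subst (asm) indep_vars_iff_distr_eq_PiM') auto
  also have "\<dots> = PiM {..<N k} (\<lambda>_. D)"
    using xi_distr[OF k] by (intro PiM_cong) auto
  finally show ?thesis .
qed

text \<open>The batch is integrated out with the past frozen; \<open>Z\<close> collects the iterates
  and the estimator that the current update reads.\<close>

lemma nn_integral_batch:
  assumes k: "k < K" and Z: "Z \<in> history k \<rightarrow>\<^sub>M S"
    and g: "g \<in> borel_measurable (S \<Otimes>\<^sub>M PiM {..<N k} (\<lambda>_. D))"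
  shows "(\<integral>\<^sup>+ \<omega>. g (Z \<omega>, batch k \<omega>) \<partial>M) = (\<integral>\<^sup>+ \<omega>. \<integral>\<^sup>+ s. g (Z \<omega>, s) \<partial>PiM {..<N k} (\<lambda>_. D) \<partial>M)"
proof -
  have "indep_set (sets (history k)) (sets (samples {k}))"
    using samples_indep_history[OF k] by (rule indep_set_commute)
  from nn_integral_indep_set[OF this _ _ Z batch_samples[OF k] g]
  show ?thesis
    by (simp add: batch_distr[OF k])
qed


definition dx :: "nat \<Rightarrow> 'w \<Rightarrow> real^'n" where "dx k \<omega> = x (Suc k) \<omega> - x k \<omega>"
text \<open>\<open>err\<close> belongs to the unprojected estimator and obeys the variance
  recursion; \<open>perr\<close> is the error that the path analysis sees. The two are compared
  through \<open>proj_error\<close>.\<close>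

definition err :: "nat \<Rightarrow> 'w \<Rightarrow> real^'n" where "err k \<omega> = h k \<omega> - gf (x k \<omega>)"
definition perr :: "nat \<Rightarrow> 'w \<Rightarrow> real^'n" where "perr k \<omega> = proj (h k \<omega>) - gf (x k \<omega>)"

lemma errors_measurable [measurable]:
  "k < K \<Longrightarrow> dx k \<in> borel_measurable M" "k < K \<Longrightarrow> err k \<in> borel_measurable M"
  "k < K \<Longrightarrow> perr k \<in> borel_measurable M"
  unfolding dx_def[abs_def] err_def[abs_def] perr_def[abs_def] by measurable

lemma regular_path_bounds:
  assumes "regular_path \<omega>"
  shows "k < K \<Longrightarrow> norm (dx k \<omega>) \<le> Delta P"
    and "(\<Sum>k<K. (norm (dx k \<omega>))\<^sup>2) \<le> D_0 P (f x0) + D_1 P * (\<Sum>k<K. (norm (perr k \<omega>))\<^sup>2)"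
    and "Suc k < K \<Longrightarrow> (kkt_residual f c (x (Suc (Suc k)) \<omega>) (l (Suc (Suc k)) \<omega>))\<^sup>2
      \<le> C_R_st P * ((norm (dx (Suc k) \<omega>))\<^sup>2 + (norm (dx k \<omega>))\<^sup>2
        + (norm (perr (Suc k) \<omega>))\<^sup>2 + (norm (perr k \<omega>))\<^sup>2)"
    and "k < K \<Longrightarrow> norm (perr k \<omega>) \<le> norm (err k \<omega>)"
    and "k < K \<Longrightarrow> norm (perr k \<omega>) \<le> 2 * G_f P"
proof -
  interpret R: nr_lalm_regular P U f c x0 l0 K "\<lambda>k. x k \<omega>" "\<lambda>k. l k \<omega>" "\<lambda>k. proj (h k \<omega>)"
    by (rule regular_path_lalm[OF assms])
  have p: "R.p k = dx k \<omega>" for k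
    by (simp add: R.p_def dx_def)
  have e: "R.e k = perr k \<omega>" if "k < K" for k
    using regular_path_U[OF assms, of k] that by (simp add: R.e_def perr_def gf_def)
  show "norm (dx k \<omega>) \<le> Delta P" if "k < K"
    using R.p_bound[OF that] by (simp add: p)
  show "(\<Sum>k<K. (norm (dx k \<omega>))\<^sup>2) \<le> D_0 P (f x0) + D_1 P * (\<Sum>k<K. (norm (perr k \<omega>))\<^sup>2)"
    using R.sum_p_bound sizes by (simp add: p e)
  show "(kkt_residual f c (x (Suc (Suc k)) \<omega>) (l (Suc (Suc k)) \<omega>))\<^sup>2
      \<le> C_R_st P * ((norm (dx (Suc k) \<omega>))\<^sup>2 + (norm (dx k \<omega>))\<^sup>2
        + (norm (perr (Suc k) \<omega>))\<^sup>2 + (norm (perr k \<omega>))\<^sup>2)" if "Suc k < K"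
    using R.kkt_residual_bound[OF that] that by (simp add: p e)
  show "norm (perr k \<omega>) \<le> norm (err k \<omega>)" if "k < K"
    using regular_path_U[OF assms, of k] that by (simp add: perr_def err_def proj_error)
  show "norm (perr k \<omega>) \<le> 2 * G_f P" if "k < K"
  proof -
    have "norm (gf (x k \<omega>)) \<le> G_f P"
      using R.grad_bound regular_path_U[OF assms, of k] that by (simp add: gf_def)
    then show ?thesis
      using norm_triangle_ineq4[of "proj (h k \<omega>)" "gf (x k \<omega>)"] proj_bound[of "h k \<omega>"]
      by (simp add: perr_def)
  qed
qed

section \<open>Mean-square error of the recursive estimator\<close>

lemma
  assumes y: "y \<in> U"
  shows sgrad_integrable: "integrable D (sgrad y)"
    and sgrad_mean: "(\<integral>s. sgrad y s \<partial>D) = gf y"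
    and sgrad_variance: "(\<integral>\<^sup>+ s. ennreal ((norm (sgrad y s - gf y))\<^sup>2) \<partial>D) \<le> ennreal ((sigma_f P)\<^sup>2)"
proof -
  have AE: "AE s in D. grad (\<lambda>y. F y s) y = sgrad y s"
    using sgrad_AE by eventually_elim (use y in simp)
  have [measurable]: "sgrad y \<in> borel_measurable D"
    using sgrad_measurable[of "\<lambda>_. y" D "\<lambda>s. s"] by simp
  have int: "integrable D (\<lambda>s. grad (\<lambda>y. F y s) y)"
    and mean: "(\<integral>s. grad (\<lambda>y. F y s) y \<partial>D) = grad f y"
    and var: "(\<integral>\<^sup>+ s. ennreal ((norm (grad (\<lambda>y. F y s) y - grad f y))\<^sup>2) \<partial>D) \<le> ennreal ((sigma_f P)\<^sup>2)"
    using gradients y by (simp_all add: oracle_assumption_def)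
  show "integrable D (sgrad y)"
    by (rule integrable_cong_AE_imp[OF int _ AE]) simp
  have "(\<integral>s. sgrad y s \<partial>D) = (\<integral>s. grad (\<lambda>y. F y s) y \<partial>D)"
    using AE borel_measurable_integrable[OF int] by (intro integral_cong_AE) auto
  then show "(\<integral>s. sgrad y s \<partial>D) = gf y"
    using mean y by (simp add: gf_def)
  have "(\<integral>\<^sup>+ s. ennreal ((norm (sgrad y s - gf y))\<^sup>2) \<partial>D)
      = (\<integral>\<^sup>+ s. ennreal ((norm (grad (\<lambda>y. F y s) y - grad f y))\<^sup>2) \<partial>D)"
    using AE by (intro nn_integral_cong_AE, eventually_elim) (use y in \<open>simp add: gf_def\<close>)
  then show "(\<integral>\<^sup>+ s. ennreal ((norm (sgrad y s - gf y))\<^sup>2) \<partial>D) \<le> ennreal ((sigma_f P)\<^sup>2)"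
    using var by simp
qed

lemma sgrad_lipschitz:
  assumes y: "y \<in> U" "z \<in> U"
  shows "(\<integral>\<^sup>+ s. ennreal ((norm (sgrad y s - sgrad z s))\<^sup>2) \<partial>D) \<le> ennreal ((L_s P)\<^sup>2 * (norm (y - z))\<^sup>2)"
proof -
  have "(\<integral>\<^sup>+ s. ennreal ((norm (sgrad y s - sgrad z s))\<^sup>2) \<partial>D)
      = (\<integral>\<^sup>+ s. ennreal ((norm (grad (\<lambda>y. F y s) y - grad (\<lambda>y. F y s) z))\<^sup>2) \<partial>D)"
    using sgrad_AE by (intro nn_integral_cong_AE, eventually_elim) (use y in simp)
  then show ?thesis
    using gradients y by (simp add: oracle_assumption_def)
qed

text \<open>The point \<open>x k\<close> is measurable for the history, so once it is frozen the
  estimator is an average of independent unbiased gradients, with inherited error 0.\<close>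

lemma error_restart:
  assumes k: "k < K" and restart: "k mod Q = 0"
  shows "(\<integral>\<^sup>+ \<omega>. ennreal ((norm (err k \<omega>))\<^sup>2) \<partial>M) \<le> ennreal ((sigma_f P)\<^sup>2 / B)"
proof -
  let ?g = "\<lambda>z. ennreal ((norm ((1 / real (N k)) *\<^sub>R (\<Sum>i<N k. sgrad (fst z) (snd z i)) - gf (fst z)))\<^sup>2)"
  have meas: "?g \<in> borel_measurable (borel \<Otimes>\<^sub>M PiM {..<N k} (\<lambda>_. D))"
    by measurable
  have "(\<integral>\<^sup>+ \<omega>. ennreal ((norm (err k \<omega>))\<^sup>2) \<partial>M) = (\<integral>\<^sup>+ \<omega>. ?g (x k \<omega>, batch k \<omega>) \<partial>M)"
    using AE_regular_path
    by (intro nn_integral_cong_AE, eventually_elim)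
       (simp add: err_def regular_path_restart[OF _ k restart] batch_def)
  also have "\<dots> = (\<integral>\<^sup>+ \<omega>. \<integral>\<^sup>+ s. ?g (x k \<omega>, s) \<partial>PiM {..<N k} (\<lambda>_. D) \<partial>M)"
    by (rule nn_integral_batch[OF k x_history meas]) simp
  also have "\<dots> \<le> (\<integral>\<^sup>+ \<omega>. ennreal ((sigma_f P)\<^sup>2 / B) \<partial>M)"
  proof (rule nn_integral_mono_AE)
    have "AE \<omega> in M. x k \<omega> \<in> U"
      using k by (intro AE_U) simp
    then show "AE \<omega> in M. (\<integral>\<^sup>+ s. ?g (x k \<omega>, s) \<partial>PiM {..<N k} (\<lambda>_. D)) \<le> ennreal ((sigma_f P)\<^sup>2 / B)"
    proof eventually_elim
      case U: (elim \<omega>)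
      show ?case
        using D.nn_integral_norm_add_average_sq[OF sgrad_integrable[OF U] N_pos[of k], of "(sigma_f P)\<^sup>2" 0]
          sgrad_variance[OF U] restart
        by (simp add: sgrad_mean[OF U] batch_size_def)
    qed
  qed
  finally show ?thesis
    by (simp add: emeasure_space_1)
qed

text \<open>The new error is the old one plus a batch average of gradient differences minus its
  mean. With the history frozen, the old error is constant and the added part is centered, so
  squared errors add without a cross term.\<close>

lemma error_recursion:
  assumes k: "k < K" and rec: "k mod Q \<noteq> 0"
  shows "(\<integral>\<^sup>+ \<omega>. ennreal ((norm (err k \<omega>))\<^sup>2) \<partial>M)
    \<le> (\<integral>\<^sup>+ \<omega>. ennreal ((norm (err (k - 1) \<omega>))\<^sup>2) \<partial>M)
      + ennreal ((L_s P)\<^sup>2 / b) * (\<integral>\<^sup>+ \<omega>. ennreal ((norm (dx (k - 1) \<omega>))\<^sup>2) \<partial>M)"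
proof -
  have k0: "0 < k" using rec by (cases k) auto
  let ?g = "\<lambda>(w, s). case w of (y, z, g) \<Rightarrow> ennreal ((norm (g + (1 / real (N k)) *\<^sub>R
      (\<Sum>i<N k. sgrad y (s i) - sgrad z (s i)) - gf y))\<^sup>2)"
  let ?Z = "\<lambda>\<omega>. (x k \<omega>, x (k - 1) \<omega>, h (k - 1) \<omega>)"
  have meas: "?g \<in> borel_measurable ((borel \<Otimes>\<^sub>M borel \<Otimes>\<^sub>M borel) \<Otimes>\<^sub>M PiM {..<N k} (\<lambda>_. D))"
    by measurable
  have Z: "?Z \<in> history k \<rightarrow>\<^sub>M borel \<Otimes>\<^sub>M borel \<Otimes>\<^sub>M borel"
    using k0 by (intro measurable_Pair x_history h_history) auto
  have [measurable]: "x k \<in> borel_measurable M" "x (k - 1) \<in> borel_measurable M"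
      "h (k - 1) \<in> borel_measurable M" "err (k - 1) \<in> borel_measurable M"
      "dx (k - 1) \<in> borel_measurable M"
    using k by auto
  have "(\<integral>\<^sup>+ \<omega>. ennreal ((norm (err k \<omega>))\<^sup>2) \<partial>M) = (\<integral>\<^sup>+ \<omega>. ?g (?Z \<omega>, batch k \<omega>) \<partial>M)"
    using AE_regular_path
    by (intro nn_integral_cong_AE, eventually_elim)
       (simp add: err_def regular_path_recursive[OF _ k rec] batch_def)
  also have "\<dots> = (\<integral>\<^sup>+ \<omega>. \<integral>\<^sup>+ s. ?g (?Z \<omega>, s) \<partial>PiM {..<N k} (\<lambda>_. D) \<partial>M)"
    by (rule nn_integral_batch[OF k Z meas])
  also have "\<dots> \<le> (\<integral>\<^sup>+ \<omega>. ennreal ((norm (err (k - 1) \<omega>))\<^sup>2)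
      + ennreal ((L_s P)\<^sup>2 / b) * ennreal ((norm (dx (k - 1) \<omega>))\<^sup>2) \<partial>M)"
  proof (rule nn_integral_mono_AE)
    have "AE \<omega> in M. x k \<omega> \<in> U" "AE \<omega> in M. x (k - 1) \<omega> \<in> U"
      using k by (auto intro!: AE_U)
    then show "AE \<omega> in M. (\<integral>\<^sup>+ s. ?g (?Z \<omega>, s) \<partial>PiM {..<N k} (\<lambda>_. D))
        \<le> ennreal ((norm (err (k - 1) \<omega>))\<^sup>2) + ennreal ((L_s P)\<^sup>2 / b) * ennreal ((norm (dx (k - 1) \<omega>))\<^sup>2)"
    proof eventually_elim
      case (elim \<omega>)
      let ?y = "x k \<omega>" and ?z = "x (k - 1) \<omega>"
      let ?Y = "\<lambda>s. sgrad ?y s - sgrad ?z s"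
      let ?t = "(L_s P)\<^sup>2 * (norm (?y - ?z))\<^sup>2"
      have int: "integrable D ?Y"
        using sgrad_integrable elim by simp
      have mean: "(\<integral>s. ?Y s \<partial>D) = gf ?y - gf ?z"
        using sgrad_integrable sgrad_mean elim by simp
      \<comment> \<open>Centering does not increase the second moment, so the oracle's mean-square
        Lipschitz bound for the uncentered difference applies.\<close>
      have "(\<integral>\<^sup>+ s. ennreal ((norm (?Y s - (\<integral>s. ?Y s \<partial>D)))\<^sup>2) \<partial>D) \<le> ennreal ?t"
        using D.nn_integral_norm_centered_sq_le[OF int] sgrad_lipschitz[OF elim] by (rule order_trans)
      from D.nn_integral_norm_add_average_sq[OF int N_pos[of k] _ this, of "err (k - 1) \<omega>"]
      have I: "(\<integral>\<^sup>+ s. ennreal ((norm (err (k - 1) \<omega> + ((1 / real (N k)) *\<^sub>R (\<Sum>i<N k. ?Y (s i))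
          - (gf ?y - gf ?z))))\<^sup>2) \<partial>PiM {..<N k} (\<lambda>_. D))
        \<le> ennreal ((norm (err (k - 1) \<omega>))\<^sup>2 + ?t / real (N k))"
        unfolding mean by simp
      have eq: "err (k - 1) \<omega> + ((1 / real (N k)) *\<^sub>R (\<Sum>i<N k. ?Y (s i)) - (gf ?y - gf ?z))
          = h (k - 1) \<omega> + (1 / real (N k)) *\<^sub>R (\<Sum>i<N k. ?Y (s i)) - gf ?y" for s
        by (simp add: err_def)
      have "N k = b" "dx (k - 1) \<omega> = ?y - ?z"
        using rec k0 by (simp_all add: batch_size_def dx_def)
      with I[unfolded eq] show ?case
        by (simp add: ennreal_plus[symmetric] ennreal_mult[symmetric] del: ennreal_plus)
    qed
  qed
  also have "\<dots> = (\<integral>\<^sup>+ \<omega>. ennreal ((norm (err (k - 1) \<omega>))\<^sup>2) \<partial>M)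
      + (\<integral>\<^sup>+ \<omega>. ennreal ((L_s P)\<^sup>2 / b) * ennreal ((norm (dx (k - 1) \<omega>))\<^sup>2) \<partial>M)"
    by (rule nn_integral_add) measurable
  also have "(\<integral>\<^sup>+ \<omega>. ennreal ((L_s P)\<^sup>2 / b) * ennreal ((norm (dx (k - 1) \<omega>))\<^sup>2) \<partial>M)
      = ennreal ((L_s P)\<^sup>2 / b) * (\<integral>\<^sup>+ \<omega>. ennreal ((norm (dx (k - 1) \<omega>))\<^sup>2) \<partial>M)"
    by (rule nn_integral_cmult) measurable
  finally show ?thesis .
qed

text \<open>Real-valued expectations, because the coupled inequalities are solved by subtraction.
  They are finite since on regular paths the steps are bounded by \<Delta> and, thanks to the
  projection, the errors by twice G.\<close>

definition Edx :: "nat \<Rightarrow> real" where "Edx k = expectation (\<lambda>\<omega>. (norm (dx k \<omega>))\<^sup>2)"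
definition Eperr :: "nat \<Rightarrow> real" where "Eperr k = expectation (\<lambda>\<omega>. (norm (perr k \<omega>))\<^sup>2)"

lemma dx_sq_integrable: "k < K \<Longrightarrow> integrable M (\<lambda>\<omega>. (norm (dx k \<omega>))\<^sup>2)"
  and perr_sq_integrable: "k < K \<Longrightarrow> integrable M (\<lambda>\<omega>. (norm (perr k \<omega>))\<^sup>2)"
proof -
  assume k: "k < K"
  have "AE \<omega> in M. norm ((norm (dx k \<omega>))\<^sup>2) \<le> (Delta P)\<^sup>2"
    using AE_regular_path by eventually_elim (use k regular_path_bounds(1) in \<open>auto intro!: power_mono\<close>)
  then show "integrable M (\<lambda>\<omega>. (norm (dx k \<omega>))\<^sup>2)"
    using k by (intro integrable_const_bound) auto
  have "AE \<omega> in M. norm ((norm (perr k \<omega>))\<^sup>2) \<le> (2 * G_f P)\<^sup>2"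
    using AE_regular_path
  proof eventually_elim
    case (elim \<omega>)
    have "(norm (perr k \<omega>))\<^sup>2 \<le> (2 * G_f P)\<^sup>2"
      by (intro power_mono regular_path_bounds(5)[OF elim k]) simp
    then show ?case by simp
  qed
  then show "integrable M (\<lambda>\<omega>. (norm (perr k \<omega>))\<^sup>2)"
    using k by (intro integrable_const_bound) auto
qed

lemma Edx_nonneg: "0 \<le> Edx k" and Eperr_nonneg: "0 \<le> Eperr k"
  by (simp_all add: Edx_def Eperr_def)

lemma nn_integral_dx: "k < K \<Longrightarrow> (\<integral>\<^sup>+ \<omega>. ennreal ((norm (dx k \<omega>))\<^sup>2) \<partial>M) = ennreal (Edx k)"
  and nn_integral_perr: "k < K \<Longrightarrow> (\<integral>\<^sup>+ \<omega>. ennreal ((norm (perr k \<omega>))\<^sup>2) \<partial>M) = ennreal (Eperr k)"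
  unfolding Edx_def Eperr_def
  by (simp_all add: nn_integral_eq_integral dx_sq_integrable perr_sq_integrable)

text \<open>\<open>k - k mod Q\<close> is the most recent restart, so the interval collects the
  steps taken since then; it is empty at a restart.\<close>

lemma error_bound:
  "k < K \<Longrightarrow> (\<integral>\<^sup>+ \<omega>. ennreal ((norm (err k \<omega>))\<^sup>2) \<partial>M)
    \<le> ennreal ((sigma_f P)\<^sup>2 / B + (L_s P)\<^sup>2 / b * (\<Sum>j\<in>{k - k mod Q..<k}. Edx j))"
proof (induction k)
  case 0
  then show ?case
    using error_restart[of 0] by simp
next
  case (Suc k)
  show ?case
  proof (cases "Suc k mod Q = 0")
    case True
    then show ?thesis
      using error_restart[OF Suc.prems] by simp
  next
    case False
    then have "Suc k mod Q = Suc (k mod Q)"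
      by (simp add: mod_Suc split: if_splits)
    then have start: "{Suc k - Suc k mod Q..<Suc k} = insert k {k - k mod Q..<k}"
      by auto
    have k: "k < K" using Suc.prems by simp
    have "(\<integral>\<^sup>+ \<omega>. ennreal ((norm (err (Suc k) \<omega>))\<^sup>2) \<partial>M)
        \<le> (\<integral>\<^sup>+ \<omega>. ennreal ((norm (err k \<omega>))\<^sup>2) \<partial>M) + ennreal ((L_s P)\<^sup>2 / b) * ennreal (Edx k)"
      using error_recursion[OF Suc.prems False] by (simp add: nn_integral_dx[OF k])
    also have "\<dots> \<le> ennreal ((sigma_f P)\<^sup>2 / B + (L_s P)\<^sup>2 / b * (\<Sum>j\<in>{k - k mod Q..<k}. Edx j))
        + ennreal ((L_s P)\<^sup>2 / b) * ennreal (Edx k)"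
      by (intro add_mono Suc.IH k order_refl)
    also have "\<dots> = ennreal ((sigma_f P)\<^sup>2 / B
        + (L_s P)\<^sup>2 / b * (\<Sum>j\<in>{k - k mod Q..<k}. Edx j) + (L_s P)\<^sup>2 / b * Edx k)"
      using Edx_nonneg
      by (simp add: ennreal_plus[symmetric] ennreal_mult[symmetric] sum_nonneg del: ennreal_plus)
    finally show ?thesis
      by (simp add: start algebra_simps)
  qed
qed

lemma Eperr_bound:
  assumes k: "k < K"
  shows "Eperr k \<le> (sigma_f P)\<^sup>2 / B + (L_s P)\<^sup>2 / b * (\<Sum>j\<in>{k - k mod Q..<k}. Edx j)"
proof -
  have "ennreal (Eperr k) \<le> (\<integral>\<^sup>+ \<omega>. ennreal ((norm (err k \<omega>))\<^sup>2) \<partial>M)"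
    unfolding nn_integral_perr[OF k, symmetric] using AE_regular_path
    by (intro nn_integral_mono_AE, eventually_elim)
       (auto intro!: ennreal_leI power_mono regular_path_bounds(4)[OF _ k])
  also note error_bound[OF k]
  finally have le: "ennreal (Eperr k)
      \<le> ennreal ((sigma_f P)\<^sup>2 / B + (L_s P)\<^sup>2 / b * (\<Sum>j\<in>{k - k mod Q..<k}. Edx j))" .
  have nonneg: "0 \<le> (sigma_f P)\<^sup>2 / B + (L_s P)\<^sup>2 / b * (\<Sum>j\<in>{k - k mod Q..<k}. Edx j)"
    by (intro add_nonneg_nonneg mult_nonneg_nonneg sum_nonneg Edx_nonneg) auto
  from le show ?thesis
    unfolding ennreal_le_iff[OF nonneg] .
qed

text \<open>After exchanging the sums, a step \<open>j\<close> is counted only by later iterations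
  of its epoch, of which there are fewer than \<open>Q\<close>.\<close>

lemma sum_Eperr_bound:
  "(\<Sum>k<K. Eperr k) \<le> K * (sigma_f P)\<^sup>2 / B + (L_s P)\<^sup>2 * Q / b * (\<Sum>k<K. Edx k)"
proof -
  have "(\<Sum>k<K. Eperr k) \<le> (\<Sum>k<K. (sigma_f P)\<^sup>2 / B + (L_s P)\<^sup>2 / b * (\<Sum>j\<in>{k - k mod Q..<k}. Edx j))"
    by (intro sum_mono Eperr_bound) simp
  also have "\<dots> = K * (sigma_f P)\<^sup>2 / B + (L_s P)\<^sup>2 / b * (\<Sum>k<K. \<Sum>j\<in>{k - k mod Q..<k}. Edx j)"
    by (simp add: sum.distrib sum_distrib_left)
  \<comment> \<open>The epoch interval is enlarged to j < k < j + Q, a relation between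
    \<open>j\<close> and \<open>k\<close> without residues, for which the exchange is
    immediate.\<close>
  also have "(\<Sum>k<K. \<Sum>j\<in>{k - k mod Q..<k}. Edx j) \<le> (\<Sum>k<K. \<Sum>j\<in>{j\<in>{..<K}. j < k \<and> k < j + Q}. Edx j)"
  proof (intro sum_mono sum_mono2)
    fix k assume "k \<in> {..<K}"
    then show "{k - k mod Q..<k} \<subseteq> {j\<in>{..<K}. j < k \<and> k < j + Q}"
      using mod_less_divisor[OF sizes(1), of k] mod_less_eq_dividend[of k Q] by auto
  qed (auto simp: Edx_nonneg)
  also have "\<dots> = (\<Sum>j<K. \<Sum>k\<in>{k\<in>{..<K}. j < k \<and> k < j + Q}. Edx j)"
    by (rule sum.swap_restrict) auto
  also have "\<dots> \<le> (\<Sum>j<K. Q * Edx j)"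
  proof (rule sum_mono)
    fix j
    have "card {k\<in>{..<K}. j < k \<and> k < j + Q} \<le> card {j..<j + Q}"
      by (intro card_mono) auto
    then show "(\<Sum>k\<in>{k\<in>{..<K}. j < k \<and> k < j + Q}. Edx j) \<le> Q * Edx j"
      using Edx_nonneg[of j] by (simp add: mult_right_mono)
  qed
  finally show ?thesis
    by (simp add: sum_distrib_left[symmetric] mult_left_mono divide_right_mono)
qed

lemma sum_Edx_bound: "(\<Sum>k<K. Edx k) \<le> D_0 P (f x0) + D_1 P * (\<Sum>k<K. Eperr k)"
proof -
  have "(\<Sum>k<K. Edx k) = expectation (\<lambda>\<omega>. \<Sum>k<K. (norm (dx k \<omega>))\<^sup>2)"
    unfolding Edx_def by (intro Bochner_Integration.integral_sum[symmetric] dx_sq_integrable) simp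
  also have "\<dots> \<le> expectation (\<lambda>\<omega>. D_0 P (f x0) + D_1 P * (\<Sum>k<K. (norm (perr k \<omega>))\<^sup>2))"
  proof (rule integral_mono_AE)
    show "AE \<omega> in M. (\<Sum>k<K. (norm (dx k \<omega>))\<^sup>2) \<le> D_0 P (f x0) + D_1 P * (\<Sum>k<K. (norm (perr k \<omega>))\<^sup>2)"
      using AE_regular_path by eventually_elim (rule regular_path_bounds(2))
  qed (auto intro!: Bochner_Integration.integrable_sum Bochner_Integration.integrable_add
        integrable_mult_right dx_sq_integrable perr_sq_integrable)
  also have "\<dots> = D_0 P (f x0) + D_1 P * (\<Sum>k<K. Eperr k)"
    unfolding Eperr_def
    by (subst Bochner_Integration.integral_add)
       (auto simp: prob_space intro!: Bochner_Integration.integrable_sum perr_sq_integrable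
          Bochner_Integration.integral_sum)
  finally show ?thesis .
qed

lemma D_1_pos: "0 < D_1 P"
proof -
  have "0 < beta P" "0 < rho P" "0 < sigma_c P"
    using parameters regularity by (auto simp: parameter_assumption_def regularity_assumption_def)
  then show ?thesis
    by (simp add: D_1_def C_e_star_def C_lambda_e_def add_pos_pos)
qed

text \<open>The condition on \<open>b\<close> bounds the error sum by sigma_f squared plus Sp / (2
  D_1). Inserted into the bound of Sp by D_0 + D_1 Se, this leaves Sp / 2 on the right. Absorbing it
  doubles the constants and gives \<open>Gamma_p\<close>; substituting back gives
  \<open>Gamma_e\<close>.\<close>

lemma expected_sums:
  assumes B: "B = K" and b: "2 * D_1 P * (L_s P)\<^sup>2 * Q \<le> b"
  shows "(\<Sum>k<K. Edx k) \<le> Gamma_p P (f x0)" and "(\<Sum>k<K. Eperr k) \<le> Gamma_e P (f x0)"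
proof -
  define Sp where "Sp = (\<Sum>k<K. Edx k)"
  define Se where "Se = (\<Sum>k<K. Eperr k)"
  have Sp0: "0 \<le> Sp"
    unfolding Sp_def by (intro sum_nonneg Edx_nonneg)
  have "(L_s P)\<^sup>2 * Q / b \<le> 1 / (2 * D_1 P)"
    using b D_1_pos sizes by (simp add: field_simps)
  then have "(L_s P)\<^sup>2 * Q / b * Sp \<le> 1 / (2 * D_1 P) * Sp"
    using Sp0 by (rule mult_right_mono)
  then have Se: "Se \<le> (sigma_f P)\<^sup>2 + Sp / (2 * D_1 P)"
    using sum_Eperr_bound B sizes by (simp add: Sp_def Se_def)
  then have "D_1 P * Se \<le> D_1 P * ((sigma_f P)\<^sup>2 + Sp / (2 * D_1 P))"
    using D_1_pos by (intro mult_left_mono) auto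
  also have "\<dots> = D_1 P * (sigma_f P)\<^sup>2 + Sp / 2"
    using D_1_pos by (simp add: field_simps)
  finally have Sp: "Sp \<le> Gamma_p P (f x0)"
    using sum_Edx_bound by (simp add: Sp_def Se_def Gamma_p_def)
  then show "(\<Sum>k<K. Edx k) \<le> Gamma_p P (f x0)"
    by (simp add: Sp_def)
  have "Sp / (2 * D_1 P) \<le> Gamma_p P (f x0) / (2 * D_1 P)"
    using Sp D_1_pos by (intro divide_right_mono) auto
  also have "\<dots> = (sigma_f P)\<^sup>2 + D_0 P (f x0) / D_1 P"
    using D_1_pos by (simp add: Gamma_p_def field_simps)
  finally show "(\<Sum>k<K. Eperr k) \<le> Gamma_e P (f x0)"
    using Se by (simp add: Se_def Gamma_e_def)
qed


section \<open>The iterates as functions of the samples\<close>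

lemma regular_path_step:
  assumes "regular_path \<omega>" "k < K"
  shows "x (Suc k) \<omega> = x k \<omega> + cramer_solution (lalm_matrix (beta P) (rho P) (gA (x k \<omega>)))
      (- proj (h k \<omega>) - gA (x k \<omega>) *v (l k \<omega> + rho P *\<^sub>R cU (x k \<omega>)))"
    and "l (Suc k) \<omega> = l k \<omega> + rho P *\<^sub>R cU (x (Suc k) \<omega>)"
proof -
  interpret R: nr_lalm_regular P U f c x0 l0 K "\<lambda>k. x k \<omega>" "\<lambda>k. l k \<omega>" "\<lambda>k. proj (h k \<omega>)"
    by (rule regular_path_lalm[OF assms(1)])
  have U: "x k \<omega> \<in> U" "x (Suc k) \<omega> \<in> U"
    using regular_path_U[OF assms(1)] assms(2) by auto
  have "x (Suc k) \<omega> - x k \<omega> = cramer_solution (lalm_matrix (beta P) (rho P) (gradc c (x k \<omega>)))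
      (- proj (h k \<omega>) - gradc c (x k \<omega>) *v (l k \<omega> + rho P *\<^sub>R c (x k \<omega>)))"
    using R.positive by (intro cramer_solution_eq invertible_lalm_matrix R.primal_step[OF assms(2)]) auto
  then show "x (Suc k) \<omega> = x k \<omega> + cramer_solution (lalm_matrix (beta P) (rho P) (gA (x k \<omega>)))
      (- proj (h k \<omega>) - gA (x k \<omega>) *v (l k \<omega> + rho P *\<^sub>R cU (x k \<omega>)))"
    using U by (simp add: gA_def cU_def algebra_simps)
  show "l (Suc k) \<omega> = l k \<omega> + rho P *\<^sub>R cU (x (Suc k) \<omega>)"
    using R.dual_step[OF assms(2)] U by (simp add: cU_def)
qed

text \<open>The output index is only known to be independent of the samples, so the iterates have to be
  recognised as functions of the samples.\<close>
definition sample_determined :: "('w \<Rightarrow> 'a::topological_space) \<Rightarrow> bool" where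
  "sample_determined Z \<longleftrightarrow> (\<exists>Z'\<in>borel_measurable (samples {..<K}). AE \<omega> in M. Z \<omega> = Z' \<omega>)"

lemma sample_determinedE:
  assumes "sample_determined Z"
  obtains Z' where "Z' \<in> borel_measurable (samples {..<K})" "AE \<omega> in M. Z \<omega> = Z' \<omega>"
  using assms unfolding sample_determined_def by blast

lemma sample_determinedI:
  assumes "Z' \<in> borel_measurable (samples {..<K})" "AE \<omega> in M. Z \<omega> = Z' \<omega>"
  shows "sample_determined Z"
  using assms unfolding sample_determined_def by blast

lemma sample_determined_h:
  assumes k: "k < K" and x: "\<And>j. j \<le> k \<Longrightarrow> sample_determined (x j)"
    and h: "\<And>j. j < k \<Longrightarrow> sample_determined (h j)"
  shows "sample_determined (h k)"
proof -
  have xi [measurable]: "xi k i \<in> samples {..<K} \<rightarrow>\<^sub>M D" if "i < N k" for i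
    using k that by (intro xi_samples) auto
  obtain X where [measurable]: "X \<in> borel_measurable (samples {..<K})" and X: "AE \<omega> in M. x k \<omega> = X \<omega>"
    using x[of k] by (auto elim: sample_determinedE)
  show ?thesis
  proof (cases "k mod Q = 0")
    case True
    show ?thesis
    proof (rule sample_determinedI)
      show "(\<lambda>\<omega>. (1 / real (N k)) *\<^sub>R (\<Sum>i<N k. sgrad (X \<omega>) (xi k i \<omega>)))
          \<in> borel_measurable (samples {..<K})"
        by measurable
      show "AE \<omega> in M. h k \<omega> = (1 / real (N k)) *\<^sub>R (\<Sum>i<N k. sgrad (X \<omega>) (xi k i \<omega>))"
        using AE_regular_path X
        by eventually_elim (use regular_path_restart[OF _ k True] in auto)
    qed
  next
    case False
    then have k0: "k - 1 < k" by (cases k) auto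
    obtain Y where [measurable]: "Y \<in> borel_measurable (samples {..<K})"
      and Y: "AE \<omega> in M. x (k - 1) \<omega> = Y \<omega>"
      using x[of "k - 1"] by (auto elim: sample_determinedE)
    obtain H where [measurable]: "H \<in> borel_measurable (samples {..<K})"
      and H: "AE \<omega> in M. h (k - 1) \<omega> = H \<omega>"
      using h[OF k0] by (auto elim: sample_determinedE)
    show ?thesis
    proof (rule sample_determinedI)
      show "(\<lambda>\<omega>. H \<omega> + (1 / real (N k)) *\<^sub>R
          (\<Sum>i<N k. sgrad (X \<omega>) (xi k i \<omega>) - sgrad (Y \<omega>) (xi k i \<omega>))) \<in> borel_measurable (samples {..<K})"
        by measurable
      show "AE \<omega> in M. h k \<omega> = H \<omega> + (1 / real (N k)) *\<^sub>R
          (\<Sum>i<N k. sgrad (X \<omega>) (xi k i \<omega>) - sgrad (Y \<omega>) (xi k i \<omega>))"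
        using AE_regular_path X Y H
        by eventually_elim (use regular_path_recursive[OF _ k False] in auto)
    qed
  qed
qed

lemma sample_determined_step:
  assumes k: "k < K" and "sample_determined (x k)" "sample_determined (l k)" "sample_determined (h k)"
  shows "sample_determined (x (Suc k))" "sample_determined (l (Suc k))"
proof -
  obtain X where [measurable]: "X \<in> borel_measurable (samples {..<K})" and X: "AE \<omega> in M. x k \<omega> = X \<omega>"
    using assms(2) by (rule sample_determinedE)
  obtain L where [measurable]: "L \<in> borel_measurable (samples {..<K})" and L: "AE \<omega> in M. l k \<omega> = L \<omega>"
    using assms(3) by (rule sample_determinedE)
  obtain H where [measurable]: "H \<in> borel_measurable (samples {..<K})" and H: "AE \<omega> in M. h k \<omega> = H \<omega>"
    using assms(4) by (rule sample_determinedE)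
  define Y where "Y \<omega> = X \<omega> + cramer_solution (lalm_matrix (beta P) (rho P) (gA (X \<omega>)))
      (- proj (H \<omega>) - gA (X \<omega>) *v (L \<omega> + rho P *\<^sub>R cU (X \<omega>)))" for \<omega>
  have Y_meas [measurable]: "Y \<in> borel_measurable (samples {..<K})"
    unfolding Y_def[abs_def] by measurable
  have Y: "AE \<omega> in M. x (Suc k) \<omega> = Y \<omega>"
    using AE_regular_path X L H
    by eventually_elim (use regular_path_step(1)[OF _ k] in \<open>simp add: Y_def\<close>)
  show "sample_determined (x (Suc k))"
    by (rule sample_determinedI[OF Y_meas Y])
  show "sample_determined (l (Suc k))"
  proof (rule sample_determinedI)
    show "(\<lambda>\<omega>. L \<omega> + rho P *\<^sub>R cU (Y \<omega>)) \<in> borel_measurable (samples {..<K})"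
      by measurable
    show "AE \<omega> in M. l (Suc k) \<omega> = L \<omega> + rho P *\<^sub>R cU (Y \<omega>)"
      using AE_regular_path L Y by eventually_elim (use regular_path_step(2)[OF _ k] in simp)
  qed
qed

text \<open>Induction along the algorithm, carrying all earlier indices because a recursive
  estimator reads the previous point and the previous estimator. Equality is only almost sure, as
  the update equations are available on regular paths.\<close>

lemma sample_determined_run:
  "k \<le> K \<Longrightarrow> (\<forall>j\<le>k. sample_determined (x j) \<and> sample_determined (l j)) \<and> (\<forall>j<k. sample_determined (h j))"
proof (induction k)
  case 0
  have "AE \<omega> in M. x 0 \<omega> = x0" "AE \<omega> in M. l 0 \<omega> = l0"
    using AE_regular_path by (eventually_elim, simp add: regular_path_def nr_lalm_path_def)+
  then have "sample_determined (x 0)" "sample_determined (l 0)"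
    by - (rule sample_determinedI[OF borel_measurable_const], assumption)+
  then show ?case by auto
next
  case (Suc k)
  then have k: "k < K" and IH: "\<And>j. j \<le> k \<Longrightarrow> sample_determined (x j)"
      "\<And>j. j \<le> k \<Longrightarrow> sample_determined (l j)" "\<And>j. j < k \<Longrightarrow> sample_determined (h j)"
    by auto
  have h: "sample_determined (h k)"
    by (rule sample_determined_h[OF k]) (use IH in auto)
  from sample_determined_step[OF k IH(1)[OF order_refl] IH(2)[OF order_refl] h] IH h
  show ?case
    by (auto simp: le_Suc_eq less_Suc_eq)
qed

lemma sample_determined_errors:
  assumes "k < K"
  shows "sample_determined (\<lambda>\<omega>. norm (dx k \<omega>))" "sample_determined (\<lambda>\<omega>. norm (perr k \<omega>))"
proof -
  have "sample_determined (x k)" "sample_determined (x (Suc k))" "sample_determined (h k)"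
    using sample_determined_run[of K] assms by auto
  then obtain X Y H where [measurable]: "X \<in> borel_measurable (samples {..<K})"
      "Y \<in> borel_measurable (samples {..<K})" "H \<in> borel_measurable (samples {..<K})"
    and AE: "AE \<omega> in M. x k \<omega> = X \<omega>" "AE \<omega> in M. x (Suc k) \<omega> = Y \<omega>" "AE \<omega> in M. h k \<omega> = H \<omega>"
    by (elim sample_determinedE) blast
  have "(\<lambda>\<omega>. norm (Y \<omega> - X \<omega>)) \<in> borel_measurable (samples {..<K})"
    "(\<lambda>\<omega>. norm (proj (H \<omega>) - gf (X \<omega>))) \<in> borel_measurable (samples {..<K})"
    by measurable
  then show "sample_determined (\<lambda>\<omega>. norm (dx k \<omega>))" "sample_determined (\<lambda>\<omega>. norm (perr k \<omega>))"
    using AE by (auto intro!: sample_determinedI simp: dx_def perr_def elim: AE_mp)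
qed

text \<open>Independence of the output index is applied to this sample-determined majorant instead
  of the squared residual itself. The averaging uses indices from 1 on, where \<open>k - 1\<close>
  is the true predecessor.\<close>

definition residual_bound :: "nat \<Rightarrow> 'w \<Rightarrow> real" where
  "residual_bound k \<omega> = C_R_st P * ((norm (dx k \<omega>))\<^sup>2 + (norm (dx (k - 1) \<omega>))\<^sup>2
    + (norm (perr k \<omega>))\<^sup>2 + (norm (perr (k - 1) \<omega>))\<^sup>2)"

lemma sample_determined_residual_bound:
  assumes "k < K"
  shows "sample_determined (residual_bound k)"
proof -
  have "k - 1 < K" using assms by simp
  note sd = sample_determined_errors[OF assms] sample_determined_errors[OF this]
  obtain a where [measurable]: "a \<in> borel_measurable (samples {..<K})"
    and a: "AE \<omega> in M. norm (dx k \<omega>) = a \<omega>" using sd(1) by (rule sample_determinedE)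
  obtain b where [measurable]: "b \<in> borel_measurable (samples {..<K})"
    and b: "AE \<omega> in M. norm (perr k \<omega>) = b \<omega>" using sd(2) by (rule sample_determinedE)
  obtain d where [measurable]: "d \<in> borel_measurable (samples {..<K})"
    and d: "AE \<omega> in M. norm (dx (k - 1) \<omega>) = d \<omega>" using sd(3) by (rule sample_determinedE)
  obtain e where [measurable]: "e \<in> borel_measurable (samples {..<K})"
    and e: "AE \<omega> in M. norm (perr (k - 1) \<omega>) = e \<omega>" using sd(4) by (rule sample_determinedE)
  show ?thesis
  proof (rule sample_determinedI)
    show "(\<lambda>\<omega>. C_R_st P * ((a \<omega>)\<^sup>2 + (d \<omega>)\<^sup>2 + (b \<omega>)\<^sup>2 + (e \<omega>)\<^sup>2)) \<in> borel_measurable (samples {..<K})"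
      by measurable
    show "AE \<omega> in M. residual_bound k \<omega> = C_R_st P * ((a \<omega>)\<^sup>2 + (d \<omega>)\<^sup>2 + (b \<omega>)\<^sup>2 + (e \<omega>)\<^sup>2)"
      using a b d e by eventually_elim (simp only: residual_bound_def)
  qed
qed

lemma C_R_st_nonneg: "0 \<le> C_R_st P"
  by (simp add: C_R_st_def C_lambda_e_def le_max_iff_disj)

lemma nn_integral_residual_bound:
  assumes "k < K"
  shows "(\<integral>\<^sup>+ \<omega>. ennreal (residual_bound k \<omega>) \<partial>M)
    = ennreal (C_R_st P * (Edx k + Edx (k - 1) + Eperr k + Eperr (k - 1)))"
proof -
  have k: "k - 1 < K" using assms by simp
  note int [simp] = dx_sq_integrable[OF assms] dx_sq_integrable[OF k]
    perr_sq_integrable[OF assms] perr_sq_integrable[OF k]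
  have "(\<integral>\<^sup>+ \<omega>. ennreal (residual_bound k \<omega>) \<partial>M) = ennreal (expectation (residual_bound k))"
    unfolding residual_bound_def[abs_def] using C_R_st_nonneg
    by (intro nn_integral_eq_integral integrable_mult_right Bochner_Integration.integrable_add int) auto
  also have "expectation (residual_bound k) = C_R_st P * (Edx k + Edx (k - 1) + Eperr k + Eperr (k - 1))"
    unfolding residual_bound_def[abs_def] Edx_def Eperr_def
    by (simp only: integral_mult_right_zero Bochner_Integration.integral_add
        Bochner_Integration.integrable_add int)
  finally show ?thesis .
qed

section \<open>Averaging over the random output index\<close>

context
  fixes kh :: "'w \<Rightarrow> nat"
  assumes output_index: "uniform_output_index M D N xi K kh" and K2: "2 \<le> K"
begin

lemma kh_measurable [measurable]: "kh \<in> M \<rightarrow>\<^sub>M count_space {1..K - 1}"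
  and kh_distr: "distr M (count_space {1..K - 1}) kh = uniform_count_measure {1..K - 1}"
  using output_index by (auto simp: uniform_output_index_def)

lemma indicator_kh_measurable: "(\<lambda>\<omega>. indicator {k} (kh \<omega>) :: ennreal) \<in> borel_measurable M"
  by (rule measurable_compose[OF kh_measurable]) simp

text \<open>Up to a null set \<open>Z\<close> is measurable for the samples, hence independent of
  the index; the integral factors, and each index value has probability 1 / (K - 1).\<close>

lemma nn_integral_output_index:
  assumes k: "k \<in> {1..K - 1}" and Z: "sample_determined Z"
  shows "(\<integral>\<^sup>+ \<omega>. indicator {k} (kh \<omega>) * ennreal (Z \<omega>) \<partial>M)
    = ennreal (1 / (real K - 1)) * (\<integral>\<^sup>+ \<omega>. ennreal (Z \<omega>) \<partial>M)"
proof -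
  obtain W where W: "W \<in> borel_measurable (samples {..<K})" and ZW: "AE \<omega> in M. Z \<omega> = W \<omega>"
    using Z by (rule sample_determinedE)
  let ?A = "vimage_algebra (space M) kh (count_space {1..K - 1})"
  have indep: "indep_set (sets ?A) (sets (samples {..<K}))"
    using output_index by (simp add: uniform_output_index_def sets_samples)
  have "sets (samples {..<K}) \<subseteq> events"
    using indep unfolding indep_set_def indep_sets_def by (auto split: bool.splits)
  then have [measurable]: "W \<in> borel_measurable M"
    using W by (auto simp: measurable_def)
  have kh: "kh \<in> ?A \<rightarrow>\<^sub>M count_space {1..K - 1}"
    using measurable_space[OF kh_measurable] by (intro measurable_vimage_algebra1) auto
  let ?g = "\<lambda>z. indicator {k} (fst z) * ennreal (snd z)"
  have g: "?g \<in> borel_measurable (count_space {1..K - 1} \<Otimes>\<^sub>M borel)"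
    by (intro borel_measurable_times_ennreal measurable_compose[OF measurable_fst]
        measurable_compose[OF measurable_snd measurable_ennreal]) simp
  have "(\<integral>\<^sup>+ \<omega>. indicator {k} (kh \<omega>) * ennreal (Z \<omega>) \<partial>M) = (\<integral>\<^sup>+ \<omega>. ?g (kh \<omega>, W \<omega>) \<partial>M)"
    using ZW by (intro nn_integral_cong_AE, eventually_elim) simp
  also have "\<dots> = (\<integral>\<^sup>+ \<omega>. \<integral>\<^sup>+ t. ?g (kh \<omega>, t) \<partial>distr M borel W \<partial>M)"
    by (rule nn_integral_indep_set[OF indep _ _ kh W g]) simp_all
  also have "\<dots> = (\<integral>\<^sup>+ \<omega>. indicator {k} (kh \<omega>) * (\<integral>\<^sup>+ \<omega>. ennreal (W \<omega>) \<partial>M) \<partial>M)"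
    by (simp add: nn_integral_cmult nn_integral_distr)
  also have "\<dots> = (\<integral>\<^sup>+ \<omega>. indicator {k} (kh \<omega>) \<partial>M) * (\<integral>\<^sup>+ \<omega>. ennreal (W \<omega>) \<partial>M)"
    by (rule nn_integral_multc[OF indicator_kh_measurable])
  also have "(\<integral>\<^sup>+ \<omega>. indicator {k} (kh \<omega>) \<partial>M)
      = (\<integral>\<^sup>+ j. indicator {k} j \<partial>distr M (count_space {1..K - 1}) kh)"
    by (rule nn_integral_distr[symmetric]) measurable
  also have "\<dots> = emeasure (uniform_count_measure {1..K - 1}) {k}"
    unfolding kh_distr using k by (intro nn_integral_indicator) (simp add: sets_uniform_count_measure)
  also have "\<dots> = ennreal (1 / (real K - 1))"
    using k K2 by (subst emeasure_uniform_count_measure) (auto simp: of_nat_diff)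
  also have "(\<integral>\<^sup>+ \<omega>. ennreal (W \<omega>) \<partial>M) = (\<integral>\<^sup>+ \<omega>. ennreal (Z \<omega>) \<partial>M)"
    using ZW by (intro nn_integral_cong_AE, eventually_elim) simp
  finally show ?thesis .
qed

lemma output_residual:
  assumes B: "B = K" and b: "2 * D_1 P * (L_s P)\<^sup>2 * Q \<le> b"
  shows "(\<integral>\<^sup>+ \<omega>. ennreal ((kkt_residual f c (x (kh \<omega> + 1) \<omega>) (l (kh \<omega> + 1) \<omega>))\<^sup>2) \<partial>M)
    \<le> ennreal (C_st P (f x0) / (real K - 1))"
proof -
  let ?I = "{1..K - 1}"
  let ?R = "\<lambda>k. C_R_st P * (Edx k + Edx (k - 1) + Eperr k + Eperr (k - 1))"
  have I: "k < K" "k - 1 < K" if "k \<in> ?I" for k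
    using that K2 by auto
  have meas: "residual_bound k \<in> borel_measurable M" if "k \<in> ?I" for k
    unfolding residual_bound_def[abs_def] using I[OF that] by measurable
  \<comment> \<open>Exactly one indicator is 1, and the residual is replaced by its majorant before
    independence is used.\<close>
  have "(\<integral>\<^sup>+ \<omega>. ennreal ((kkt_residual f c (x (kh \<omega> + 1) \<omega>) (l (kh \<omega> + 1) \<omega>))\<^sup>2) \<partial>M)
      \<le> (\<integral>\<^sup>+ \<omega>. (\<Sum>k\<in>?I. indicator {k} (kh \<omega>) * ennreal (residual_bound k \<omega>)) \<partial>M)"
  proof (rule nn_integral_mono_AE)
    have "AE \<omega> in M. kh \<omega> \<in> ?I"
      using measurable_space[OF kh_measurable] by (intro AE_I2) auto
    with AE_regular_path
    show "AE \<omega> in M. ennreal ((kkt_residual f c (x (kh \<omega> + 1) \<omega>) (l (kh \<omega> + 1) \<omega>))\<^sup>2)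
        \<le> (\<Sum>k\<in>?I. indicator {k} (kh \<omega>) * ennreal (residual_bound k \<omega>))"
    proof eventually_elim
      case (elim \<omega>)
      then obtain j where j: "kh \<omega> = Suc j" "Suc j < K"
        using K2 by (cases "kh \<omega>") auto
      have "(kkt_residual f c (x (kh \<omega> + 1) \<omega>) (l (kh \<omega> + 1) \<omega>))\<^sup>2 \<le> residual_bound (kh \<omega>) \<omega>"
        using regular_path_bounds(3)[OF elim(1) j(2)] by (simp add: residual_bound_def j(1))
      then have "ennreal ((kkt_residual f c (x (kh \<omega> + 1) \<omega>) (l (kh \<omega> + 1) \<omega>))\<^sup>2)
          \<le> indicator {kh \<omega>} (kh \<omega>) * ennreal (residual_bound (kh \<omega>) \<omega>)"
        by (simp add: ennreal_leI)
      also have "\<dots> \<le> (\<Sum>k\<in>?I. indicator {k} (kh \<omega>) * ennreal (residual_bound k \<omega>))"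
        by (rule member_le_sum[OF elim(2)]) auto
      finally show ?case .
    qed
  qed
  also have "\<dots> = (\<Sum>k\<in>?I. \<integral>\<^sup>+ \<omega>. indicator {k} (kh \<omega>) * ennreal (residual_bound k \<omega>) \<partial>M)"
    by (intro nn_integral_sum borel_measurable_times_ennreal indicator_kh_measurable
        measurable_compose[OF meas measurable_ennreal])
  also have "\<dots> = (\<Sum>k\<in>?I. ennreal (1 / (real K - 1) * ?R k))"
  proof (rule sum.cong[OF refl])
    fix k assume k: "k \<in> ?I"
    have "(\<integral>\<^sup>+ \<omega>. indicator {k} (kh \<omega>) * ennreal (residual_bound k \<omega>) \<partial>M)
        = ennreal (1 / (real K - 1)) * ennreal (?R k)"
      unfolding nn_integral_output_index[OF k sample_determined_residual_bound[OF I(1)[OF k]]]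
        nn_integral_residual_bound[OF I(1)[OF k]] ..
    also have "\<dots> = ennreal (1 / (real K - 1) * ?R k)"
      using K2 C_R_st_nonneg Edx_nonneg Eperr_nonneg by (intro ennreal_mult[symmetric]) auto
    finally show "(\<integral>\<^sup>+ \<omega>. indicator {k} (kh \<omega>) * ennreal (residual_bound k \<omega>) \<partial>M)
        = ennreal (1 / (real K - 1) * ?R k)" .
  qed
  also have "\<dots> = ennreal (\<Sum>k\<in>?I. 1 / (real K - 1) * ?R k)"
    using K2 C_R_st_nonneg Edx_nonneg Eperr_nonneg by (intro sum_ennreal) auto
  also have "\<dots> \<le> ennreal (C_st P (f x0) / (real K - 1))"
  proof (rule ennreal_leI)
    \<comment> \<open>Steps and errors are counted at their own index and at the next one, hence the
      factor 2 in \<open>C_st\<close>. The shifted sum omits the last index and the plain sum omits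
      index 0.\<close>
    have shift: "(\<Sum>k\<in>?I. g (k - 1)) \<le> (\<Sum>k<K. g k)" "(\<Sum>k\<in>?I. g k) \<le> (\<Sum>k<K. g k)"
      if "\<And>k. 0 \<le> g k" for g :: "nat \<Rightarrow> real"
    proof -
      have "(\<Sum>k\<in>?I. g (k - 1)) = (\<Sum>k<K - 1. g k)"
        by (rule sum.reindex_bij_witness[of _ Suc "\<lambda>k. k - 1"]) auto
      also have "\<dots> \<le> (\<Sum>k<K. g k)"
        using that by (intro sum_mono2) auto
      finally show "(\<Sum>k\<in>?I. g (k - 1)) \<le> (\<Sum>k<K. g k)" .
      show "(\<Sum>k\<in>?I. g k) \<le> (\<Sum>k<K. g k)"
        using that K2 by (intro sum_mono2) auto
    qed
    have "(\<Sum>k\<in>?I. Edx k + Edx (k - 1) + Eperr k + Eperr (k - 1))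
        \<le> 2 * (Gamma_p P (f x0) + Gamma_e P (f x0))"
      using shift[of Edx, OF Edx_nonneg] shift[of Eperr, OF Eperr_nonneg] expected_sums[OF B b]
      by (simp add: sum.distrib)
    from mult_left_mono[OF this C_R_st_nonneg]
    have "C_R_st P * (\<Sum>k\<in>?I. Edx k + Edx (k - 1) + Eperr k + Eperr (k - 1)) \<le> C_st P (f x0)"
      by (simp add: C_st_def mult_ac)
    then have "C_R_st P * (\<Sum>k\<in>?I. Edx k + Edx (k - 1) + Eperr k + Eperr (k - 1)) / (real K - 1)
        \<le> C_st P (f x0) / (real K - 1)"
      using K2 by (intro divide_right_mono) auto
    then show "(\<Sum>k\<in>?I. 1 / (real K - 1) * ?R k) \<le> C_st P (f x0) / (real K - 1)"
      by (simp add: sum_distrib_left[symmetric] sum_divide_distrib[symmetric])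
  qed
  finally show ?thesis .
qed

lemma output_measurable:
  "(\<lambda>\<omega>. x (kh \<omega> + 1) \<omega>) \<in> borel_measurable M" "(\<lambda>\<omega>. l (kh \<omega> + 1) \<omega>) \<in> borel_measurable M"
proof -
  have le: "k + 1 \<le> K" if "k \<in> {1..K - 1}" for k
    using that by auto
  show "(\<lambda>\<omega>. x (kh \<omega> + 1) \<omega>) \<in> borel_measurable M"
    by (rule measurable_compose_countable'[OF xlh_measurable(1)[OF le] kh_measurable]) auto
  show "(\<lambda>\<omega>. l (kh \<omega> + 1) \<omega>) \<in> borel_measurable M"
    by (rule measurable_compose_countable'[OF xlh_measurable(2)[OF le] kh_measurable]) auto
qed

text \<open>Both squared norms are summands of the squared residual, so one bound serves
  both.\<close>

lemma output_stochastic_KKT: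
  assumes B: "B = K" and b: "2 * D_1 P * (L_s P)\<^sup>2 * Q \<le> b"
    and "0 < \<epsilon>" and K: "C_st P (f x0) / \<epsilon>\<^sup>2 \<le> real K - 1"
  shows "stochastic_KKT M f c \<epsilon> (\<lambda>\<omega>. x (kh \<omega> + 1) \<omega>) (\<lambda>\<omega>. l (kh \<omega> + 1) \<omega>)"
proof -
  let ?R = "\<lambda>\<omega>. ennreal ((kkt_residual f c (x (kh \<omega> + 1) \<omega>) (l (kh \<omega> + 1) \<omega>))\<^sup>2)"
  have "C_st P (f x0) / (real K - 1) \<le> \<epsilon>\<^sup>2"
    using K K2 \<open>0 < \<epsilon>\<close> by (simp add: field_simps)
  then have le: "(\<integral>\<^sup>+ \<omega>. ?R \<omega> \<partial>M) \<le> ennreal (\<epsilon>\<^sup>2)"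
    using output_residual[OF B b] ennreal_leI order_trans by blast
  have "(\<integral>\<^sup>+ \<omega>. ennreal ((norm (kkt_grad f c (x (kh \<omega> + 1) \<omega>) (l (kh \<omega> + 1) \<omega>)))\<^sup>2) \<partial>M) \<le> (\<integral>\<^sup>+ \<omega>. ?R \<omega> \<partial>M)"
    "(\<integral>\<^sup>+ \<omega>. ennreal ((norm (c (x (kh \<omega> + 1) \<omega>)))\<^sup>2) \<partial>M) \<le> (\<integral>\<^sup>+ \<omega>. ?R \<omega> \<partial>M)"
    by (auto intro!: nn_integral_mono ennreal_leI simp: kkt_residual_def)
  then show ?thesis
    unfolding stochastic_KKT_def using output_measurable le by (auto intro: order_trans)
qed

end
end

section \<open>Complexity\<close>

lemma horizon_exists: "\<exists>K. 2 \<le> K \<and> C / e\<^sup>2 \<le> real K - 1"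
  by (intro exI[of _ "2 + nat \<lceil>C / e\<^sup>2\<rceil>"]) (auto, linarith)

lemma horizon_sufficient: "2 \<le> horizon C e" "C / e\<^sup>2 \<le> real (horizon C e) - 1"
  using LeastI_ex[OF horizon_exists[of C e]] unfolding horizon_def by auto

text \<open>The 3 is the offset 2 plus 1 for rounding up, absorbed into \<open>3 / e\<^sup>2\<close>
  for \<open>e < 1\<close>. The absolute value covers a constant of either sign.\<close>

lemma horizon_le:
  assumes "0 < e" "e < 1"
  shows "real (horizon C e) \<le> (\<bar>C\<bar> + 3) / e\<^sup>2"
proof -
  have "horizon C e \<le> 2 + nat \<lceil>C / e\<^sup>2\<rceil>"
    unfolding horizon_def by (intro Least_le) (auto, linarith)
  also have "real (2 + nat \<lceil>C / e\<^sup>2\<rceil>) \<le> 3 + \<bar>C / e\<^sup>2\<bar>"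
    by linarith
  finally have "real (horizon C e) \<le> 3 + \<bar>C\<bar> / e\<^sup>2"
    by simp
  moreover have "3 \<le> 3 / e\<^sup>2"
    using assms by (simp add: power_le_one field_simps)
  ultimately show ?thesis
    by (simp add: add_divide_distrib)
qed

text \<open>The shift \<open>d\<close> accounts for the constraint evaluation at the initial
  point.\<close>

lemma horizon_bigo_shift: "(\<lambda>e. real (horizon C e) + d) \<in> O[at_right 0](\<lambda>e. 1 / e\<^sup>2)"
proof (rule bigoI)
  show "\<forall>\<^sub>F e in at_right 0. norm (real (horizon C e) + d) \<le> (\<bar>C\<bar> + 3 + \<bar>d\<bar>) * norm (1 / e\<^sup>2)"
    using eventually_at_right_real[OF zero_less_one]
  proof eventually_elim
    case (elim e)
    then have "\<bar>d\<bar> \<le> \<bar>d\<bar> / e\<^sup>2"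
      by (simp add: pos_le_divide_eq power_le_one mult_left_le)
    then show ?case
      using horizon_le[of e C] elim by (simp add: add_divide_distrib)
  qed
qed

section \<open>Counting stochastic gradients\<close>

lemma epoch_length_bounds:
  assumes "2 \<le> K"
  shows "0 < epoch_length K" "K \<le> epoch_length K * epoch_length K" "real (epoch_length K) \<le> 2 * sqrt K"
proof -
  have s: "1 \<le> sqrt K"
    using assms by simp
  have Q: "sqrt K \<le> real (epoch_length K)" "real (epoch_length K) \<le> sqrt K + 1"
    using s unfolding epoch_length_def by linarith+
  show "0 < epoch_length K"
    using Q s by linarith
  have "sqrt K * sqrt K \<le> real (epoch_length K) * real (epoch_length K)"
    using Q s by (intro mult_mono) auto
  then have "real K \<le> real (epoch_length K * epoch_length K)"
    by simp
  then show "K \<le> epoch_length K * epoch_length K"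
    by (simp only: of_nat_le_iff)
  show "real (epoch_length K) \<le> 2 * sqrt K"
    using Q s by linarith
qed

text \<open>At most \<open>Q\<close> restarts of cost \<open>K\<close> are followed by recursive
  updates of cost \<open>2 * b\<close>, with \<open>b\<close> at most proportional to
  \<open>Q\<close>. Both contributions are at most of order K Q; \<open>Q\<close> near the square
  root of \<open>K\<close> balances restarts against updates.\<close>

lemma sgrad_evals_le:
  assumes "2 \<le> K" and a: "0 \<le> 2 * D_1 P * (L_s P)\<^sup>2" (is "0 \<le> ?a")
  shows "real (sgrad_evals (epoch_length K) K (minibatch P K) K) \<le> 2 * (5 + 2 * ?a) * (K * sqrt K)"
proof -
  define Q where "Q = epoch_length K"
  define b where "b = minibatch P K"
  note Q = epoch_length_bounds[OF assms(1), folded Q_def]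
  \<comment> \<open>Restarts are multiples of \<open>Q\<close> below \<open>K\<close>, and
    \<open>K\<close> is at most \<open>Q * Q\<close>, so their quotients are below
    \<open>Q\<close>.\<close>
  have "{k\<in>{..<K}. k mod Q = 0} \<subseteq> (\<lambda>j. Q * j) ` {..<Q}"
  proof
    fix k assume "k \<in> {k\<in>{..<K}. k mod Q = 0}"
    then have k: "k < Q * Q" "k = Q * (k div Q)"
      using Q by auto
    then have "k div Q < Q"
      by (metis Q(1) less_mult_imp_div_less)
    then show "k \<in> (\<lambda>j. Q * j) ` {..<Q}"
      using k by blast
  qed
  then have "card {k\<in>{..<K}. k mod Q = 0} \<le> card ((\<lambda>j. Q * j) ` {..<Q})"
    by (intro card_mono) auto
  also have "\<dots> \<le> Q"
    using card_image_le[of "{..<Q}" "\<lambda>j. Q * j"] by simp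
  finally have card: "card {k\<in>{..<K}. k mod Q = 0} \<le> Q" .
  have "sgrad_evals Q K b K \<le> (\<Sum>k<K. (if k mod Q = 0 then K else 0) + 2 * b)"
    unfolding sgrad_evals_def by (intro sum_mono) auto
  also have "\<dots> = card {k\<in>{..<K}. k mod Q = 0} * K + K * (2 * b)"
    by (simp add: sum.distrib sum.If_cases Int_def)
  also have "\<dots> \<le> Q * K + K * (2 * b)"
    using card by simp
  finally have "real (sgrad_evals Q K b K) \<le> real (Q * K + K * (2 * b))"
    by (simp only: of_nat_le_iff)
  \<comment> \<open>Rounding up and the maximum with 1 cost at most 2, absorbed in
    \<open>2 * Q\<close>. Doubling for the cost of an update and adding one K Q for the restarts
    gives 5 + 2 \<open>?a\<close>.\<close>
  moreover have "real b \<le> (2 + ?a) * Q"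
  proof -
    have "real b \<le> 2 + ?a * Q"
      using a unfolding b_def minibatch_def Q_def[symmetric] by (simp add: max_def) linarith
    moreover have "(2::real) \<le> 2 * Q"
      using Q(1) by simp
    ultimately show ?thesis
      by (simp add: algebra_simps)
  qed
  then have "K * (2 * real b) \<le> K * (2 * ((2 + ?a) * Q))"
    by (intro mult_left_mono) auto
  ultimately have "real (sgrad_evals Q K b K) \<le> (5 + 2 * ?a) * (K * real Q)"
    by (simp add: algebra_simps)
  also have "\<dots> \<le> (5 + 2 * ?a) * (K * (2 * sqrt K))"
    using Q(3) a by (intro mult_left_mono) auto
  finally show ?thesis
    by (simp add: Q_def b_def mult_ac)
qed

text \<open>The horizon is of order \<open>1 / e\<^sup>2\<close>, and the count grows like its power
  3/2.\<close>

lemma sgrad_evals_bigo: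
  assumes a: "0 \<le> 2 * D_1 P * (L_s P)\<^sup>2"
  shows "(\<lambda>e. let K = horizon C e in real (sgrad_evals (epoch_length K) K (minibatch P K) K))
    \<in> O[at_right 0](\<lambda>e. 1 / e ^ 3)"
proof (rule bigoI)
  let ?A = "\<bar>C\<bar> + 3"
  let ?c = "2 * (5 + 2 * (2 * D_1 P * (L_s P)\<^sup>2))"
  show "\<forall>\<^sub>F e in at_right 0.
      norm (let K = horizon C e in real (sgrad_evals (epoch_length K) K (minibatch P K) K))
      \<le> (?c * (?A * sqrt ?A)) * norm (1 / e ^ 3)"
    using eventually_at_right_real[OF zero_less_one]
  proof eventually_elim
    case (elim e)
    define K where "K = horizon C e"
    have K: "real K \<le> ?A / e\<^sup>2"
      using horizon_le[of e C] elim by (simp add: K_def)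
    then have "sqrt K \<le> sqrt (?A / e\<^sup>2)"
      by (rule real_sqrt_le_mono)
    also have "\<dots> = sqrt ?A / e"
      using elim by (simp add: real_sqrt_divide)
    finally have "K * sqrt K \<le> (?A / e\<^sup>2) * (sqrt ?A / e)"
      using K elim by (intro mult_mono) auto
    also have "\<dots> = ?A * sqrt ?A / e ^ 3"
      by (simp add: power2_eq_square power3_eq_cube)
    finally have "?c * (K * sqrt K) \<le> ?c * (?A * sqrt ?A / e ^ 3)"
      using a by (intro mult_left_mono) auto
    with sgrad_evals_le[OF horizon_sufficient(1)[of C e] a, folded K_def] elim
    show ?case
      by (simp add: K_def[symmetric] Let_def)
  qed
qed

lemma minibatch_bounds:
  "0 < minibatch P K" "2 * D_1 P * (L_s P)\<^sup>2 * real (epoch_length K) \<le> real (minibatch P K)"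
proof -
  show "0 < minibatch P K"
    by (simp add: minibatch_def)
  have "2 * D_1 P * (L_s P)\<^sup>2 * real (epoch_length K)
      \<le> real (nat \<lceil>2 * D_1 P * (L_s P)\<^sup>2 * real (epoch_length K)\<rceil>)"
    by (rule real_nat_ceiling_ge)
  also have "\<dots> \<le> real (minibatch P K)"
    unfolding minibatch_def by simp
  finally show "2 * D_1 P * (L_s P)\<^sup>2 * real (epoch_length K) \<le> real (minibatch P K)" .
qed

theorem theorem3p6:
  fixes P :: lalm_consts and U :: "(real^'n) set"
    and f :: "real^'n \<Rightarrow> real" and c :: "real^'n \<Rightarrow> real^'m"
    and D :: "'s measure" and F :: "real^'n \<Rightarrow> 's \<Rightarrow> real"
    and x0 :: "real^'n" and l0 :: "real^'m"
  assumes "regularity_assumption P U f c"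
    and "oracle_assumption P U f D F"
    and "parameter_assumption P c x0 l0"
  shows
    "(\<forall>(K::nat) (M::'w measure) xi x l h kh.
        2 \<le> K \<and> admissible_run P U c D F x0 l0 K M xi x l h kh \<longrightarrow>
        (\<integral>\<^sup>+ \<omega>. ennreal ((kkt_residual f c (x (kh \<omega> + 1) \<omega>) (l (kh \<omega> + 1) \<omega>))\<^sup>2) \<partial>M)
          \<le> ennreal (C_st P (f x0) / (real K - 1)) \<and>
        (\<forall>\<epsilon>>0. real K - 1 \<ge> C_st P (f x0) / \<epsilon>\<^sup>2 \<longrightarrow>
           stochastic_KKT M f c \<epsilon> (\<lambda>\<omega>. x (kh \<omega> + 1) \<omega>) (\<lambda>\<omega>. l (kh \<omega> + 1) \<omega>))) \<and>
     (\<forall>\<epsilon>>0. 2 \<le> horizon (C_st P (f x0)) \<epsilon> \<and>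
        (\<forall>(M::'w measure) xi x l h kh.
          admissible_run P U c D F x0 l0 (horizon (C_st P (f x0)) \<epsilon>) M xi x l h kh \<longrightarrow>
          stochastic_KKT M f c \<epsilon> (\<lambda>\<omega>. x (kh \<omega> + 1) \<omega>) (\<lambda>\<omega>. l (kh \<omega> + 1) \<omega>))) \<and>
     (\<lambda>\<epsilon>. real (horizon (C_st P (f x0)) \<epsilon>)) \<in> O[at_right 0](\<lambda>\<epsilon>. 1 / \<epsilon>\<^sup>2) \<and>
     (\<lambda>\<epsilon>. real (constraint_evals (horizon (C_st P (f x0)) \<epsilon>))) \<in> O[at_right 0](\<lambda>\<epsilon>. 1 / \<epsilon>\<^sup>2) \<and>
     (\<lambda>\<epsilon>. real (jacobian_evals (horizon (C_st P (f x0)) \<epsilon>))) \<in> O[at_right 0](\<lambda>\<epsilon>. 1 / \<epsilon>\<^sup>2) \<and>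
     (\<lambda>\<epsilon>. real (linear_solves (horizon (C_st P (f x0)) \<epsilon>))) \<in> O[at_right 0](\<lambda>\<epsilon>. 1 / \<epsilon>\<^sup>2) \<and>
     (\<lambda>\<epsilon>. let K = horizon (C_st P (f x0)) \<epsilon>
           in real (sgrad_evals (epoch_length K) K (minibatch P K) K))
       \<in> O[at_right 0](\<lambda>\<epsilon>. 1 / \<epsilon> ^ 3)"
proof (intro conjI)
  let ?C = "C_st P (f x0)"
  have bounds: "(\<integral>\<^sup>+ \<omega>. ennreal ((kkt_residual f c (x (kh \<omega> + 1) \<omega>) (l (kh \<omega> + 1) \<omega>))\<^sup>2) \<partial>M)
        \<le> ennreal (?C / (real K - 1)) \<and>
      (\<forall>\<epsilon>>0. real K - 1 \<ge> ?C / \<epsilon>\<^sup>2 \<longrightarrow>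
        stochastic_KKT M f c \<epsilon> (\<lambda>\<omega>. x (kh \<omega> + 1) \<omega>) (\<lambda>\<omega>. l (kh \<omega> + 1) \<omega>))"
    if K: "2 \<le> K" and adm: "admissible_run P U c D F x0 l0 K M xi x l h kh"
    for K and M :: "'w measure" and xi x l h kh
  proof -
    interpret prob_space M
      using adm by (simp add: admissible_run_def stochastic_nr_lalm_def)
    \<comment> \<open>The restart batch size and the number of iterations are both \<open>K\<close>,
      so the condition \<open>B = K\<close> becomes reflexivity.\<close>
    interpret stochastic_lalm_run M P U f c D F x0 l0 "epoch_length K" K "minibatch P K" K xi x l h
      using assms adm K epoch_length_bounds(1)[OF K] minibatch_bounds(1)[of P K]
      by unfold_locales (simp_all add: admissible_run_def)
    have "uniform_output_index M D N xi K kh"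
      using adm by (simp add: admissible_run_def)
    from output_residual[OF this K refl minibatch_bounds(2)]
      output_stochastic_KKT[OF this K refl minibatch_bounds(2)]
    show ?thesis by blast
  qed
  show "\<forall>(K::nat) (M::'w measure) xi x l h kh.
      2 \<le> K \<and> admissible_run P U c D F x0 l0 K M xi x l h kh \<longrightarrow>
      (\<integral>\<^sup>+ \<omega>. ennreal ((kkt_residual f c (x (kh \<omega> + 1) \<omega>) (l (kh \<omega> + 1) \<omega>))\<^sup>2) \<partial>M)
        \<le> ennreal (?C / (real K - 1)) \<and>
      (\<forall>\<epsilon>>0. real K - 1 \<ge> ?C / \<epsilon>\<^sup>2 \<longrightarrow>
         stochastic_KKT M f c \<epsilon> (\<lambda>\<omega>. x (kh \<omega> + 1) \<omega>) (\<lambda>\<omega>. l (kh \<omega> + 1) \<omega>))"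
    by (intro allI impI, elim conjE, rule bounds)
  show "\<forall>\<epsilon>>0. 2 \<le> horizon ?C \<epsilon> \<and>
      (\<forall>(M::'w measure) xi x l h kh.
        admissible_run P U c D F x0 l0 (horizon ?C \<epsilon>) M xi x l h kh \<longrightarrow>
        stochastic_KKT M f c \<epsilon> (\<lambda>\<omega>. x (kh \<omega> + 1) \<omega>) (\<lambda>\<omega>. l (kh \<omega> + 1) \<omega>))"
  proof (intro allI impI conjI)
    fix \<epsilon> :: real and M :: "'w measure" and xi x l h kh
    assume "0 < \<epsilon>" and adm: "admissible_run P U c D F x0 l0 (horizon ?C \<epsilon>) M xi x l h kh"
    then show "stochastic_KKT M f c \<epsilon> (\<lambda>\<omega>. x (kh \<omega> + 1) \<omega>) (\<lambda>\<omega>. l (kh \<omega> + 1) \<omega>)"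
      using conjunct2[OF bounds[OF horizon_sufficient(1) adm]] horizon_sufficient(2)[of ?C \<epsilon>]
      by simp
  qed (rule horizon_sufficient(1))
  show "(\<lambda>\<epsilon>. real (horizon ?C \<epsilon>)) \<in> O[at_right 0](\<lambda>\<epsilon>. 1 / \<epsilon>\<^sup>2)"
    "(\<lambda>\<epsilon>. real (jacobian_evals (horizon ?C \<epsilon>))) \<in> O[at_right 0](\<lambda>\<epsilon>. 1 / \<epsilon>\<^sup>2)"
    "(\<lambda>\<epsilon>. real (linear_solves (horizon ?C \<epsilon>))) \<in> O[at_right 0](\<lambda>\<epsilon>. 1 / \<epsilon>\<^sup>2)"
    using horizon_bigo_shift[of ?C 0] by (simp_all add: jacobian_evals_def linear_solves_def)
  show "(\<lambda>\<epsilon>. real (constraint_evals (horizon ?C \<epsilon>))) \<in> O[at_right 0](\<lambda>\<epsilon>. 1 / \<epsilon>\<^sup>2)"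
    using horizon_bigo_shift[of ?C 1] by (simp add: constraint_evals_def add.commute)
  have "0 < beta P" "0 < rho P" "0 < sigma_c P"
    using assms by (auto simp: parameter_assumption_def regularity_assumption_def)
  then have "0 \<le> 2 * D_1 P * (L_s P)\<^sup>2"
    by (simp add: D_1_def C_e_star_def C_lambda_e_def)
  then show "(\<lambda>\<epsilon>. let K = horizon ?C \<epsilon>
        in real (sgrad_evals (epoch_length K) K (minibatch P K) K)) \<in> O[at_right 0](\<lambda>\<epsilon>. 1 / \<epsilon> ^ 3)"
    by (rule sgrad_evals_bigo)
qed

end
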